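(* Let $U=(u_{ax})_{a\in V(H),x\in V(G)}$ be a quantum isomorphism from a graph $G$ to a graph $H$. Let $x\in V(G)$ and let $b_1,\dots,b_k$ be the blocks of $G$ containing $x$. Let $a\in V(H)$ and let $d_1,\dots,d_l$ be the blocks of $H$ containing $a$. If $u_{ax}\neq 0$, then $k=l$ and, up to reordering, $G[b_i]\simeq_q H[d_i]$ for every $1\leq i\leq k$.
   Context: All graphs are finite and simple. $\mathrm{Adj}(G)$ is the adjacency matrix, and $G[S]$ is the subgraph induced on $S\subseteq V(G)$. Quantum isomorphism: a magic unitary with coefficients in a (nonzero) unital $C^*$-algebra $X$ is a matrix $U=(u_{ij})_{i\in I,j\in J}$ with $I,J$ finite, $u_{ij}=u_{ij}^2=u_{ij}^*\in X$, and $\sum_{k\in I}u_{kj}=1=\sum_{k\in J}u_{ik}$ for all $i\in I,j\in J$. A quantum isomorphism from a graph $G$ to a graph $H$ with the same number of vertices is a magic unitary $U$ indexed by $V(H)\times V(G)$ with $U\,\mathrm{Adj}(G)=\mathrm{Adj}(H)\,U$. $G\simeq_q H$ (quantum isomorphic) means that such a $U$ exists over some nonzero unital $C^*$-algebra. Blocks: a graph is 2-connected if it is connected and for every vertex $v$ the graph $G\setminus\{v\}$ is connected and nonempty (so $K_2$ is 2-connected and $K_1$ is not). A block of $G$ is a maximal 2-connected subgraph of $G$; a block is also identified with its vertex set. *)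

theory Defs
  imports "HOL-Algebra.Module" "HOL-Library.Countable_Set" "HOL-Combinatorics.Permutations" "Graph_Theory.Digraph_Component"
begin

section \<open>Unital C*-algebras\<close>

text \<open>
  Algebras are records with an explicit carrier, so that one can quantify existentially over them
  and so that corners and subalgebras need no new type.
\<close>

record 'x cstar = "(complex, 'x) module" +
  star :: "'x \<Rightarrow> 'x"
  nrm :: "'x \<Rightarrow> real"

definition complex_ring :: "complex ring" where
  "complex_ring = \<lparr>carrier = UNIV, monoid.mult = (*), one = 1, zero = 0, add = (+)\<rparr>"

locale unital_cstar_algebra =
  Module.module complex_ring A + ring A for A :: "'x cstar" (structure) +
  assumes one_neq_zero: "\<one> \<noteq> \<zero>"
    and smult_mult_left: "\<lbrakk>x \<in> carrier A; y \<in> carrier A\<rbrakk> \<Longrightarrow> (c \<odot> x) \<otimes> y = c \<odot> (x \<otimes> y)"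
    and smult_mult_right: "\<lbrakk>x \<in> carrier A; y \<in> carrier A\<rbrakk> \<Longrightarrow> x \<otimes> (c \<odot> y) = c \<odot> (x \<otimes> y)"
    and star_closed: "x \<in> carrier A \<Longrightarrow> star A x \<in> carrier A"
    and star_star: "x \<in> carrier A \<Longrightarrow> star A (star A x) = x"
    and star_add: "\<lbrakk>x \<in> carrier A; y \<in> carrier A\<rbrakk> \<Longrightarrow> star A (x \<oplus> y) = star A x \<oplus> star A y"
    and star_smult: "x \<in> carrier A \<Longrightarrow> star A (c \<odot> x) = cnj c \<odot> star A x"
    and star_mult: "\<lbrakk>x \<in> carrier A; y \<in> carrier A\<rbrakk> \<Longrightarrow> star A (x \<otimes> y) = star A y \<otimes> star A x"
    and nrm_nonneg: "x \<in> carrier A \<Longrightarrow> 0 \<le> nrm A x"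
    and nrm_eq_zero: "x \<in> carrier A \<Longrightarrow> nrm A x = 0 \<longleftrightarrow> x = \<zero>"
    and nrm_triangle: "\<lbrakk>x \<in> carrier A; y \<in> carrier A\<rbrakk> \<Longrightarrow> nrm A (x \<oplus> y) \<le> nrm A x + nrm A y"
    and nrm_smult: "x \<in> carrier A \<Longrightarrow> nrm A (c \<odot> x) = cmod c * nrm A x"
    and nrm_mult: "\<lbrakk>x \<in> carrier A; y \<in> carrier A\<rbrakk> \<Longrightarrow> nrm A (x \<otimes> y) \<le> nrm A x * nrm A y"
    and cstar_identity: "x \<in> carrier A \<Longrightarrow> nrm A (star A x \<otimes> x) = (nrm A x)\<^sup>2"
    and nrm_complete:
      "\<lbrakk>\<And>n. s n \<in> carrier A;
        \<And>e. 0 < e \<Longrightarrow> \<exists>N. \<forall>m\<ge>N. \<forall>n\<ge>N. nrm A (s m \<ominus> s n) < e\<rbrakk>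
       \<Longrightarrow> \<exists>l\<in>carrier A. (\<lambda>n. nrm A (s n \<ominus> l)) \<longlonglongrightarrow> 0"


section \<open>Quantum isomorphisms\<close>

definition magic_unitary :: "'x cstar \<Rightarrow> 'i set \<Rightarrow> 'j set \<Rightarrow> ('i \<Rightarrow> 'j \<Rightarrow> 'x) \<Rightarrow> bool" where
  "magic_unitary A I J U \<longleftrightarrow> finite I \<and> finite J \<and>
     (\<forall>i\<in>I. \<forall>j\<in>J. U i j \<in> carrier A \<and> U i j \<otimes>\<^bsub>A\<^esub> U i j = U i j \<and> star A (U i j) = U i j) \<and>
     (\<forall>j\<in>J. (\<Oplus>\<^bsub>A\<^esub>k\<in>I. U k j) = \<one>\<^bsub>A\<^esub>) \<and>
     (\<forall>i\<in>I. (\<Oplus>\<^bsub>A\<^esub>k\<in>J. U i k) = \<one>\<^bsub>A\<^esub>)"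

definition adj_matrix :: "'x cstar \<Rightarrow> ('v, 'e) pre_digraph \<Rightarrow> 'v \<Rightarrow> 'v \<Rightarrow> 'x" where
  "adj_matrix A G y z = (if y \<rightarrow>\<^bsub>G\<^esub> z then \<one>\<^bsub>A\<^esub> else \<zero>\<^bsub>A\<^esub>)"

definition matrix_prod ::
    "'x cstar \<Rightarrow> 'k set \<Rightarrow> ('i \<Rightarrow> 'k \<Rightarrow> 'x) \<Rightarrow> ('k \<Rightarrow> 'j \<Rightarrow> 'x) \<Rightarrow> 'i \<Rightarrow> 'j \<Rightarrow> 'x" where
  "matrix_prod A K M N i j = (\<Oplus>\<^bsub>A\<^esub>k\<in>K. M i k \<otimes>\<^bsub>A\<^esub> N k j)"

definition quantum_isomorphism ::
    "'x cstar \<Rightarrow> ('v, 'e) pre_digraph \<Rightarrow> ('w, 'f) pre_digraph \<Rightarrow> ('w \<Rightarrow> 'v \<Rightarrow> 'x) \<Rightarrow> bool" where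
  "quantum_isomorphism A G H U \<longleftrightarrow>
     card (verts G) = card (verts H) \<and>
     magic_unitary A (verts H) (verts G) U \<and>
     (\<forall>a\<in>verts H. \<forall>x\<in>verts G.
        matrix_prod A (verts G) U (adj_matrix A G) a x =
        matrix_prod A (verts H) (adj_matrix A H) U a x)"

text \<open>
  HOL cannot quantify over types inside a formula, so the C*-algebra witnessing
  \<open>G \<simeq>\<^sub>q H\<close> has its carrier in the fixed type \<^typ>\<open>nat \<Rightarrow> real\<close>.  No witness is lost: the entries of a
  magic unitary generate a separable C*-subalgebra, which has at most continuum many elements.
  This is the content of \<open>quantum_isomorphicI\<close> below.
\<close>

definition quantum_isomorphic :: "('v, 'e) pre_digraph \<Rightarrow> ('w, 'f) pre_digraph \<Rightarrow> bool" where
  "quantum_isomorphic G H \<longleftrightarrow>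
     (\<exists>(A :: (nat \<Rightarrow> real) cstar) U. unital_cstar_algebra A \<and> quantum_isomorphism A G H U)"


section \<open>Blocks\<close>

text \<open>
  A finite simple graph is a \<^const>\<open>Digraph.graph\<close>, i.e. a finite loop-free digraph without parallel
  arcs whose arc relation is symmetric.  \<^const>\<open>Digraph_Component.subgraph\<close> also admits non-symmetric
  subdigraphs, which is why \<open>two_connected\<close> asks for a \<^const>\<open>Digraph.graph\<close>.
\<close>

definition two_connected :: "('v, 'e) pre_digraph \<Rightarrow> bool" where
  "two_connected G \<longleftrightarrow> Digraph.graph G \<and> Digraph_Component.connected G \<and>
     (\<forall>v\<in>verts G. verts (pre_digraph.del_vert G v) \<noteq> {} \<and>
                  Digraph_Component.connected (pre_digraph.del_vert G v))"

definition block :: "('v, 'e) pre_digraph \<Rightarrow> ('v, 'e) pre_digraph \<Rightarrow> bool" where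
  "block G B \<longleftrightarrow> pre_digraph.max_subgraph G two_connected B"


section \<open>Independence of the carrier type\<close>

text \<open>
  A magic unitary over a C*-algebra \<open>A\<close> of any type has its entries in the norm closure \<open>K\<close> of a
  countable set that is stable under the *-algebra operations with scalars from a countable dense
  subset of the complex plane.  The distances to the members of that set embed \<open>K\<close> into
  \<^typ>\<open>nat \<Rightarrow> real\<close>, and the structure of \<open>K\<close> is transported along this embedding.
\<close>

lemma complex_ring_simps [simp]:
  "carrier complex_ring = UNIV" "monoid.mult complex_ring = (*)" "one complex_ring = 1"
  "zero complex_ring = 0" "add complex_ring = (+)"
  by (simp_all add: complex_ring_def)

lemma cring_complex_ring: "cring complex_ring"
  by (rule cringI, rule abelian_groupI, auto intro!: comm_monoidI exI[of _ "- _"] simp: algebra_simps)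

context unital_cstar_algebra begin

lemma minus_smult: "x \<in> carrier A \<Longrightarrow> \<ominus> x = (-1) \<odot> x"
proof -
  assume x: "x \<in> carrier A"
  have "(-1) \<odot> x \<oplus> x = ((-1) + 1) \<odot> x"
    using x smult_l_distr[of "-1" 1 x] smult_one[of x] by simp
  also have "\<dots> = \<zero>" using smult_l_null[of x] x by simp
  finally show ?thesis using x by (metis M.minus_equality complex_ring_simps(1) iso_tuple_UNIV_I smult_closed)
qed

lemma nrm_minus_commute: "x \<in> carrier A \<Longrightarrow> y \<in> carrier A \<Longrightarrow> nrm A (x \<ominus> y) = nrm A (y \<ominus> x)"
proof -
  assume xy: "x \<in> carrier A" "y \<in> carrier A"
  have "x \<ominus> y = \<ominus> (y \<ominus> x)" using xy by algebra
  then show ?thesis using xy by (simp add: minus_smult nrm_smult)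
qed

lemma nrm_minus_triangle:
  "x \<in> carrier A \<Longrightarrow> y \<in> carrier A \<Longrightarrow> z \<in> carrier A \<Longrightarrow> nrm A (x \<ominus> z) \<le> nrm A (x \<ominus> y) + nrm A (y \<ominus> z)"
proof -
  assume xyz: "x \<in> carrier A" "y \<in> carrier A" "z \<in> carrier A"
  have "x \<ominus> z = (x \<ominus> y) \<oplus> (y \<ominus> z)" using xyz by algebra
  then show ?thesis using xyz nrm_triangle[of "x \<ominus> y" "y \<ominus> z"] by simp
qed

lemma nrm_star: assumes "x \<in> carrier A" shows "nrm A (star A x) = nrm A x"
proof -
  have le: "nrm A y \<le> nrm A (star A y)" if y: "y \<in> carrier A" for y
  proof (cases "nrm A y = 0")
    case True then show ?thesis using nrm_nonneg star_closed y by simp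
  next
    case False
    then have "nrm A y > 0" using nrm_nonneg[OF y] by simp
    moreover have "nrm A y * nrm A y \<le> nrm A (star A y) * nrm A y"
      using cstar_identity[OF y] nrm_mult[OF star_closed[OF y] y] by (simp add: power2_eq_square)
    ultimately show ?thesis by simp
  qed
  show ?thesis using le[OF assms] le[OF star_closed[OF assms]] star_star[OF assms] by simp
qed

end

definition pullback :: "'x cstar \<Rightarrow> 'x set \<Rightarrow> ('x \<Rightarrow> 'y) \<Rightarrow> 'y cstar" where
  "pullback A K f = (let h = inv_into K f in
     \<lparr>carrier = f ` K, monoid.mult = (\<lambda>p q. f (h p \<otimes>\<^bsub>A\<^esub> h q)), one = f \<one>\<^bsub>A\<^esub>, zero = f \<zero>\<^bsub>A\<^esub>,
      add = (\<lambda>p q. f (h p \<oplus>\<^bsub>A\<^esub> h q)), smult = (\<lambda>c p. f (c \<odot>\<^bsub>A\<^esub> h p)),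
      star = (\<lambda>p. f (star A (h p))), nrm = (\<lambda>p. nrm A (h p))\<rparr>)"

locale closed_star_subalgebra = unital_cstar_algebra +
  fixes K
  assumes sub: "K \<subseteq> carrier A"
    and K_zero: "\<zero> \<in> K" and K_one: "\<one> \<in> K"
    and K_add: "x \<in> K \<Longrightarrow> y \<in> K \<Longrightarrow> x \<oplus> y \<in> K"
    and K_mult: "x \<in> K \<Longrightarrow> y \<in> K \<Longrightarrow> x \<otimes> y \<in> K"
    and K_smult: "x \<in> K \<Longrightarrow> c \<odot> x \<in> K"
    and K_star: "x \<in> K \<Longrightarrow> star A x \<in> K"
    and K_closed: "\<lbrakk>\<And>n. s n \<in> K; l \<in> carrier A; (\<lambda>n. nrm A (s n \<ominus> l)) \<longlonglongrightarrow> 0\<rbrakk> \<Longrightarrow> l \<in> K"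
begin

context
  fixes f :: "'a \<Rightarrow> 'y" assumes inj: "inj_on f K"
begin

abbreviation "h \<equiv> inv_into K f"
abbreviation "B \<equiv> pullback A K f"

lemma hf[simp]: "x \<in> K \<Longrightarrow> h (f x) = x"
  using inj by (rule inv_into_f_f)

lemma B_simps:
  "carrier B = f ` K" "monoid.mult B p q = f (h p \<otimes> h q)" "\<one>\<^bsub>B\<^esub> = f \<one>" "\<zero>\<^bsub>B\<^esub> = f \<zero>"
  "p \<oplus>\<^bsub>B\<^esub> q = f (h p \<oplus> h q)" "c \<odot>\<^bsub>B\<^esub> p = f (c \<odot> h p)" "star B p = f (star A (h p))"
  "nrm B p = nrm A (h p)"
  by (simp_all add: pullback_def Let_def)

lemma KA[simp]: "x \<in> K \<Longrightarrow> x \<in> carrier A" using sub by auto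

lemmas K_rules = K_zero K_one K_add K_mult K_smult K_star

lemma K_minus: "x \<in> K \<Longrightarrow> \<ominus> x \<in> K" by (simp add: minus_smult K_smult)

lemma K_diff: "x \<in> K \<Longrightarrow> y \<in> K \<Longrightarrow> x \<ominus> y \<in> K" by (simp add: a_minus_def K_minus K_add)

lemma ring_B: "ring B"
proof (rule ringI)
  show "abelian_group B"
  proof (rule abelian_groupI)
    fix p assume "p \<in> carrier B"
    then obtain x where x: "x \<in> K" "p = f x" by (auto simp: B_simps)
    then show "\<exists>y\<in>carrier B. y \<oplus>\<^bsub>B\<^esub> p = \<zero>\<^bsub>B\<^esub>"
      by (intro bexI[of _ "f (\<ominus> x)"]) (auto simp: B_simps K_minus M.l_neg)
  qed (auto simp: B_simps K_rules M.a_assoc intro!: arg_cong[where f=f] intro: M.a_comm)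
  show "monoid B"
    by (rule monoidI) (auto simp: B_simps K_rules m_assoc)
qed (auto simp: B_simps K_rules l_distr r_distr)

lemma module_B: "Module.module complex_ring B"
proof -
  interpret B: ring B by (rule ring_B)
  show ?thesis
    by (rule moduleI[OF cring_complex_ring B.is_abelian_group])
       (use smult_l_distr smult_r_distr smult_assoc1 smult_one in \<open>auto simp: B_simps K_rules\<close>)
qed

lemma f_minus: assumes "x \<in> K" "y \<in> K" shows "f x \<ominus>\<^bsub>B\<^esub> f y = f (x \<ominus> y)"
proof -
  interpret B: ring B by (rule ring_B)
  have "\<ominus>\<^bsub>B\<^esub> f y = f (\<ominus> y)"
    by (rule B.minus_equality) (use assms in \<open>auto simp: B_simps K_minus M.l_neg\<close>)
  then show ?thesis using assms by (simp add: a_minus_def B_simps K_minus)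
qed

lemma cstar_B: "unital_cstar_algebra B"
proof -
  interpret B: ring B by (rule ring_B)
  interpret Bm: Module.module complex_ring B by (rule module_B)
  show ?thesis
  proof
    show "\<one>\<^bsub>B\<^esub> \<noteq> \<zero>\<^bsub>B\<^esub>" using one_neq_zero inj K_zero K_one by (auto simp: B_simps inj_on_eq_iff)
    fix p assume "p \<in> carrier B"
    then obtain x where x: "x \<in> K" "p = f x" by (auto simp: B_simps)
    then show "(nrm B p = 0) = (p = \<zero>\<^bsub>B\<^esub>)"
      using inj K_zero by (auto simp: B_simps nrm_eq_zero inj_on_eq_iff)
  next
    fix s :: "nat \<Rightarrow> 'y"
    assume s: "\<And>n. s n \<in> carrier B"
      and C: "\<And>e. 0 < e \<Longrightarrow> \<exists>N. \<forall>m\<ge>N. \<forall>n\<ge>N. nrm B (s m \<ominus>\<^bsub>B\<^esub> s n) < e"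
    have "\<forall>n. \<exists>x\<in>K. s n = f x" using s by (auto simp: B_simps)
    then obtain t where t: "\<And>n. t n \<in> K" "\<And>n. s n = f (t n)" by metis
    have st: "nrm B (f x \<ominus>\<^bsub>B\<^esub> f y) = nrm A (x \<ominus> y)" if "x \<in> K" "y \<in> K" for x y
      using that by (simp add: f_minus B_simps K_diff)
    obtain l where l: "l \<in> carrier A" "(\<lambda>n. nrm A (t n \<ominus> l)) \<longlonglongrightarrow> 0"
      using nrm_complete[of t] C t st by auto
    then have "l \<in> K" using K_closed t by blast
    then show "\<exists>l\<in>carrier B. (\<lambda>n. nrm B (s n \<ominus>\<^bsub>B\<^esub> l)) \<longlonglongrightarrow> 0"
      using l t st by (intro bexI[of _ "f l"]) (auto simp: B_simps)
  qed (auto simp: B_simps K_rules smult_mult_left smult_mult_right star_star star_add star_smult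
      star_mult nrm_nonneg nrm_triangle nrm_smult nrm_mult cstar_identity)
qed

lemma finsum_B:
  assumes "finite S" "\<And>i. i \<in> S \<Longrightarrow> g i \<in> K"
  shows "(\<Oplus>\<^bsub>B\<^esub>i\<in>S. f (g i)) = f (\<Oplus>i\<in>S. g i) \<and> (\<Oplus>i\<in>S. g i) \<in> K"
proof -
  interpret B: ring B by (rule ring_B)
  show ?thesis using assms
  proof (induction S rule: finite_induct)
    case empty then show ?case by (simp add: B_simps K_zero)
  next
    case (insert i S)
    then have "f \<circ> g \<in> S \<rightarrow> carrier B" "g \<in> S \<rightarrow> carrier A" by (auto simp: B_simps)
    with insert show ?case
      by (simp add: B.finsum_insert M.finsum_insert comp_def Pi_def) (simp add: B_simps K_add)
  qed
qed

lemma quantum_isomorphism_B: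
  assumes q: "quantum_isomorphism A G H U"
    and U: "\<And>a x. a \<in> verts H \<Longrightarrow> x \<in> verts G \<Longrightarrow> U a x \<in> K"
  shows "quantum_isomorphism B G H (\<lambda>a x. f (U a x))"
proof -
  have mu: "magic_unitary A (verts H) (verts G) U" using q by (simp add: quantum_isomorphism_def)
  then have fin: "finite (verts G)" "finite (verts H)" by (auto simp: magic_unitary_def)
  have adj: "adj_matrix B G' y z = f (adj_matrix A G' y z)" "adj_matrix A G' y z \<in> K"
    for G' :: "('u,'t) pre_digraph" and y z by (auto simp: adj_matrix_def B_simps K_rules)
  have m: "f x \<otimes>\<^bsub>B\<^esub> f y = f (x \<otimes> y)" if "x \<in> K" "y \<in> K" for x y
    using that by (simp add: B_simps)
  interpret B: ring B by (rule ring_B)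
  have mp: "matrix_prod B S (\<lambda>i j. f (M i j)) (\<lambda>i j. f (N i j)) i j = f (matrix_prod A S M N i j)"
    if "finite S" "\<And>k. k \<in> S \<Longrightarrow> M i k \<in> K" "\<And>k. k \<in> S \<Longrightarrow> N k j \<in> K" for S :: "'s set" and M :: "'i \<Rightarrow> 's \<Rightarrow> 'a" and N :: "'s \<Rightarrow> 'j \<Rightarrow> 'a" and i j
  proof -
    have "matrix_prod B S (\<lambda>i j. f (M i j)) (\<lambda>i j. f (N i j)) i j = (\<Oplus>\<^bsub>B\<^esub>k\<in>S. f (M i k \<otimes> N k j))"
      unfolding matrix_prod_def using that
      by (intro B.finsum_cong') (auto simp: m, auto simp: B_simps K_mult)
    also have "\<dots> = f (\<Oplus>k\<in>S. M i k \<otimes> N k j)"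
      using finsum_B[of S "\<lambda>k. M i k \<otimes> N k j"] that by (simp add: K_mult)
    finally show ?thesis by (simp add: matrix_prod_def)
  qed
  have "magic_unitary B (verts H) (verts G) (\<lambda>a x. f (U a x))"
    using mu finsum_B[of "verts H" "\<lambda>k. U k _"] finsum_B[of "verts G" "U _"] U
    by (auto simp: magic_unitary_def m) (auto simp: B_simps)
  moreover have "matrix_prod B (verts G) (\<lambda>a x. f (U a x)) (adj_matrix B G) a x
      = matrix_prod B (verts H) (adj_matrix B H) (\<lambda>a x. f (U a x)) a x"
    if "a \<in> verts H" "x \<in> verts G" for a x
  proof -
    have "adj_matrix B G = (\<lambda>i j. f (adj_matrix A G i j))" "adj_matrix B H = (\<lambda>i j. f (adj_matrix A H i j))"
      by (intro ext adj)+
    moreover have "matrix_prod B (verts G) (\<lambda>i j. f (U i j)) (\<lambda>i j. f (adj_matrix A G i j)) a x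
        = f (matrix_prod A (verts G) U (adj_matrix A G) a x)"
      by (rule mp[OF fin(1)]) (use U that adj(2) in auto)
    moreover have "matrix_prod B (verts H) (\<lambda>i j. f (adj_matrix A H i j)) (\<lambda>i j. f (U i j)) a x
        = f (matrix_prod A (verts H) (adj_matrix A H) U a x)"
      by (rule mp[OF fin(2)]) (use U that adj(2) in auto)
    ultimately show ?thesis using q that by (simp only: quantum_isomorphism_def)
  qed
  ultimately show ?thesis using q by (simp add: quantum_isomorphism_def)
qed

end
end

context unital_cstar_algebra begin

lemma nrm_zero: "nrm A \<zero> = 0" by (simp add: nrm_eq_zero)

definition gen_step :: "complex set \<Rightarrow> 'x set \<Rightarrow> 'x set" where
  "gen_step Q T = T \<union> (\<lambda>(x, y). x \<oplus> y) ` (T \<times> T) \<union> (\<lambda>(x, y). x \<otimes> y) ` (T \<times> T) \<union>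
     (\<lambda>(c, x). c \<odot> x) ` (Q \<times> T) \<union> star A ` T"

definition generated :: "complex set \<Rightarrow> 'x set \<Rightarrow> 'x set" where
  "generated Q T = (\<Union>n. (gen_step Q ^^ n) T)"

lemma countable_generated:
  assumes "countable Q" "countable T" shows "countable (generated Q T)"
proof -
  have "countable ((gen_step Q ^^ n) T)" for n
    by (induction n) (use assms in \<open>auto simp: gen_step_def intro!: countable_image countable_SIGMA\<close>)
  then show ?thesis by (auto simp: generated_def)
qed

lemma generated_carrier:
  assumes "T \<subseteq> carrier A" shows "generated Q T \<subseteq> carrier A"
proof -
  have "(gen_step Q ^^ n) T \<subseteq> carrier A" for n
    by (induction n) (use assms in \<open>auto simp: gen_step_def intro: star_closed\<close>)
  then show ?thesis by (auto simp: generated_def)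
qed

lemma generated_base: "T \<subseteq> generated Q T"
proof
  fix x assume "x \<in> T"
  then have "x \<in> (gen_step Q ^^ 0) T" by simp
  then show "x \<in> generated Q T" unfolding generated_def by blast
qed

lemma generated_mono: "m \<le> n \<Longrightarrow> (gen_step Q ^^ m) T \<subseteq> (gen_step Q ^^ n) T"
proof (induction n rule: dec_induct)
  case (step n)
  have "X \<subseteq> gen_step Q X" for X by (auto simp: gen_step_def)
  with step show ?case by force
qed simp

lemma generated_step1:
  assumes "x \<in> generated Q T"
  shows "star A x \<in> generated Q T" "c \<in> Q \<Longrightarrow> c \<odot> x \<in> generated Q T"
proof -
  from assms obtain n where n: "x \<in> (gen_step Q ^^ n) T" by (auto simp: generated_def)
  then have "star A x \<in> (gen_step Q ^^ Suc n) T" "c \<in> Q \<Longrightarrow> c \<odot> x \<in> (gen_step Q ^^ Suc n) T"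
    by (auto simp: gen_step_def)
  then show "star A x \<in> generated Q T" "c \<in> Q \<Longrightarrow> c \<odot> x \<in> generated Q T" unfolding generated_def by blast+
qed

lemma generated_step2:
  assumes "x \<in> generated Q T" "y \<in> generated Q T"
  shows "x \<oplus> y \<in> generated Q T" "x \<otimes> y \<in> generated Q T"
proof -
  from assms obtain m n where "x \<in> (gen_step Q ^^ m) T" "y \<in> (gen_step Q ^^ n) T" by (auto simp: generated_def)
  then have "x \<in> (gen_step Q ^^ max m n) T" "y \<in> (gen_step Q ^^ max m n) T"
    using generated_mono[of m "max m n" Q T] generated_mono[of n "max m n" Q T] by auto
  then have "x \<oplus> y \<in> (gen_step Q ^^ Suc (max m n)) T" "x \<otimes> y \<in> (gen_step Q ^^ Suc (max m n)) T"
    by (auto simp: gen_step_def)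
  then show "x \<oplus> y \<in> generated Q T" "x \<otimes> y \<in> generated Q T" unfolding generated_def by blast+
qed

definition norm_closure :: "'x set \<Rightarrow> 'x set" where
  "norm_closure S = {x \<in> carrier A. \<forall>e>0. \<exists>s\<in>S. nrm A (x \<ominus> s) < e}"

lemma norm_closureI_seq:
  assumes "S \<subseteq> carrier A" "x \<in> carrier A"
    and "\<And>n. s n \<in> S" "(\<lambda>n. nrm A (x \<ominus> s n)) \<longlonglongrightarrow> 0"
  shows "x \<in> norm_closure S"
  unfolding norm_closure_def
proof (intro CollectI conjI allI impI)
  fix e :: real assume "e > 0"
  then obtain n where "nrm A (x \<ominus> s n) < e"
    using order_tendstoD(2)[OF assms(4), of e] by (auto simp: eventually_sequentially)
  then show "\<exists>s\<in>S. nrm A (x \<ominus> s) < e" using assms(3) by blast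
qed fact

lemma norm_closureE_seq:
  assumes "S \<subseteq> carrier A" "x \<in> norm_closure S"
  obtains s where "\<And>n. s n \<in> S" "\<And>n. s n \<in> carrier A" "(\<lambda>n. nrm A (x \<ominus> s n)) \<longlonglongrightarrow> 0"
proof -
  have "\<forall>n. \<exists>s\<in>S. nrm A (x \<ominus> s) < inverse (real (Suc n))"
    using assms by (auto simp: norm_closure_def)
  then obtain s where s: "\<And>n. s n \<in> S" "\<And>n. nrm A (x \<ominus> s n) < inverse (real (Suc n))" by metis
  have x: "x \<in> carrier A" using assms by (simp add: norm_closure_def)
  have "(\<lambda>n. nrm A (x \<ominus> s n)) \<longlonglongrightarrow> 0"
    by (rule tendsto_sandwich[OF _ _ tendsto_const LIMSEQ_inverse_real_of_nat])
       (use s x assms in \<open>auto intro!: always_eventually nrm_nonneg less_imp_le[OF s(2)] simp del: of_nat_Suc\<close>)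
  then show thesis using that s assms(1) by blast
qed

lemma tendsto0_le:
  assumes "g \<longlonglongrightarrow> (0::real)" "\<And>n. x n \<in> carrier A" "\<And>n. nrm A (x n) \<le> g n"
  shows "(\<lambda>n. nrm A (x n)) \<longlonglongrightarrow> 0"
  by (rule tendsto_sandwich[OF _ _ tendsto_const assms(1)])
     (use assms in \<open>auto intro!: always_eventually nrm_nonneg\<close>)

lemma closed_star_subalgebra_closure:
  assumes Q: "\<And>c e. 0 < e \<Longrightarrow> \<exists>q\<in>Q. cmod (c - q) < e"
    and T: "T \<subseteq> carrier A" "\<zero> \<in> T" "\<one> \<in> T"
  shows "closed_star_subalgebra A (norm_closure (generated Q T))"
proof -
  let ?S = "generated Q T"
  have S: "?S \<subseteq> carrier A" using generated_carrier T by blast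
  have base: "x \<in> norm_closure ?S" if "x \<in> T" for x
  proof -
    have "x \<ominus> x = \<zero>" using that T by (auto simp: a_minus_def M.r_neg)
    then show ?thesis using that generated_base[of T Q] T by (auto simp: norm_closure_def nrm_zero intro!: bexI[of _ x])
  qed
  have car: "norm_closure ?S \<subseteq> carrier A" by (auto simp: norm_closure_def)
  show ?thesis
  proof
    show "norm_closure ?S \<subseteq> carrier A" by fact
    show "\<zero> \<in> norm_closure ?S" "\<one> \<in> norm_closure ?S" using base T by auto
    fix x y assume x: "x \<in> norm_closure ?S" and y: "y \<in> norm_closure ?S"
    have xy: "x \<in> carrier A" "y \<in> carrier A" using x y car by auto
    obtain s where s: "\<And>n. s n \<in> ?S" "\<And>n. s n \<in> carrier A" "(\<lambda>n. nrm A (x \<ominus> s n)) \<longlonglongrightarrow> 0"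
      using norm_closureE_seq[OF S x] by blast
    obtain t where t: "\<And>n. t n \<in> ?S" "\<And>n. t n \<in> carrier A" "(\<lambda>n. nrm A (y \<ominus> t n)) \<longlonglongrightarrow> 0"
      using norm_closureE_seq[OF S y] by blast
    show "x \<oplus> y \<in> norm_closure ?S"
    proof (rule norm_closureI_seq[OF S, of _ "\<lambda>n. s n \<oplus> t n"])
      show "(\<lambda>n. nrm A (x \<oplus> y \<ominus> (s n \<oplus> t n))) \<longlonglongrightarrow> 0"
      proof (rule tendsto0_le)
        show "(\<lambda>n. nrm A (x \<ominus> s n) + nrm A (y \<ominus> t n)) \<longlonglongrightarrow> 0" using tendsto_add[OF s(3) t(3)] by simp
        fix n
        have "x \<oplus> y \<ominus> (s n \<oplus> t n) = (x \<ominus> s n) \<oplus> (y \<ominus> t n)" using xy s(2)[of n] t(2)[of n] by algebra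
        then show "nrm A (x \<oplus> y \<ominus> (s n \<oplus> t n)) \<le> nrm A (x \<ominus> s n) + nrm A (y \<ominus> t n)"
          using nrm_triangle xy s(2)[of n] t(2)[of n] by simp
      qed (use xy s t in auto)
    qed (use xy s t generated_step2 in auto)
    show "x \<otimes> y \<in> norm_closure ?S"
    proof (rule norm_closureI_seq[OF S, of _ "\<lambda>n. s n \<otimes> t n"])
      show "(\<lambda>n. nrm A (x \<otimes> y \<ominus> (s n \<otimes> t n))) \<longlonglongrightarrow> 0"
      proof (rule tendsto0_le)
        let ?g = "\<lambda>n. nrm A x * nrm A (y \<ominus> t n) + nrm A (x \<ominus> s n) * (nrm A y + nrm A (y \<ominus> t n))"
        have "?g \<longlonglongrightarrow> nrm A x * 0 + 0 * (nrm A y + 0)"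
          by (intro tendsto_intros s(3) t(3))
        then show "?g \<longlonglongrightarrow> 0" by simp
        fix n
        have st: "s n \<in> carrier A" "t n \<in> carrier A" using s t by auto
        have e: "x \<otimes> y \<ominus> (s n \<otimes> t n) = x \<otimes> (y \<ominus> t n) \<oplus> (x \<ominus> s n) \<otimes> t n"
          using xy st by algebra
        have "t n = y \<ominus> (y \<ominus> t n)" using xy st by algebra
        then have "t n = y \<oplus> (-1) \<odot> (y \<ominus> t n)" using xy st by (metis a_minus_def minus_smult M.minus_closed)
        then have "nrm A (t n) \<le> nrm A y + nrm A ((-1) \<odot> (y \<ominus> t n))"
          using nrm_triangle[of y "(-1) \<odot> (y \<ominus> t n)"] xy st by simp
        then have tb: "nrm A (t n) \<le> nrm A y + nrm A (y \<ominus> t n)" using xy st by (simp add: nrm_smult)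
        have "nrm A (x \<otimes> y \<ominus> (s n \<otimes> t n)) \<le> nrm A (x \<otimes> (y \<ominus> t n)) + nrm A ((x \<ominus> s n) \<otimes> t n)"
          unfolding e using xy st by (intro nrm_triangle) auto
        also have "\<dots> \<le> nrm A x * nrm A (y \<ominus> t n) + nrm A (x \<ominus> s n) * nrm A (t n)"
          using xy st by (intro add_mono nrm_mult) auto
        also have "\<dots> \<le> ?g n" using tb xy st by (intro add_mono mult_left_mono nrm_nonneg) auto
        finally show "nrm A (x \<otimes> y \<ominus> (s n \<otimes> t n)) \<le> ?g n" .
      qed (use xy s t in auto)
    qed (use xy s t generated_step2 in auto)
    show "star A x \<in> norm_closure ?S"
    proof (rule norm_closureI_seq[OF S, of _ "\<lambda>n. star A (s n)"])
      have "star A x \<ominus> star A (s n) = star A (x \<ominus> s n)" for n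
        using xy s(2)[of n] by (simp add: a_minus_def minus_smult star_add star_smult star_closed)
      then show "(\<lambda>n. nrm A (star A x \<ominus> star A (s n))) \<longlonglongrightarrow> 0"
        using s xy by (simp add: nrm_star)
    qed (use xy s generated_step1 star_closed in auto)
    fix c
    have "\<forall>n. \<exists>q\<in>Q. cmod (c - q) < inverse (real (Suc n))" using Q by simp
    then obtain q where q: "\<And>n. q n \<in> Q" "\<And>n. cmod (c - q n) < inverse (real (Suc n))" by metis
    have q0: "(\<lambda>n. cmod (c - q n)) \<longlonglongrightarrow> 0"
      by (rule tendsto_sandwich[OF _ _ tendsto_const LIMSEQ_inverse_real_of_nat])
         (use q in \<open>auto intro!: always_eventually less_imp_le\<close>)
    show "c \<odot> x \<in> norm_closure ?S"
    proof (rule norm_closureI_seq[OF S, of _ "\<lambda>n. q n \<odot> s n"])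
      show "(\<lambda>n. nrm A (c \<odot> x \<ominus> q n \<odot> s n)) \<longlonglongrightarrow> 0"
      proof (rule tendsto0_le)
        let ?g = "\<lambda>n. cmod (c - q n) * nrm A x + (cmod c + cmod (c - q n)) * nrm A (x \<ominus> s n)"
        have "?g \<longlonglongrightarrow> 0 * nrm A x + (cmod c + 0) * 0"
          by (intro tendsto_intros s(3) q0)
        then show "?g \<longlonglongrightarrow> 0" by simp
        fix n
        have sn: "s n \<in> carrier A" using s by auto
        have m: "(- q n) \<odot> z = \<ominus> (q n \<odot> z)" if "z \<in> carrier A" for z
          using smult_assoc1[of "-1" "q n" z] that by (simp add: minus_smult)
        have "(c - q n) \<odot> x = c \<odot> x \<oplus> (- q n) \<odot> x"
          using smult_l_distr[of c "- q n" x] xy by simp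
        then have e1: "(c - q n) \<odot> x = c \<odot> x \<ominus> q n \<odot> x"
          using m[OF xy(1)] by (simp add: a_minus_def)
        have "q n \<odot> (\<ominus> s n) = \<ominus> (q n \<odot> s n)"
          using smult_assoc1[of "q n" "-1" "s n"] m[OF sn] sn by (simp add: minus_smult)
        then have e2: "q n \<odot> (x \<ominus> s n) = q n \<odot> x \<ominus> q n \<odot> s n"
          using smult_r_distr[of "q n" x "\<ominus> s n"] xy sn by (simp add: a_minus_def)
        have e3: "u \<ominus> w = (u \<ominus> v) \<oplus> (v \<ominus> w)"
          if "u \<in> carrier A" "v \<in> carrier A" "w \<in> carrier A" for u v w using that by algebra
        have e: "c \<odot> x \<ominus> q n \<odot> s n = (c - q n) \<odot> x \<oplus> q n \<odot> (x \<ominus> s n)"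
          unfolding e1 e2 using xy sn by (intro e3) auto
        have qb: "cmod (q n) \<le> cmod c + cmod (c - q n)"
          by (metis norm_triangle_sub norm_minus_commute)
        have "nrm A (c \<odot> x \<ominus> q n \<odot> s n) \<le> nrm A ((c - q n) \<odot> x) + nrm A (q n \<odot> (x \<ominus> s n))"
          unfolding e using xy sn by (intro nrm_triangle) auto
        also have "\<dots> = cmod (c - q n) * nrm A x + cmod (q n) * nrm A (x \<ominus> s n)"
          using xy sn by (simp add: nrm_smult)
        also have "\<dots> \<le> ?g n" using qb xy sn by (intro add_mono mult_right_mono nrm_nonneg) auto
        finally show "nrm A (c \<odot> x \<ominus> q n \<odot> s n) \<le> ?g n" .
      qed (use xy s in auto)
    qed (use xy s q generated_step1 in auto)
  next
    fix s l
    assume s: "\<And>n::nat. s n \<in> norm_closure ?S" and l: "l \<in> carrier A" "(\<lambda>n. nrm A (s n \<ominus> l)) \<longlonglongrightarrow> 0"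
    have sc: "s n \<in> carrier A" for n using s car by auto
    show "l \<in> norm_closure ?S"
      unfolding norm_closure_def
    proof (intro CollectI conjI allI impI)
      fix e :: real assume "e > 0"
      then obtain n where n: "nrm A (s n \<ominus> l) < e / 2"
        using order_tendstoD(2)[OF l(2), of "e/2"] by (auto simp: eventually_sequentially)
      obtain z where z: "z \<in> ?S" "nrm A (s n \<ominus> z) < e / 2"
        using s[of n] \<open>e > 0\<close> by (auto simp: norm_closure_def dest: spec[of _ "e/2"])
      have "nrm A (l \<ominus> z) \<le> nrm A (l \<ominus> s n) + nrm A (s n \<ominus> z)"
        using z(1) S sc l by (intro nrm_minus_triangle) auto
      then show "\<exists>z\<in>?S. nrm A (l \<ominus> z) < e"
        using n z nrm_minus_commute[OF l(1) sc[of n]] by (intro bexI[of _ z]) auto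
    qed (rule l)
  qed
qed

lemma closure_of_inj:
  assumes S: "S \<subseteq> carrier A" "countable S" "S \<noteq> {}"
  shows "\<exists>f ::  'x \<Rightarrow> nat \<Rightarrow> real. inj_on f (norm_closure S)"
proof (intro exI inj_onI)
  let ?f = "\<lambda>x n. nrm A (x \<ominus> from_nat_into S n)"
  fix x y assume x: "x \<in> norm_closure S" and y: "y \<in> norm_closure S" and eq: "?f x = ?f y"
  have xy: "x \<in> carrier A" "y \<in> carrier A" using x y by (auto simp: norm_closure_def)
  have "nrm A (x \<ominus> y) \<le> 0 + e" if "e > 0" for e :: real
  proof -
    obtain s where s: "s \<in> S" "nrm A (x \<ominus> s) < e / 2"
      using x \<open>e > 0\<close> by (auto simp: norm_closure_def dest: spec[of _ "e/2"])
    have sc: "s \<in> carrier A" using s S by auto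
    obtain n where "from_nat_into S n = s" using s S from_nat_into_surj by metis
    then have "nrm A (y \<ominus> s) = nrm A (x \<ominus> s)" using eq by (metis (no_types))
    then show ?thesis using s nrm_minus_triangle[OF xy(1) sc xy(2)] nrm_minus_commute[OF sc xy(2)] by simp
  qed
  then have "nrm A (x \<ominus> y) \<le> 0" by (rule field_le_epsilon)
  then have "nrm A (x \<ominus> y) = 0" using nrm_nonneg[of "x \<ominus> y"] xy by simp
  then have "x \<ominus> y = \<zero>" using xy by (simp add: nrm_eq_zero)
  moreover have "x = (x \<ominus> y) \<oplus> y" using xy by algebra
  ultimately show "x = y" using xy by simp
qed

end

lemma complex_countable_dense:
  "\<exists>Q :: complex set. countable Q \<and> (\<forall>c e. 0 < e \<longrightarrow> (\<exists>q\<in>Q. cmod (c - q) < e))"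
proof (intro exI conjI allI impI)
  let ?Q = "(\<lambda>(a, b). Complex a b) ` (\<rat> \<times> \<rat>)"
  show "countable ?Q" by (intro countable_image countable_SIGMA countable_rat)
  fix c :: complex and e :: real assume "0 < e"
  obtain a where a: "a \<in> \<rat>" "Re c - e / 2 < a" "a < Re c" using Rats_dense_in_real[of "Re c - e/2" "Re c"] \<open>0 < e\<close> by auto
  obtain b where b: "b \<in> \<rat>" "Im c - e / 2 < b" "b < Im c" using Rats_dense_in_real[of "Im c - e/2" "Im c"] \<open>0 < e\<close> by auto
  have "cmod (c - Complex a b) \<le> \<bar>Re (c - Complex a b)\<bar> + \<bar>Im (c - Complex a b)\<bar>" by (rule cmod_le)
  also have "\<dots> < e" using a b by simp
  finally show "\<exists>q\<in>?Q. cmod (c - q) < e" using a b by (intro bexI[of _ "Complex a b"]) auto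
qed

theorem quantum_isomorphicI:
  assumes "unital_cstar_algebra A" "quantum_isomorphism A G H U"
  shows "quantum_isomorphic G H"
proof -
  interpret unital_cstar_algebra A by fact
  obtain Q :: "complex set" where Q: "countable Q" "\<And>c e. 0 < e \<Longrightarrow> \<exists>q\<in>Q. cmod (c - q) < e"
    using complex_countable_dense by blast
  define T where "T = {\<zero>\<^bsub>A\<^esub>, \<one>\<^bsub>A\<^esub>} \<union> (\<lambda>(a, x). U a x) ` (verts H \<times> verts G)"
  have mu: "magic_unitary A (verts H) (verts G) U" using assms(2) by (simp add: quantum_isomorphism_def)
  have T: "T \<subseteq> carrier A" "\<zero>\<^bsub>A\<^esub> \<in> T" "\<one>\<^bsub>A\<^esub> \<in> T" "countable T"
    using mu by (auto simp: T_def magic_unitary_def intro!: countable_finite)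
  let ?S = "generated Q T"
  let ?K = "norm_closure ?S"
  interpret K: closed_star_subalgebra A ?K
    by (rule closed_star_subalgebra_closure[OF Q(2) T(1-3)])
  have S: "?S \<subseteq> carrier A" "countable ?S" "?S \<noteq> {}"
    using generated_carrier[OF T(1)] countable_generated[OF Q(1) T(4)] generated_base[of T Q] T(2) by blast+
  obtain f :: "_ \<Rightarrow> nat \<Rightarrow> real" where f: "inj_on f ?K" using closure_of_inj[OF S] by blast
  have "U a x \<in> ?K" if "a \<in> verts H" "x \<in> verts G" for a x
  proof (rule norm_closureI_seq[OF S(1), of _ "\<lambda>_. U a x"])
    have "U a x \<in> T" using that by (auto simp: T_def)
    then show "U a x \<in> ?S" "U a x \<in> carrier A" using generated_base T(1) by blast+
    then show "(\<lambda>n. nrm A (U a x \<ominus>\<^bsub>A\<^esub> U a x)) \<longlonglongrightarrow> 0" by (simp add: a_minus_def M.r_neg nrm_zero)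
  qed
  then have "quantum_isomorphism (pullback A ?K f) G H (\<lambda>a x. f (U a x))"
    using K.quantum_isomorphism_B[OF f assms(2)] by blast
  then show ?thesis using K.cstar_B[OF f] unfolding quantum_isomorphic_def by blast
qed

end

theory Submission
  imports Defs
begin

text \<open>
  If \<open>u\<^bsub>ax\<^esub> u\<^bsub>by\<^esub> \<noteq> 0\<close>, then for every \<open>n\<close> there are as many walks of length \<open>n\<close> from \<open>x\<close> to
  \<open>y\<close> as from \<open>a\<close> to \<open>b\<close>.  By the first-passage decomposition these numbers determine, for each
  \<open>z\<close>, the number of walks from \<open>x\<close> to \<open>y\<close> avoiding \<open>z\<close>, and hence the number of vertices \<open>z\<close>
  that separate \<open>x\<close> from \<open>y\<close>.  So \<open>x, y\<close> lie in a common block iff \<open>a, b\<close> do.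

  For a block \<open>d\<close> of \<open>H\<close> put \<open>p\<^sub>d(z) = (\<Sum>e\<in>d. u\<^bsub>ez\<^esub>)\<close>.  As blocks are arranged in a tree-like way, for
  a block \<open>b\<close> of \<open>G\<close> the product \<open>q = p\<^sub>d(z) p\<^sub>d(w)\<close> is a projection that does not depend on the
  distinct vertices \<open>z, w\<close> of \<open>b\<close>, it commutes with all \<open>u\<^bsub>cz\<^esub>\<close> (\<open>c \<in> d\<close>, \<open>z \<in> b\<close>), and the \<open>u\<^bsub>cz\<^esub> q\<close> form
  a quantum isomorphism from \<open>G[b]\<close> to \<open>H[d]\<close> over the corner of \<open>q\<close> as soon as \<open>q \<noteq> 0\<close>.  The projections
  \<open>u\<^bsub>ax\<^esub> q\<close>, indexed by the blocks \<open>b \<ni> x\<close> and \<open>d \<ni> a\<close>, have all row and column sums equal to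
  \<open>u\<^bsub>ax\<^esub>\<close>; Hall's theorem yields a perfect matching in their support.
\<close>

section \<open>Walks, separation and blocks as sets of vertices\<close>

text \<open>Two obstacles shape the proof. The algebra is given by axioms only, without spectral
  theory or order, yet orthogonality of projections with sum one, and Hall's condition, rest on
  positivity. Norms of reflections replace it: if \<open>w\<close> is a projection below a nonzero
  projection \<open>u\<close>, then \<open>u - 2w\<close> has norm one, so a sum of \<open>n\<close>
  such elements has norm at most \<open>n\<close>; this is how it is used that sums of projections
  are not negative.

  The other obstacle is that entries of \<open>U\<close> need not commute, so no bijection of
  vertices can be followed. What survives is counting, since a nonzero product \<open>u v\<close>
  can be expanded along rows as well as along columns, and one property of the relation of lying in
  a common block: two distinct vertices with two distinct common neighbours are related. It makes
  the products defining \<open>q\<close> independent of the chosen vertices.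

  Column sums over a block come directly from the definition of \<open>q\<close>. Row sums need that
  \<open>q\<close> coincides with its analogue for the transposed matrix, which is read off from the
  square of the sum of all \<open>u_ez\<close> with \<open>e\<close> in \<open>d\<close> and
  \<open>z\<close> in \<open>b\<close>.\<close>

primrec walks :: "'v set \<Rightarrow> 'v rel \<Rightarrow> nat \<Rightarrow> 'v \<Rightarrow> 'v \<Rightarrow> nat" where
  "walks V E 0 x y = of_bool (x \<in> V \<and> x = y)"
| "walks V E (Suc n) x y = (\<Sum>v\<in>V. of_bool (x \<in> V \<and> (x, v) \<in> E) * walks V E n v y)"

text \<open>Counts walks whose first visit to \<open>z\<close> is their last vertex; hence
  \<open>z\<close> is excluded as a starting point in the successor case, while \<open>v\<close> may
  be \<open>z\<close>. As in \<open>walks\<close>, \<open>E\<close> stays fixed and membership tests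
  confine the walk, so deleting a vertex only shrinks \<open>V\<close>.\<close>

primrec first_hits :: "'v set \<Rightarrow> 'v rel \<Rightarrow> 'v \<Rightarrow> nat \<Rightarrow> 'v \<Rightarrow> nat" where
  "first_hits V E z 0 x = of_bool (x = z)"
| "first_hits V E z (Suc n) x = (\<Sum>v\<in>V. of_bool (x \<in> V - {z} \<and> (x, v) \<in> E) * first_hits V E z n v)"

lemma walks_notin: "x \<notin> V \<Longrightarrow> walks V E n x y = 0" "y \<notin> V \<Longrightarrow> walks V E n x y = 0"
  by (induction n arbitrary: x) auto

text \<open>A walk that meets \<open>z\<close> does so for the first time after exactly one number
  \<open>i\<close> of steps, and goes on as an arbitrary walk from \<open>z\<close>.\<close>

lemma walks_split:
  assumes "finite V" "z \<in> V"
  shows "walks V E n x y =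
    walks (V - {z}) E n x y + (\<Sum>i\<le>n. first_hits V E z i x * walks V E (n - i) z y)"
proof (induction n arbitrary: x)
  case 0
  then show ?case using assms by auto
next
  case (Suc n)
  show ?case
  proof (cases "x \<in> V - {z}")
    case False
    then have "first_hits V E z (Suc i) x = 0" for i by auto
    then have s: "(\<Sum>i\<le>Suc n. first_hits V E z i x * walks V E (Suc n - i) z y) =
        of_bool (x = z) * walks V E (Suc n) z y"
      by (subst sum.atMost_Suc_shift) simp
    show ?thesis
    proof (cases "x = z")
      case True
      then show ?thesis using s walks_notin(1)[of z "V - {z}"] by simp
    next
      case False
      with \<open>x \<notin> V - {z}\<close> have "x \<notin> V" by auto
      then show ?thesis using s False walks_notin(1)[of x V] walks_notin(1)[of x "V - {z}"]
        by (simp del: walks.simps first_hits.simps sum.atMost_Suc)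
    qed
  next
    case True
    let ?e = "\<lambda>v. of_bool ((x, v) \<in> E) :: nat"
    have "walks V E (Suc n) x y = (\<Sum>v\<in>V. ?e v * walks V E n v y)" using True by simp
    also have "\<dots> = (\<Sum>v\<in>V. ?e v * walks (V - {z}) E n v y) +
        (\<Sum>v\<in>V. ?e v * (\<Sum>i\<le>n. first_hits V E z i v * walks V E (n - i) z y))"
      by (simp add: Suc sum.distrib algebra_simps)
    also have "(\<Sum>v\<in>V. ?e v * walks (V - {z}) E n v y) = (\<Sum>v\<in>V - {z}. ?e v * walks (V - {z}) E n v y)"
      using assms walks_notin(1)[of z "V - {z}"] by (intro sum.mono_neutral_right) auto
    also have "\<dots> = walks (V - {z}) E (Suc n) x y"
      using True by simp
    also have "(\<Sum>v\<in>V. ?e v * (\<Sum>i\<le>n. first_hits V E z i v * walks V E (n - i) z y)) =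
        (\<Sum>v\<in>V. \<Sum>i\<le>n. ?e v * first_hits V E z i v * walks V E (n - i) z y)"
      by (simp add: sum_distrib_left mult.assoc)
    also have "\<dots> = (\<Sum>i\<le>n. \<Sum>v\<in>V. ?e v * first_hits V E z i v * walks V E (n - i) z y)"
      by (rule sum.swap)
    also have "\<dots> = (\<Sum>i\<le>n. first_hits V E z (Suc i) x * walks V E (n - i) z y)"
      using True by (simp add: sum_distrib_right)
    also have "\<dots> = (\<Sum>i\<le>Suc n. first_hits V E z i x * walks V E (Suc n - i) z y)"
      using True by (subst sum.atMost_Suc_shift) simp
    finally show ?thesis .
  qed
qed

text \<open>For \<open>y = z\<close> the avoiding part of \<open>walks_split\<close> vanishes and a
  convolution remains. Its term \<open>i = n\<close> has the coefficient
  \<open>walks V E 0 z z = 1\<close>, so this triangular system is solved from small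
  \<open>n\<close> upwards.\<close>

lemma first_hits_determined:
  assumes fin: "finite V" "finite W" and zc: "z \<in> V" "c \<in> W"
    and xz: "\<And>n. walks V E n x z = walks W F n a c"
    and zz: "\<And>n. walks V E n z z = walks W F n c c"
  shows "first_hits V E z n x = first_hits W F c n a"
proof (induction n rule: less_induct)
  case (less n)
  have "(\<Sum>i\<le>n. first_hits V E z i x * walks V E (n - i) z z) =
      (\<Sum>i\<le>n. first_hits W F c i a * walks W F (n - i) c c)"
    using walks_split[OF fin(1) zc(1), of E n x z] walks_split[OF fin(2) zc(2), of F n a c] xz[of n]
    by (simp add: walks_notin(2))
  moreover have "(\<Sum>i<n. first_hits V E z i x * walks V E (n - i) z z) =
      (\<Sum>i<n. first_hits W F c i a * walks W F (n - i) c c)"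
    using less zz by simp
  ultimately show ?case using zc by (simp add: lessThan_Suc_atMost[symmetric] zz)
qed

lemma walks_remove_determined:
  assumes fin: "finite V" "finite W" and zc: "z \<in> V" "c \<in> W"
    and xz: "\<And>n. walks V E n x z = walks W F n a c"
    and zz: "\<And>n. walks V E n z z = walks W F n c c"
    and zy: "\<And>n. walks V E n z y = walks W F n c b"
    and xy: "\<And>n. walks V E n x y = walks W F n a b"
  shows "walks (V - {z}) E n x y = walks (W - {c}) F n a b"
  using walks_split[OF fin(1) zc(1), of E n x y] walks_split[OF fin(2) zc(2), of F n a b] xy[of n]
    first_hits_determined[OF fin zc xz zz] zy by simp

lemma walks_pos_iff:
  assumes "finite V"
  shows "(\<exists>n. walks V E n x y > 0) \<longleftrightarrow> (x, y) \<in> rtrancl_on V E"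
proof
  assume "\<exists>n. walks V E n x y > 0"
  then obtain n where "walks V E n x y > 0" by blast
  then show "(x, y) \<in> rtrancl_on V E"
  proof (induction n arbitrary: x)
    case (Suc n)
    then obtain v where "v \<in> V" "of_bool (x \<in> V \<and> (x, v) \<in> E) * walks V E n v y > 0"
      by (metis (no_types, lifting) gr0I sum.neutral walks.simps(2) less_irrefl)
    then show ?case using Suc.IH
      by (auto simp: of_bool_def split: if_splits intro: converse_rtrancl_on_into_rtrancl_on)
  qed (auto simp: of_bool_def split: if_splits)
next
  assume "(x, y) \<in> rtrancl_on V E"
  then show "\<exists>n. walks V E n x y > 0"
  proof (induction rule: converse_rtrancl_on_induct)
    case base
    then show ?case by (intro exI[of _ 0]) simp
  next
    case (step x v)
    then obtain n where "walks V E n v y > 0" by blast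
    moreover have "of_bool (x \<in> V \<and> (x, v) \<in> E) * walks V E n v y \<le> walks V E (Suc n) x y"
      unfolding walks.simps by (rule member_le_sum) (use step assms in auto)
    ultimately show ?case using step by (intro exI[of _ "Suc n"]) (simp del: walks.simps)
  qed
qed

section \<open>Vertices that no single vertex separates\<close>

definition biconnected :: "'v set \<Rightarrow> 'v rel \<Rightarrow> 'v \<Rightarrow> 'v \<Rightarrow> bool" where
  "biconnected V E x y \<longleftrightarrow> x \<noteq> y \<and> (x, y) \<in> rtrancl_on V E \<and>
     (\<forall>z\<in>V - {x, y}. (x, y) \<in> rtrancl_on (V - {z}) E)"

lemma biconnectedD:
  "biconnected V E x y \<Longrightarrow> z \<noteq> x \<Longrightarrow> z \<noteq> y \<Longrightarrow> (x, y) \<in> rtrancl_on (V - {z}) E"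
  by (cases "z \<in> V") (auto simp: biconnected_def)

lemma biconnected_in: "biconnected V E x y \<Longrightarrow> x \<in> V" "biconnected V E x y \<Longrightarrow> y \<in> V"
  by (auto simp: biconnected_def dest: in_rtrancl_on_in_F)

lemma biconnected_irrefl: "\<not> biconnected V E x x"
  by (simp add: biconnected_def)

lemma biconnected_sym: "sym E \<Longrightarrow> biconnected V E x y \<Longrightarrow> biconnected V E y x"
  unfolding biconnected_def by (auto dest: rtrancl_on_sym symD simp: insert_commute)

text \<open>A deleted vertex is at most one of \<open>c\<close> and \<open>d\<close>, so a
  connection through the other one survives. In this form the tree-like arrangement of blocks enters
  the operator computations.\<close>

lemma biconnected_square:
  assumes "sym E" "biconnected V E a c" "biconnected V E c b" "biconnected V E a d" "biconnected V E d b"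
    and "a \<noteq> b" "c \<noteq> d"
  shows "biconnected V E a b"
  unfolding biconnected_def
proof (intro conjI ballI)
  show "(a, b) \<in> rtrancl_on V E"
    using assms(2,3) by (auto simp: biconnected_def intro: rtrancl_on_trans)
  fix z assume z: "z \<in> V - {a, b}"
  consider "z \<noteq> c" | "z \<noteq> d" using assms by blast
  then show "(a, b) \<in> rtrancl_on (V - {z}) E"
  proof cases
    case 1
    then show ?thesis
      using z rtrancl_on_trans biconnectedD[OF assms(2), of z] biconnectedD[OF assms(3), of z] by auto
  next
    case 2
    then show ?thesis
      using z rtrancl_on_trans biconnectedD[OF assms(4), of z] biconnectedD[OF assms(5), of z] by auto
  qed
qed fact

text \<open>Two distinct vertices determine their block, so the pair \<open>a\<close>,
  \<open>c\<close> serves as its name. The pair is added explicitly because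
  \<open>biconnected\<close> is irreflexive.\<close>

definition block_verts :: "'v set \<Rightarrow> 'v rel \<Rightarrow> 'v \<Rightarrow> 'v \<Rightarrow> 'v set" where
  "block_verts V E a c = {a, c} \<union> {v. biconnected V E v a \<and> biconnected V E v c}"

text \<open>A repeated first vertex is removed by cutting out the loop. Distinctness is what
  \<open>rtrancl_on_block_verts\<close> relies on: no vertex occurs both before and after another
  one.\<close>

lemma rtrancl_on_imp_path:
  assumes "(x, y) \<in> rtrancl_on F E"
  shows "\<exists>p. p \<noteq> [] \<and> hd p = x \<and> last p = y \<and> distinct p \<and> set p \<subseteq> F \<and>
    successively (\<lambda>u v. (u, v) \<in> E) p"
  using assms
proof (induction rule: converse_rtrancl_on_induct)
  case base
  then show ?case by (intro exI[of _ "[y]"]) auto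
next
  case (step x v)
  then obtain p where p: "p \<noteq> []" "hd p = v" "last p = y" "distinct p" "set p \<subseteq> F"
    "successively (\<lambda>u v. (u, v) \<in> E) p" by blast
  show ?case
  proof (cases "x \<in> set p")
    case True
    then obtain q r where "p = q @ x # r" by (meson split_list)
    then show ?thesis using p by (intro exI[of _ "x # r"]) (auto simp: successively_append_iff)
  next
    case False
    then show ?thesis using p step(1,3)
      by (intro exI[of _ "x # p"]) (auto simp: successively_Cons)
  qed
qed

lemma path_imp_rtrancl_on:
  assumes "p \<noteq> []" "successively (\<lambda>u v. (u, v) \<in> E) p" "set p \<subseteq> F"
  shows "(hd p, last p) \<in> rtrancl_on F E"
  using assms
proof (induction p)
  case (Cons x p)
  then show ?case
    by (cases "p = []") (auto simp: successively_Cons intro: converse_rtrancl_on_into_rtrancl_on)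
qed simp

lemma block_verts_reach:
  assumes "sym E" "biconnected V E a c" "v \<in> block_verts V E a c" "z \<noteq> v"
  shows "\<exists>t\<in>{a, c} - {z}. (v, t) \<in> rtrancl_on (V - {z}) E"
proof -
  have ca: "biconnected V E c a" by (rule biconnected_sym[OF assms(1,2)])
  obtain t where "t \<in> {a, c} - {z}" using assms(2) by (auto simp: biconnected_def)
  then show ?thesis
    using assms(3,4) biconnected_in[OF assms(2)] biconnectedD[of V E v t z] unfolding block_verts_def
    by (intro bexI[of _ "if v \<in> {a, c} then v else t"]) auto
qed

text \<open>Converse of \<open>block_verts_reach\<close>. Reaching either member of the pair is
  enough, because \<open>a\<close> and \<open>c\<close> are biconnected and the walk can continue
  from one to the other while avoiding \<open>z\<close>.\<close>

lemma block_vertsI: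
  assumes "sym E" "biconnected V E a c" "w \<in> V"
    and reach: "\<And>z. z \<noteq> w \<Longrightarrow> \<exists>t\<in>{a, c} - {z}. (w, t) \<in> rtrancl_on (V - {z}) E"
  shows "w \<in> block_verts V E a c"
proof (cases "w \<in> {a, c}")
  case True
  then show ?thesis by (auto simp: block_verts_def)
next
  case False
  have ca: "biconnected V E c a" by (rule biconnected_sym[OF assms(1,2)])
  have "biconnected V E w s" if s: "s \<in> {a, c}" for s
  proof -
    have r: "(w, s) \<in> rtrancl_on (V - {z}) E" if z: "z \<notin> {w, s}" for z
    proof -
      obtain t where t: "t \<in> {a, c} - {z}" "(w, t) \<in> rtrancl_on (V - {z}) E"
        using reach[of z] z by auto
      show ?thesis
      proof (cases "t = s")
        case False
        then have "biconnected V E t s" using t s assms(2) ca by auto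
        then have "(t, s) \<in> rtrancl_on (V - {z}) E" using t z by (intro biconnectedD) auto
        then show ?thesis using t(2) by (rule rtrancl_on_trans[rotated])
      qed (use t in simp)
    qed
    \<comment> \<open>Deleting the other member \<open>s'\<close> forces the reached member to be
      \<open>s\<close>, which gives connectedness without deletion.\<close>
    obtain s' where s': "s' \<in> {a, c}" "s' \<noteq> s" using assms(2) by (auto simp: biconnected_def)
    obtain t where t: "t \<in> {a, c} - {s'}" "(w, t) \<in> rtrancl_on (V - {s'}) E"
      using reach[of s'] s' False by auto
    with s s' have "t = s" by auto
    with t(2) have "(w, s) \<in> rtrancl_on V E" by (auto intro: rtrancl_on_mono[of E E "V - {s'}" V])
    then show ?thesis unfolding biconnected_def using r False s by auto
  qed
  then show ?thesis by (simp add: block_verts_def)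
qed

text \<open>A path leaving the block would have to re-enter it through the vertex by which it left.\<close>

lemma rtrancl_on_block_verts:
  assumes E: "sym E" and ac: "biconnected V E a c" and F: "F \<subseteq> V"
    and v: "v \<in> block_verts V E a c" and t: "t \<in> {a, c}" and vt: "(v, t) \<in> rtrancl_on F E"
  shows "(v, t) \<in> rtrancl_on (F \<inter> block_verts V E a c) E"
proof -
  obtain p where p: "p \<noteq> []" "hd p = v" "last p = t" "distinct p" "set p \<subseteq> F"
    "successively (\<lambda>u v. (u, v) \<in> E) p"
    using rtrancl_on_imp_path[OF vt] by blast
  have "w \<in> block_verts V E a c" if w: "w \<in> set p" for w
  proof (rule block_vertsI[OF E ac])
    show "w \<in> V" using w p(5) F by auto
    fix z assume z: "z \<noteq> w"
    \<comment> \<open>Since \<open>p\<close> is simple, \<open>z\<close> misses either the part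
      after \<open>w\<close>, which leads to \<open>t\<close>, or the part before \<open>w\<close>,
      which leads back to \<open>v\<close>; from \<open>v\<close> the pair is reached by
      \<open>block_verts_reach\<close>.\<close>
    obtain q r where pq: "p = q @ w # r" using w by (meson split_list)
    show "\<exists>t\<in>{a, c} - {z}. (w, t) \<in> rtrancl_on (V - {z}) E"
    proof (cases "z \<in> set (w # r)")
      case False
      have "(hd (w # r), last (w # r)) \<in> rtrancl_on (V - {z}) E"
        using p F False by (intro path_imp_rtrancl_on) (auto simp: pq successively_append_iff)
      moreover have t': "last (w # r) = t" using p(3) by (simp add: pq)
      moreover have "t \<noteq> z" using False t' last_in_set[of "w # r"] by auto
      ultimately show ?thesis using t by auto
    next
      case True
      then have nz: "z \<notin> set (q @ [w])" using p z by (auto simp: pq)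
      have "(hd (q @ [w]), last (q @ [w])) \<in> rtrancl_on (V - {z}) E"
        using p F nz
        by (intro path_imp_rtrancl_on) (auto simp: pq successively_append_iff)
      moreover have hd: "hd (q @ [w]) = v" using p(2) by (cases q) (auto simp: pq)
      ultimately have "(w, v) \<in> rtrancl_on (V - {z}) E"
        using rtrancl_on_sym[OF E] by (auto dest: symD)
      moreover have "z \<noteq> v" using nz hd by (metis hd_in_set snoc_eq_iff_butlast)
      then obtain s where "s \<in> {a, c} - {z}" "(v, s) \<in> rtrancl_on (V - {z}) E"
        using block_verts_reach[OF E ac v] by blast
      ultimately show ?thesis by (blast intro: rtrancl_on_trans)
    qed
  qed
  then show ?thesis using path_imp_rtrancl_on[OF p(1,6), of "F \<inter> block_verts V E a c"] p by auto
qed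

section \<open>Blocks of finite graphs\<close>

lemma rtrancl_on_restrict: "rtrancl_on F (r \<inter> F \<times> F) = rtrancl_on F r"
proof (intro subset_antisym subrelI)
  fix x y assume "(x, y) \<in> rtrancl_on F r"
  then show "(x, y) \<in> rtrancl_on F (r \<inter> F \<times> F)"
    by (induction rule: converse_rtrancl_on_induct) (auto intro: converse_rtrancl_on_into_rtrancl_on)
qed (auto intro: rtrancl_on_mono[of "r \<inter> F \<times> F" r F F])

lemma arcs_ends_induce: "arcs_ends (G \<restriction> S) = arcs_ends G \<inter> S \<times> S"
  by (auto simp: arcs_ends_conv)

lemma induce_verts: "wf_digraph G \<Longrightarrow> G \<restriction> verts G = G"
  by (auto simp: induce_subgraph_def wf_digraph_def intro!: pre_digraph.equality)

lemma (in wf_digraph) del_vert_eq_induce: "del_vert z = G \<restriction> (verts G - {z})"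
  by (auto simp: induce_subgraph_def del_vert_def wellformed)

text \<open>Connectedness is defined through the symmetric closure, which adds nothing to a
  symmetric arc relation; what remains is reachability inside \<open>S\<close>.\<close>

lemma connected_induce_iff:
  assumes "wf_digraph G" "symmetric G"
  shows "Digraph_Component.connected (G \<restriction> S) \<longleftrightarrow>
    S \<noteq> {} \<and> (\<forall>u\<in>S. \<forall>v\<in>S. (u, v) \<in> rtrancl_on S (arcs_ends G))"
proof -
  interpret wf_digraph G by fact
  interpret GS: wf_digraph "G \<restriction> S" by (rule wellformed_induce_subgraph)
  have "symmetric (G \<restriction> S)"
    using assms(2) by (auto simp: symmetric_def arcs_ends_induce sym_def)
  then have "u \<rightarrow>\<^sup>*\<^bsub>mk_symmetric (G \<restriction> S)\<^esub> v \<longleftrightarrow> (u, v) \<in> rtrancl_on S (arcs_ends G)" for u v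
    by (simp add: GS.adj_mk_symmetric_eq reachable_def arcs_ends_induce rtrancl_on_restrict)
  then show ?thesis
    by (simp add: Digraph_Component.connected_def strongly_connected_def)
qed

lemma graph_symE: "Digraph.graph G \<Longrightarrow> sym (arcs_ends G)"
  by (simp add: Digraph.graph_def pseudo_graph_def sym_digraph_def sym_digraph_axioms_def symmetric_def)

lemma two_connected_iff:
  assumes "Digraph.graph G"
  shows "two_connected G \<longleftrightarrow> verts G \<noteq> {} \<and>
    (\<forall>u\<in>verts G. \<forall>v\<in>verts G. (u, v) \<in> rtrancl_on (verts G) (arcs_ends G)) \<and>
    (\<forall>z\<in>verts G. verts G - {z} \<noteq> {} \<and>
      (\<forall>u\<in>verts G - {z}. \<forall>v\<in>verts G - {z}. (u, v) \<in> rtrancl_on (verts G - {z}) (arcs_ends G)))"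
proof -
  interpret Digraph.graph G by fact
  show ?thesis
    using connected_induce_iff[OF wf_digraph sym_arcs, of "verts G"]
      connected_induce_iff[OF wf_digraph sym_arcs, of "verts G - {_}"] assms
    unfolding two_connected_def del_vert_eq_induce induce_verts[OF wf_digraph] induce_subgraph_verts
    by blast
qed

lemma two_connected_imp_biconnected:
  assumes "subgraph B G" "two_connected B" "x \<in> verts B" "y \<in> verts B" "x \<noteq> y"
  shows "biconnected (verts G) (arcs_ends G) x y"
proof -
  have sub: "verts B \<subseteq> verts G" "arcs_ends B \<subseteq> arcs_ends G"
    using assms(1) by (auto dest: arcs_ends_mono)
  have g: "Digraph.graph B" using assms(2) by (simp add: two_connected_def)
  note B = assms(2)[unfolded two_connected_iff[OF g]]
  show ?thesis
    unfolding biconnected_def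
  proof (intro conjI ballI)
    have xy: "(x, y) \<in> rtrancl_on (verts B) (arcs_ends B)" using B assms by blast
    then show "(x, y) \<in> rtrancl_on (verts G) (arcs_ends G)" 
      by (rule rtrancl_on_mono[OF sub(2,1)])
    fix z assume z: "z \<in> verts G - {x, y}"
    have "(x, y) \<in> rtrancl_on (verts B - {z}) (arcs_ends B)"
    proof (cases "z \<in> verts B")
      case True
      then show ?thesis using B z assms by blast
    qed (use xy in simp)
    then show "(x, y) \<in> rtrancl_on (verts G - {z}) (arcs_ends G)"
      using sub by (auto intro: rtrancl_on_mono[of "arcs_ends B" _ "verts B - {z}"])
  qed fact
qed

lemma two_connected_imp_subset_block_verts:
  assumes "subgraph B G" "two_connected B" "a \<in> verts B" "c \<in> verts B" "a \<noteq> c"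
  shows "verts B \<subseteq> block_verts (verts G) (arcs_ends G) a c"
  using two_connected_imp_biconnected[OF assms(1,2)] assms(3-5) by (auto simp: block_verts_def)

lemma block_verts_subset: "biconnected V E a c \<Longrightarrow> block_verts V E a c \<subseteq> V"
  by (auto simp: block_verts_def dest: biconnected_in)

context Digraph.graph begin

lemma graph_induce:
  assumes "S \<subseteq> verts G" shows "Digraph.graph (G \<restriction> S)"
proof -
  have i: "induced_subgraph (G \<restriction> S) G" using assms by (rule induced_induce)
  interpret D: digraph "G \<restriction> S" using i by (rule digraphI_induced)
  show ?thesis using induced_graph_imp_symmetric[OF sym_arcs i] by (rule D.graphI)
qed

text \<open>Walks towards the pair \<open>{a, c}\<close> can be kept inside the block by
  \<open>rtrancl_on_block_verts\<close>, so all its vertices are joined through one member of the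
  pair.\<close>

lemma two_connected_block_verts:
  assumes "biconnected (verts G) (arcs_ends G) a c"
  shows "two_connected (G \<restriction> block_verts (verts G) (arcs_ends G) a c)"
proof -
  let ?K = "block_verts (verts G) (arcs_ends G) a c"
  note E = graph_symE[OF graph_axioms]
  have K: "?K \<subseteq> verts G" using assms by (rule block_verts_subset)
  then have KZ: "(verts G - Z) \<inter> ?K = ?K - Z" for Z by blast
  have ac: "a \<noteq> c" "a \<in> ?K" "c \<in> ?K" using assms by (auto simp: biconnected_def block_verts_def)
  \<comment> \<open>\<open>Z = {}\<close> serves connectedness and \<open>Z = {z}\<close>
    connectedness after a deletion; in both cases a member \<open>t\<close> of the pair
    survives.\<close>
  have r: "(u, v) \<in> rtrancl_on (?K - Z) (arcs_ends G)"
    if Z: "Z = {} \<or> (\<exists>z. Z = {z})" and uv: "u \<in> ?K - Z" "v \<in> ?K - Z" for Z u v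
  proof -
    obtain t where t: "t \<in> {a, c} - Z" using ac Z by auto
    have "(w, t) \<in> rtrancl_on (?K - Z) (arcs_ends G)" if w: "w \<in> ?K - Z" for w
    proof -
      obtain s where s: "s \<in> {a, c} - Z" "(w, s) \<in> rtrancl_on (verts G - Z) (arcs_ends G)"
      proof (cases "Z = {}")
        case True
        have "biconnected (verts G) (arcs_ends G) w a" if "w \<noteq> a"
          using that w assms by (auto simp: block_verts_def intro: biconnected_sym[OF E])
        then have "(w, a) \<in> rtrancl_on (verts G) (arcs_ends G)"
          using w K by (cases "w = a") (auto simp: biconnected_def)
        then show ?thesis using that True by auto
      next
        case False
        then obtain z where "Z = {z}" using Z by auto
        then show ?thesis using that block_verts_reach[OF E assms, of w z] w by auto
      qed
      have ws: "(w, s) \<in> rtrancl_on (?K - Z) (arcs_ends G)"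
        using rtrancl_on_block_verts[OF E assms _ _ _ s(2)] w s(1)
        by (auto simp: KZ)
      have "(s, t) \<in> rtrancl_on (verts G - Z) (arcs_ends G)"
      proof (cases "s = t")
        case False
        then have "biconnected (verts G) (arcs_ends G) s t"
          using s t assms biconnected_sym[OF E] by auto
        then show ?thesis
          using s t Z biconnectedD[of "verts G" "arcs_ends G" s t] by (auto simp: biconnected_def)
      qed (use s K ac in auto)
      then have "(s, t) \<in> rtrancl_on (?K - Z) (arcs_ends G)"
        using rtrancl_on_block_verts[OF E assms, of "verts G - Z" s t] s(1) t ac
        by (auto simp: KZ)
      with ws show ?thesis by (rule rtrancl_on_trans)
    qed
    then show ?thesis using uv rtrancl_on_trans rtrancl_on_sym[OF E, of "?K - Z"] by (meson symD)
  qed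
  have "(u, v) \<in> rtrancl_on ?K (arcs_ends (G \<restriction> ?K))" if "u \<in> ?K" "v \<in> ?K" for u v
    using r[of "{}" u v] that rtrancl_on_restrict[of ?K "arcs_ends G"] by (simp add: arcs_ends_induce)
  moreover have "(u, v) \<in> rtrancl_on (?K - {z}) (arcs_ends (G \<restriction> ?K))"
    if "u \<in> ?K - {z}" "v \<in> ?K - {z}" for u v z
  proof -
    have "(u, v) \<in> rtrancl_on (?K - {z}) (arcs_ends G \<inter> (?K - {z}) \<times> (?K - {z}))"
      using r[of "{z}" u v] that by (simp add: rtrancl_on_restrict)
    then show ?thesis by (rule rtrancl_on_mono[rotated 2]) (auto simp: arcs_ends_induce)
  qed
  moreover have "?K - {z} \<noteq> {}" for z using ac by (metis Diff_iff empty_iff singletonD)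
  ultimately show ?thesis using ac
    unfolding two_connected_iff[OF graph_induce[OF K]] induce_subgraph_verts by blast
qed

lemma subgraph_induce:
  assumes "subgraph B G" "verts B \<subseteq> S" "S \<subseteq> verts G"
  shows "subgraph B (G \<restriction> S)"
  using assms wellformed_induce_subgraph[of S]
  by (auto simp: subgraph_def compatible_def wf_digraph.tail_in_verts wf_digraph.head_in_verts
      dest: subsetD wf_digraph.tail_in_verts wf_digraph.head_in_verts)

text \<open>\<open>B\<close> is a subgraph of the 2-connected graph induced on
  \<open>block_verts\<close>, so maximality makes them equal. In particular a block contains all
  arcs between its vertices, which justifies working with vertex sets.\<close>

lemma block_eq_induce:
  assumes "block G B" "a \<in> verts B" "c \<in> verts B" "a \<noteq> c"
  shows "B = G \<restriction> block_verts (verts G) (arcs_ends G) a c"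
proof -
  let ?K = "block_verts (verts G) (arcs_ends G) a c"
  have B: "subgraph B G" "two_connected B"
    "\<And>H'. H' \<noteq> B \<Longrightarrow> subgraph B H' \<Longrightarrow> \<not> (subgraph H' G \<and> two_connected H')"
    using assms(1) by (auto simp: block_def max_subgraph_def)
  have ac: "biconnected (verts G) (arcs_ends G) a c"
    using two_connected_imp_biconnected[OF B(1,2)] assms by blast
  have "subgraph B (G \<restriction> ?K)"
    using subgraph_induce[OF B(1) two_connected_imp_subset_block_verts[OF B(1,2) assms(2-4)]]
      block_verts_subset[OF ac] by blast
  then show ?thesis
    using B(3)[of "G \<restriction> ?K"] two_connected_block_verts[OF ac]
      subgraph_induce_subgraphI[OF block_verts_subset[OF ac]] by metis
qed

text \<open>A 2-connected graph above the induced one contains \<open>a\<close> and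
  \<open>c\<close>, so all its vertices are biconnected to both and lie in
  \<open>block_verts\<close> already.\<close>

lemma block_induce_block_verts:
  assumes ac: "biconnected (verts G) (arcs_ends G) a c"
  shows "block G (G \<restriction> block_verts (verts G) (arcs_ends G) a c)"
proof -
  let ?K = "block_verts (verts G) (arcs_ends G) a c"
  have "H = G \<restriction> ?K" if H: "subgraph (G \<restriction> ?K) H" "subgraph H G" "two_connected H" for H
  proof -
    have "?K \<subseteq> verts H" using H(1) by (auto simp: subgraph_def)
    then have "verts H \<subseteq> ?K"
      using two_connected_imp_subset_block_verts[OF H(2,3), of a c] ac
      by (auto simp: block_verts_def biconnected_def)
    then have "subgraph H (G \<restriction> ?K)" using subgraph_induce[OF H(2)] block_verts_subset[OF ac] by blast
    then show ?thesis using H(1) by (auto simp: subgraph_def compatible_def)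
  qed
  then show ?thesis
    using two_connected_block_verts[OF ac] subgraph_induce_subgraphI[OF block_verts_subset[OF ac]]
    by (auto simp: block_def max_subgraph_def)
qed

lemma block_biconnected:
  "block G B \<Longrightarrow> x \<in> verts B \<Longrightarrow> y \<in> verts B \<Longrightarrow> x \<noteq> y \<Longrightarrow> biconnected (verts G) (arcs_ends G) x y"
  by (auto simp: block_def max_subgraph_def intro: two_connected_imp_biconnected)

lemma block_closed:
  assumes "block G B" "a \<in> verts B" "c \<in> verts B" "a \<noteq> c"
    and "biconnected (verts G) (arcs_ends G) v a" "biconnected (verts G) (arcs_ends G) v c"
  shows "v \<in> verts B"
  using assms(5,6) by (subst block_eq_induce[OF assms(1-4)]) (simp add: block_verts_def)

lemma block_unique:
  "block G B \<Longrightarrow> block G B' \<Longrightarrow> {a, c} \<subseteq> verts B \<inter> verts B' \<Longrightarrow> a \<noteq> c \<Longrightarrow> B = B'"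
  using block_eq_induce[of B a c] block_eq_induce[of B' a c] by simp

lemma ex_block:
  assumes "biconnected (verts G) (arcs_ends G) a c"
  obtains B where "block G B" "a \<in> verts B" "c \<in> verts B"
  using block_induce_block_verts[OF assms] that by (simp add: block_verts_def)

text \<open>The nonemptiness clause of \<open>two_connected\<close>, which excludes a single vertex,
  supplies the second vertex that every product of two block projections needs.\<close>

lemma block_other_vertex:
  assumes "block G B" "x \<in> verts B"
  obtains y where "y \<in> verts B" "y \<noteq> x"
proof -
  have B: "two_connected B" using assms(1) by (simp add: block_def max_subgraph_def)
  then have "Digraph.graph B" by (simp add: two_connected_def)
  then show ?thesis using B assms(2) that by (metis all_not_in_conv Diff_iff singletonI two_connected_iff)
qed

lemma block_subset: "block G B \<Longrightarrow> verts B \<subseteq> verts G"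
  by (auto simp: block_def max_subgraph_def)

end

section \<open>Projections and corners in C*-algebras\<close>

context unital_cstar_algebra begin

lemma smult_add_left: "x \<in> carrier A \<Longrightarrow> (c + d) \<odot> x = c \<odot> x \<oplus> d \<odot> x"
  using smult_l_distr[of c d x] by simp

lemma smult_smult: "x \<in> carrier A \<Longrightarrow> c \<odot> (d \<odot> x) = (c * d) \<odot> x"
  using smult_assoc1[of c d x] by simp

lemma smult_one': "x \<in> carrier A \<Longrightarrow> 1 \<odot> x = x"
  using smult_one[of x] by simp

lemma smult_two: "x \<in> carrier A \<Longrightarrow> 2 \<odot> x = x \<oplus> x"
  using smult_add_left[of x 1 1] by (simp add: smult_one')

lemma smult_four: "x \<in> carrier A \<Longrightarrow> 4 \<odot> x = (x \<oplus> x) \<oplus> (x \<oplus> x)"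
  using smult_add_left[of x 2 2] by (simp add: smult_two)

lemma smult_closed': "x \<in> carrier A \<Longrightarrow> c \<odot> x \<in> carrier A"
  by simp

lemma smult_minus: "x \<in> carrier A \<Longrightarrow> c \<odot> (\<ominus> x) = \<ominus> (c \<odot> x)"
  by (simp add: minus_smult smult_smult)

lemma smult_diff: "x \<in> carrier A \<Longrightarrow> y \<in> carrier A \<Longrightarrow> c \<odot> (x \<ominus> y) = c \<odot> x \<ominus> c \<odot> y"
  using smult_r_distr[of c x "\<ominus> y"] by (simp add: a_minus_def smult_minus)

lemma nrm_diff_le: "x \<in> carrier A \<Longrightarrow> y \<in> carrier A \<Longrightarrow> nrm A (x \<ominus> y) \<le> nrm A x + nrm A y"
  using nrm_triangle[of x "\<ominus> y"] by (simp add: a_minus_def minus_smult nrm_smult)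

lemma nrm_mult_le_one:
  assumes "x \<in> carrier A" "y \<in> carrier A" "nrm A x \<le> 1" "nrm A y \<le> 1"
  shows "nrm A (x \<otimes> y) \<le> 1"
proof -
  have "nrm A x * nrm A y \<le> 1 * 1" using assms nrm_nonneg by (intro mult_mono) auto
  then show ?thesis using nrm_mult[OF assms(1,2)] by simp
qed

lemma star_one: "star A \<one> = \<one>"
  using star_mult[of \<one> "star A \<one>"] star_star[of \<one>] by (simp add: star_closed)

lemma star_zero: "star A \<zero> = \<zero>"
  using star_smult[of \<zero> 0] smult_l_null[of \<zero>] smult_l_null[of "star A \<zero>"] by (simp add: star_closed)

lemma star_minus: "x \<in> carrier A \<Longrightarrow> star A (\<ominus> x) = \<ominus> star A x"
  by (simp add: minus_smult star_smult star_closed)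

definition proj :: "'x \<Rightarrow> bool" where
  "proj p \<longleftrightarrow> p \<in> carrier A \<and> p \<otimes> p = p \<and> star A p = p"

lemma projD: "proj p \<Longrightarrow> p \<in> carrier A" "proj p \<Longrightarrow> p \<otimes> p = p" "proj p \<Longrightarrow> star A p = p"
  by (simp_all add: proj_def)

lemma proj_one: "proj \<one>"
  by (simp add: proj_def star_one)

lemma nrm_proj:
  assumes "proj p" "p \<noteq> \<zero>" shows "nrm A p = 1"
proof -
  have "nrm A p = (nrm A p)\<^sup>2" using cstar_identity[of p] projD[OF assms(1)] by simp
  moreover have "nrm A p \<noteq> 0" using assms nrm_eq_zero projD by blast
  ultimately show ?thesis by (simp add: power2_eq_square)
qed

lemma proj_mult_commute:
  assumes "proj p" "proj q" "p \<otimes> q = q \<otimes> p"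
  shows "proj (p \<otimes> q)"
proof -
  have c: "p \<in> carrier A" "q \<in> carrier A" using assms projD by auto
  have "(p \<otimes> q) \<otimes> (p \<otimes> q) = (p \<otimes> q) \<otimes> (q \<otimes> p)" by (simp add: assms(3))
  also have "\<dots> = p \<otimes> (q \<otimes> q) \<otimes> p" using c by (simp add: m_assoc)
  also have "\<dots> = p \<otimes> (p \<otimes> q)" using c by (simp add: projD(2)[OF assms(2)] m_assoc assms(3)[symmetric])
  also have "\<dots> = p \<otimes> q" using c projD(2)[OF assms(1)] m_assoc[of p p q] by simp
  finally show ?thesis using c assms by (simp add: proj_def star_mult)
qed

text \<open>\<open>u - 2w\<close> is a self-adjoint unitary of the corner of \<open>u\<close>.\<close>

lemma nrm_reflection:
  assumes "proj u" "u \<noteq> \<zero>" "proj w" "u \<otimes> w = w" "w \<otimes> u = w"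
  shows "nrm A (u \<ominus> 2 \<odot> w) = 1"
proof -
  have c: "u \<in> carrier A" "w \<in> carrier A" using assms projD by auto
  have 2: "u \<ominus> 2 \<odot> w = u \<ominus> (w \<oplus> w)" using c by (simp add: smult_two)
  have "star A (u \<ominus> (w \<oplus> w)) = u \<ominus> (w \<oplus> w)"
    using c assms by (simp add: a_minus_def star_add star_minus projD)
  moreover have "(u \<ominus> (w \<oplus> w)) \<otimes> (u \<ominus> (w \<oplus> w)) =
      u \<otimes> u \<ominus> (u \<otimes> w \<oplus> u \<otimes> w) \<ominus> (w \<otimes> u \<oplus> w \<otimes> u) \<oplus> ((w \<otimes> w \<oplus> w \<otimes> w) \<oplus> (w \<otimes> w \<oplus> w \<otimes> w))"
    using c by algebra
  moreover have "u \<ominus> (w \<oplus> w) \<ominus> (w \<oplus> w) \<oplus> ((w \<oplus> w) \<oplus> (w \<oplus> w)) = u" using c by algebra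
  ultimately have "(nrm A (u \<ominus> 2 \<odot> w))\<^sup>2 = nrm A u"
    using cstar_identity[of "u \<ominus> (w \<oplus> w)"] c assms by (simp add: 2 projD)
  also have "\<dots> = 1" using nrm_proj assms by simp
  finally show ?thesis using nrm_nonneg[of "u \<ominus> 2 \<odot> w"] c by (simp add: power2_eq_1_iff)
qed

section \<open>The unit as an extreme point of the unit ball\<close>

definition unit_segment :: "'x \<Rightarrow> bool" where
  "unit_segment h \<longleftrightarrow> h \<in> carrier A \<and> nrm A (\<one> \<oplus> h) \<le> 1 \<and> nrm A (\<one> \<ominus> h) \<le> 1"

lemma unit_segment_minus: "unit_segment h \<Longrightarrow> unit_segment (\<ominus> h)"
  by (simp add: unit_segment_def a_minus_def)

lemma square_diff:
  "x \<in> carrier A \<Longrightarrow> y \<in> carrier A \<Longrightarrow> x \<otimes> x \<ominus> y \<otimes> y = x \<otimes> (x \<ominus> y) \<oplus> (x \<ominus> y) \<otimes> y"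
  by algebra

text \<open>The difference of the squares of \<open>1 + h\<close> and \<open>1 - h\<close> is
  \<open>4 h\<close>, and both squares have norm at most one.\<close>

lemma unit_segment_half:
  assumes "unit_segment h" shows "nrm A h \<le> 1 / 2"
proof -
  have h: "h \<in> carrier A" "nrm A (\<one> \<oplus> h) \<le> 1" "nrm A (\<one> \<ominus> h) \<le> 1"
    using assms by (auto simp: unit_segment_def)
  have eq: "4 \<odot> h = (\<one> \<oplus> h) \<otimes> (\<one> \<oplus> h) \<ominus> (\<one> \<ominus> h) \<otimes> (\<one> \<ominus> h)"
  proof -
    let ?a = "\<one> \<oplus> h" and ?b = "\<one> \<ominus> h" and ?y = "h \<oplus> h"
    have c: "?a \<in> carrier A" "?b \<in> carrier A" "?y \<in> carrier A" using h by auto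
    have s: "?a \<oplus> ?b = \<one> \<oplus> \<one>" using h(1) by algebra
    have d: "?a \<ominus> ?b = ?y" using h(1) by algebra
    have hb: "h \<otimes> ?b = ?b \<otimes> h" using h(1) by (simp add: a_minus_def l_distr r_distr l_minus r_minus)
    have yb: "?y \<otimes> ?b = ?b \<otimes> ?y"
      by (simp only: l_distr[OF h(1) h(1) c(2)] r_distr[OF h(1) h(1) c(2)] hb)
    have "?a \<otimes> ?a \<ominus> ?b \<otimes> ?b = ?a \<otimes> ?y \<oplus> ?b \<otimes> ?y"
      unfolding square_diff[OF c(1,2)] d yb ..
    also have "\<dots> = (\<one> \<oplus> \<one>) \<otimes> ?y" unfolding s[symmetric] by (rule l_distr[OF c, symmetric])
    also have "\<dots> = 4 \<odot> h" using l_distr[OF one_closed one_closed c(3)] c(3) by (simp add: smult_four[OF h(1)])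
    finally show ?thesis by (rule sym)
  qed
  have "nrm A (4 \<odot> h) \<le> nrm A ((\<one> \<oplus> h) \<otimes> (\<one> \<oplus> h)) + nrm A ((\<one> \<ominus> h) \<otimes> (\<one> \<ominus> h))"
    unfolding eq using h by (intro nrm_diff_le) auto
  also have "\<dots> \<le> 1 + 1" by (rule add_mono; rule nrm_mult_le_one) (use h in auto)
  finally have "nrm A (4 \<odot> h) \<le> 1 + 1" .
  then show ?thesis using nrm_smult[OF h(1), of 4] by simp
qed

text \<open>For \<open>k = (3h - h\<^sup>3) / 2\<close> we have \<open>4 (1 + k) = (1 + h)\<^sup>3 + 3 (1 + h)\<^sup>2 (1 - h)\<close>.  So \<open>k\<close> spans a unit
  segment if \<open>h\<close> does; it is longer than \<open>h\<close> by a factor \<open>5 / 4\<close>, whereas all lengths are at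
  most \<open>1 / 2\<close>.  Hence only \<open>h = 0\<close> is possible, i.e. the unit is an extreme point of the unit ball.\<close>

lemma unit_segment_expand_aux:
  assumes "unit_segment h"
  shows "nrm A (\<one> \<oplus> (1/2) \<odot> (h \<oplus> h \<oplus> h \<ominus> h \<otimes> h \<otimes> h)) \<le> 1"
proof -
  let ?a = "\<one> \<oplus> h" and ?b = "\<one> \<ominus> h"
  have h: "h \<in> carrier A" "nrm A ?a \<le> 1" "nrm A ?b \<le> 1" using assms by (auto simp: unit_segment_def)
  define w where "w = h \<oplus> h \<oplus> h \<ominus> h \<otimes> h \<otimes> h"
  define k where "k = (1/2) \<odot> w"
  have c: "w \<in> carrier A" "k \<in> carrier A" using h by (auto simp: w_def k_def)
  have kk: "k \<oplus> k = w" using c smult_add_left[of w "1/2" "1/2"] by (simp add: k_def smult_one')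
  have "4 \<odot> (\<one> \<oplus> k) = (\<one> \<oplus> \<one>) \<oplus> (\<one> \<oplus> \<one>) \<oplus> ((k \<oplus> k) \<oplus> (k \<oplus> k))"
    using c by (subst smult_four) (simp, algebra)
  \<comment> \<open>As \<open>a + b = 2\<close>, one of the three terms \<open>a a b\<close> turns
    \<open>a a a\<close> into \<open>2 a a\<close>; the total is then
    \<open>2 (a a + a a b) = 2 (2 + w)\<close>, that is \<open>4 + 4 k\<close>.\<close>
  also have "\<dots> = ?a \<otimes> ?a \<otimes> ?a \<oplus> (?a \<otimes> ?a \<otimes> ?b \<oplus> (?a \<otimes> ?a \<otimes> ?b \<oplus> ?a \<otimes> ?a \<otimes> ?b))"
  proof -
    define y where "y = h \<otimes> h \<otimes> h"
    have y: "y \<in> carrier A" using h by (simp add: y_def)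
    have ac: "?a \<in> carrier A" "?b \<in> carrier A" using h by auto
    have atoms: "u \<oplus> (h \<oplus> v) \<oplus> (u \<ominus> (v \<oplus> y)) = (u \<oplus> u) \<oplus> (h \<ominus> y)"
      if "u \<in> carrier A" "v \<in> carrier A" for u v using that h(1) y by algebra
    have add4: "(u \<oplus> u) \<oplus> (v \<oplus> v) = (u \<oplus> v) \<oplus> (u \<oplus> v)"
      if "u \<in> carrier A" "v \<in> carrier A" for u v
      using that by (simp add: M.a_assoc M.a_lcomm[of v u v])
    have ab: "?a \<otimes> ?b = \<one> \<ominus> h \<otimes> h"
      using h(1) by algebra (simp add: M.r_neg1 M.r_neg2)
    have "?a \<otimes> ?a \<oplus> ?a \<otimes> ?a \<otimes> ?b = ?a \<otimes> ?a \<oplus> ?a \<otimes> (?a \<otimes> ?b)"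
      using ac by (simp add: m_assoc)
    also have "\<dots> = ?a \<oplus> (h \<oplus> h \<otimes> h) \<oplus> (?a \<ominus> (h \<otimes> h \<oplus> y))"
    proof -
      have "?a \<otimes> ?a = ?a \<oplus> (h \<oplus> h \<otimes> h)"
        using r_distr[of \<one> h ?a] l_distr[of \<one> h h] h(1) ac by simp
      moreover have "?a \<otimes> (\<one> \<ominus> h \<otimes> h) = ?a \<ominus> (h \<otimes> h \<oplus> y)"
        using r_distr[of \<one> "\<ominus> (h \<otimes> h)" ?a] l_distr[of \<one> h "h \<otimes> h"] h(1) ac
        by (simp add: a_minus_def r_minus y_def m_assoc)
      ultimately show ?thesis unfolding ab by simp
    qed
    also have "\<dots> = (?a \<oplus> ?a) \<oplus> (h \<ominus> y)" by (rule atoms) (use h ac in auto)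
    also have "\<dots> = (\<one> \<oplus> \<one>) \<oplus> w" unfolding w_def y_def[symmetric] using h(1) y by algebra
    finally have R: "?a \<otimes> ?a \<oplus> ?a \<otimes> ?a \<otimes> ?b = (\<one> \<oplus> \<one>) \<oplus> w" .
    have "?a \<oplus> ?b = \<one> \<oplus> \<one>" using h(1) by algebra
    then have "?a \<otimes> ?a \<otimes> ?a \<oplus> ?a \<otimes> ?a \<otimes> ?b = ?a \<otimes> ?a \<oplus> ?a \<otimes> ?a"
      using r_distr[OF ac, of "?a \<otimes> ?a"] r_distr[of \<one> \<one> "?a \<otimes> ?a"] ac by simp
    moreover have "?a \<otimes> ?a \<otimes> ?a \<oplus> (?a \<otimes> ?a \<otimes> ?b \<oplus> (?a \<otimes> ?a \<otimes> ?b \<oplus> ?a \<otimes> ?a \<otimes> ?b)) =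
        (?a \<otimes> ?a \<otimes> ?a \<oplus> ?a \<otimes> ?a \<otimes> ?b) \<oplus> (?a \<otimes> ?a \<otimes> ?b \<oplus> ?a \<otimes> ?a \<otimes> ?b)"
      using M.a_assoc[of "?a \<otimes> ?a \<otimes> ?a" "?a \<otimes> ?a \<otimes> ?b" "?a \<otimes> ?a \<otimes> ?b \<oplus> ?a \<otimes> ?a \<otimes> ?b"] ac by simp
    ultimately have "?a \<otimes> ?a \<otimes> ?a \<oplus> (?a \<otimes> ?a \<otimes> ?b \<oplus> (?a \<otimes> ?a \<otimes> ?b \<oplus> ?a \<otimes> ?a \<otimes> ?b)) =
        (?a \<otimes> ?a \<oplus> ?a \<otimes> ?a) \<oplus> (?a \<otimes> ?a \<otimes> ?b \<oplus> ?a \<otimes> ?a \<otimes> ?b)" by simp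
    also have "\<dots> = (?a \<otimes> ?a \<oplus> ?a \<otimes> ?a \<otimes> ?b) \<oplus> (?a \<otimes> ?a \<oplus> ?a \<otimes> ?a \<otimes> ?b)"
      by (rule add4) (use ac in auto)
    also have "\<dots> = (\<one> \<oplus> \<one>) \<oplus> (\<one> \<oplus> \<one>) \<oplus> (w \<oplus> w)"
      unfolding R by (rule add4[symmetric]) (use c in auto)
    finally show ?thesis unfolding kk ..
  qed
  also have "nrm A \<dots> \<le> 4"
  proof -
    have m: "?a \<otimes> ?a \<otimes> ?a \<in> carrier A" "?a \<otimes> ?a \<otimes> ?b \<in> carrier A" using h by auto
    have n: "nrm A (?a \<otimes> ?a \<otimes> ?a) \<le> 1" "nrm A (?a \<otimes> ?a \<otimes> ?b) \<le> 1"
      using h by (auto intro!: nrm_mult_le_one)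
    have "nrm A (u \<oplus> (v \<oplus> (v \<oplus> v))) \<le> 4"
      if "u \<in> carrier A" "v \<in> carrier A" "nrm A u \<le> 1" "nrm A v \<le> 1" for u v
    proof -
      have v: "v \<oplus> v \<in> carrier A" "v \<oplus> (v \<oplus> v) \<in> carrier A" using that by auto
      show ?thesis
        using nrm_triangle[OF that(1) v(2)] nrm_triangle[OF that(2) v(1)] nrm_triangle[OF that(2,2)] that(3,4)
        by linarith
    qed
    from this[OF m n] show ?thesis .
  qed
  finally have "nrm A (4 \<odot> (\<one> \<oplus> k)) \<le> 4" .
  then have "nrm A (\<one> \<oplus> k) \<le> 1" using c nrm_smult[of "\<one> \<oplus> k" 4] by simp
  then show ?thesis by (simp only: k_def w_def)
qed

lemma unit_segment_expand:
  assumes "unit_segment h"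
  shows "\<exists>k. unit_segment k \<and> 5 / 4 * nrm A h \<le> nrm A k"
proof (intro exI conjI)
  let ?w = "h \<oplus> h \<oplus> h \<ominus> h \<otimes> h \<otimes> h"
  have h: "h \<in> carrier A" using assms by (auto simp: unit_segment_def)
  have "\<ominus> h \<oplus> \<ominus> h \<oplus> \<ominus> h \<ominus> \<ominus> h \<otimes> \<ominus> h \<otimes> \<ominus> h = \<ominus> ?w" using h by algebra
  then have "nrm A (\<one> \<ominus> (1/2) \<odot> ?w) \<le> 1"
    using unit_segment_expand_aux[OF unit_segment_minus[OF assms]] h by (simp add: a_minus_def smult_minus)
  then show "unit_segment ((1/2) \<odot> ?w)"
    using unit_segment_expand_aux[OF assms] h by (simp add: unit_segment_def)
  let ?r = "nrm A h"
  have r: "0 \<le> ?r" "?r \<le> 1 / 2" using nrm_nonneg[OF h] unit_segment_half[OF assms] by auto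
  have "h \<oplus> h \<oplus> h = 3 \<odot> h" using h smult_add_left[of h 2 1] by (simp add: smult_two smult_one')
  then have "3 * ?r = nrm A (h \<oplus> h \<oplus> h)" using h by (simp add: nrm_smult)
  also have "h \<oplus> h \<oplus> h = ?w \<oplus> h \<otimes> h \<otimes> h" using h by algebra
  also have "nrm A \<dots> \<le> nrm A ?w + nrm A (h \<otimes> h \<otimes> h)" using h by (intro nrm_triangle) auto
  also have "nrm A (h \<otimes> h \<otimes> h) \<le> nrm A (h \<otimes> h) * ?r" using h by (intro nrm_mult) auto
  also have "\<dots> \<le> (?r * ?r) * ?r" using h r nrm_mult[of h h] by (intro mult_right_mono) auto
  \<comment> \<open>With \<open>r \<le> 1/2\<close> the cubic term is at most \<open>r / 4\<close>,
    so \<open>?w\<close> has norm at least \<open>11/4 r\<close> and its half at least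
    \<open>11/8 r\<close>; \<open>5/4\<close> is a convenient smaller factor above one.\<close>
  also have "\<dots> \<le> (1/2 * (1/2)) * ?r" using r by (intro mult_right_mono mult_mono) auto
  finally show "5 / 4 * ?r \<le> nrm A ((1/2) \<odot> ?w)" using h r by (simp add: nrm_smult)
qed

lemma unit_segment_zero:
  assumes "unit_segment h" shows "h = \<zero>"
proof -
  have h: "h \<in> carrier A" using assms by (auto simp: unit_segment_def)
  have "\<exists>k. unit_segment k \<and> (5/4)^n * nrm A h \<le> nrm A k" for n
  proof (induction n)
    case 0
    then show ?case using assms by auto
  next
    case (Suc n)
    then obtain k where "unit_segment k" "(5/4)^n * nrm A h \<le> nrm A k" by blast
    then show ?case using unit_segment_expand[of k] by fastforce
  qed
  then have le: "(5/4)^n * nrm A h \<le> 1 / 2" for n by (meson unit_segment_half order_trans)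
  have "nrm A h = 0"
  proof (rule ccontr)
    assume "nrm A h \<noteq> 0"
    then have pos: "nrm A h > 0" using nrm_nonneg[OF h] by simp
    obtain n where "1 / nrm A h < (5/4)^n" using real_arch_pow[of "5/4"] by auto
    then have "1 < (5/4)^n * nrm A h" using pos by (simp add: field_simps)
    with le[of n] show False by simp
  qed
  then show ?thesis using h nrm_eq_zero by blast
qed

text \<open>Norm version of the fact that only zero is both positive and negative. With
  \<open>h = (2/m) e\<close>, \<open>1 + h\<close> is \<open>(m + 2 e) / m\<close>, and
  \<open>1 - h\<close> is the convex combination of \<open>1\<close> and \<open>1 - 2 e\<close> with
  weights \<open>1 - 1/m\<close> and \<open>1/m\<close>, for which \<open>1 \<le> m\<close> is
  needed. Both lie in the unit ball, so extremality of the unit gives \<open>h = 0\<close>.\<close>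

lemma positive_and_negative_imp_zero:
  assumes e: "e \<in> carrier A" and pos: "nrm A (\<one> \<ominus> 2 \<odot> e) \<le> 1"
    and m: "1 \<le> m" and neg: "nrm A (complex_of_real m \<odot> \<one> \<oplus> 2 \<odot> e) \<le> m"
  shows "e = \<zero>"
proof -
  let ?h = "complex_of_real (2 / m) \<odot> e"
  have s: "nrm A (complex_of_real r \<odot> y) = \<bar>r\<bar> * nrm A y" if "y \<in> carrier A" for r y
    by (simp only: nrm_smult[OF that] norm_of_real)
  have eq: "complex_of_real (1 / m) \<odot> (complex_of_real m \<odot> \<one> \<oplus> 2 \<odot> e) = \<one> \<oplus> ?h"
    using e m smult_r_distr[of "complex_of_real (1/m)" "complex_of_real m \<odot> \<one>" "2 \<odot> e"]
    by (simp add: smult_smult smult_one')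
  have "nrm A (\<one> \<oplus> ?h) = \<bar>1 / m\<bar> * nrm A (complex_of_real m \<odot> \<one> \<oplus> 2 \<odot> e)"
    unfolding eq[symmetric] by (rule s) (use e in auto)
  also have "\<dots> \<le> 1" using neg m by (simp add: field_simps)
  finally have 1: "nrm A (\<one> \<oplus> ?h) \<le> 1" .
  have "complex_of_real (1 - 1/m) \<odot> \<one> \<oplus> complex_of_real (1/m) \<odot> (\<one> \<ominus> 2 \<odot> e) =
      (complex_of_real (1 - 1/m) \<odot> \<one> \<oplus> complex_of_real (1/m) \<odot> \<one>) \<ominus> complex_of_real (1/m) \<odot> (2 \<odot> e)"
    unfolding smult_diff[OF one_closed smult_closed'[OF e]] using e
    by (simp add: a_minus_def M.a_assoc)
  also have "\<dots> = \<one> \<ominus> ?h"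
    using e smult_add_left[of \<one> "complex_of_real (1 - 1/m)" "complex_of_real (1/m)"]
    by (simp add: smult_smult smult_one')
  finally have eq: "complex_of_real (1 - 1/m) \<odot> \<one> \<oplus> complex_of_real (1/m) \<odot> (\<one> \<ominus> 2 \<odot> e) = \<one> \<ominus> ?h" .
  have "nrm A (\<one> \<ominus> ?h) \<le>
      nrm A (complex_of_real (1 - 1/m) \<odot> \<one>) + nrm A (complex_of_real (1/m) \<odot> (\<one> \<ominus> 2 \<odot> e))"
    unfolding eq[symmetric] by (rule nrm_triangle) (use e in auto)
  also have "\<dots> = \<bar>1 - 1/m\<bar> + \<bar>1/m\<bar> * nrm A (\<one> \<ominus> 2 \<odot> e)"
  proof -
    have c: "\<one> \<ominus> 2 \<odot> e \<in> carrier A" using e by simp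
    show ?thesis unfolding s[OF one_closed] s[OF c] nrm_proj[OF proj_one one_neq_zero] mult_1_right ..
  qed
  also have "\<dots> \<le> \<bar>1 - 1/m\<bar> + \<bar>1/m\<bar> * 1"
    by (rule add_left_mono, rule mult_left_mono[OF pos abs_ge_zero])
  also have "\<dots> = 1" using m by (simp add: abs_if)
  finally have "unit_segment ?h" using 1 e by (simp add: unit_segment_def)
  then have "?h = \<zero>" by (rule unit_segment_zero)
  then have "nrm A ?h = 0" by (simp add: nrm_zero)
  then show ?thesis using e m nrm_eq_zero[OF e] by (simp add: nrm_smult)
qed

end

section \<open>Corner algebras\<close>

definition corner :: "'x cstar \<Rightarrow> 'x \<Rightarrow> 'x cstar" where
  "corner A p = A\<lparr>carrier := {x \<in> carrier A. p \<otimes>\<^bsub>A\<^esub> x = x \<and> x \<otimes>\<^bsub>A\<^esub> p = x}, one := p\<rparr>"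

context unital_cstar_algebra begin

context
  fixes p assumes p: "proj p" "p \<noteq> \<zero>"
begin

abbreviation "C \<equiv> corner A p"

lemma corner_simps:
  "x \<in> carrier C \<longleftrightarrow> x \<in> carrier A \<and> p \<otimes> x = x \<and> x \<otimes> p = x"
  "monoid.mult C = monoid.mult A" "\<one>\<^bsub>C\<^esub> = p" "\<zero>\<^bsub>C\<^esub> = \<zero>" "add C = add A" "smult C = smult A"
  "star C = star A" "nrm C = nrm A"
  by (simp_all add: corner_def)

lemma pA[simp]: "p \<in> carrier A" "p \<otimes> p = p" "star A p = p"
  using p projD by auto

lemma corner_star: "x \<in> carrier C \<Longrightarrow> star A x \<in> carrier C"
  using star_mult[of p x] star_mult[of x p] by (simp add: corner_simps star_closed)

lemma corner_minus: "x \<in> carrier C \<Longrightarrow> \<ominus> x \<in> carrier C"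
  by (simp add: corner_simps r_minus l_minus)

lemma corner_mult:
  assumes "x \<in> carrier C" "y \<in> carrier C" shows "x \<otimes> y \<in> carrier C"
  using assms m_assoc[of p x y, symmetric] m_assoc[of x y p] by (simp add: corner_simps)

lemma ring_corner: "ring C"
proof (rule ringI)
  show "abelian_group C"
  proof (rule abelian_groupI)
    fix x assume x: "x \<in> carrier C"
    then show "\<exists>y\<in>carrier C. y \<oplus>\<^bsub>C\<^esub> x = \<zero>\<^bsub>C\<^esub>"
      using corner_minus[OF x] by (intro bexI[of _ "\<ominus> x"]) (auto simp: corner_simps M.l_neg)
  qed (auto simp: corner_simps M.a_assoc r_distr l_distr intro: M.a_comm)
  show "monoid C"
    by (rule monoidI) (use corner_mult in \<open>auto simp: corner_simps m_assoc\<close>)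
qed (auto simp: corner_simps r_distr l_distr)

lemma corner_diff: assumes "x \<in> carrier C" "y \<in> carrier C" shows "x \<ominus>\<^bsub>C\<^esub> y = x \<ominus> y"
proof -
  interpret C: ring C by (rule ring_corner)
  have "\<ominus>\<^bsub>C\<^esub> y = \<ominus> y"
    using assms corner_minus[OF assms(2)] by (intro C.minus_equality) (auto simp: corner_simps M.l_neg)
  then show ?thesis by (simp add: a_minus_def corner_simps)
qed

lemma corner_finsum:
  assumes "\<And>i. i \<in> S \<Longrightarrow> g i \<in> carrier C"
  shows "(\<Oplus>\<^bsub>C\<^esub>i\<in>S. g i) = (\<Oplus>i\<in>S. g i)"
proof -
  interpret C: ring C by (rule ring_corner)
  show ?thesis using assms
  proof (induction S rule: infinite_finite_induct)
    case (insert i S)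
    then have "g \<in> S \<rightarrow> carrier C" "g \<in> S \<rightarrow> carrier A" "g i \<in> carrier A" by (auto simp: corner_simps)
    with insert show ?case by (simp add: C.finsum_insert M.finsum_insert) (simp add: corner_simps)
  qed (simp_all add: C.finsum_infinite M.finsum_infinite C.finsum_empty M.finsum_empty, simp_all add: corner_simps)
qed

lemma corner_cstar_axioms:
  "x \<in> carrier C \<Longrightarrow> y \<in> carrier C \<Longrightarrow> (c \<odot>\<^bsub>C\<^esub> x) \<otimes>\<^bsub>C\<^esub> y = c \<odot>\<^bsub>C\<^esub> (x \<otimes>\<^bsub>C\<^esub> y)"
  "x \<in> carrier C \<Longrightarrow> y \<in> carrier C \<Longrightarrow> x \<otimes>\<^bsub>C\<^esub> (c \<odot>\<^bsub>C\<^esub> y) = c \<odot>\<^bsub>C\<^esub> (x \<otimes>\<^bsub>C\<^esub> y)"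
  "x \<in> carrier C \<Longrightarrow> star C x \<in> carrier C"
  "x \<in> carrier C \<Longrightarrow> star C (star C x) = x"
  "x \<in> carrier C \<Longrightarrow> y \<in> carrier C \<Longrightarrow> star C (x \<oplus>\<^bsub>C\<^esub> y) = star C x \<oplus>\<^bsub>C\<^esub> star C y"
  "x \<in> carrier C \<Longrightarrow> star C (c \<odot>\<^bsub>C\<^esub> x) = cnj c \<odot>\<^bsub>C\<^esub> star C x"
  "x \<in> carrier C \<Longrightarrow> y \<in> carrier C \<Longrightarrow> star C (x \<otimes>\<^bsub>C\<^esub> y) = star C y \<otimes>\<^bsub>C\<^esub> star C x"
  "x \<in> carrier C \<Longrightarrow> 0 \<le> nrm C x"
  "x \<in> carrier C \<Longrightarrow> nrm C x = 0 \<longleftrightarrow> x = \<zero>\<^bsub>C\<^esub>"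
  "x \<in> carrier C \<Longrightarrow> y \<in> carrier C \<Longrightarrow> nrm C (x \<oplus>\<^bsub>C\<^esub> y) \<le> nrm C x + nrm C y"
  "x \<in> carrier C \<Longrightarrow> nrm C (c \<odot>\<^bsub>C\<^esub> x) = cmod c * nrm C x"
  "x \<in> carrier C \<Longrightarrow> y \<in> carrier C \<Longrightarrow> nrm C (x \<otimes>\<^bsub>C\<^esub> y) \<le> nrm C x * nrm C y"
  "x \<in> carrier C \<Longrightarrow> nrm C (star C x \<otimes>\<^bsub>C\<^esub> x) = (nrm C x)\<^sup>2"
  using smult_mult_left[of x y c] smult_mult_right[of x y c] corner_star[of x] star_star[of x]
    star_add[of x y] star_smult[of x c] star_mult[of x y] nrm_nonneg[of x] nrm_eq_zero[of x]
    nrm_triangle[of x y] nrm_smult[of x c] nrm_mult[of x y] cstar_identity[of x]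
  by (simp_all only: corner_simps)

lemma cstar_corner: "unital_cstar_algebra C"
proof -
  interpret C: ring C by (rule ring_corner)
  interpret Cm: Module.module complex_ring C
  proof (rule moduleI[OF cring_complex_ring C.is_abelian_group])
    fix a b x y assume x: "x \<in> carrier C"
    show "a \<odot>\<^bsub>C\<^esub> x \<in> carrier C"
      using x by (simp add: corner_simps smult_mult_left smult_mult_right)
    show "(a \<oplus>\<^bsub>complex_ring\<^esub> b) \<odot>\<^bsub>C\<^esub> x = a \<odot>\<^bsub>C\<^esub> x \<oplus>\<^bsub>C\<^esub> b \<odot>\<^bsub>C\<^esub> x"
      using x smult_add_left[of x a b] by (simp add: corner_simps)
    show "(a \<otimes>\<^bsub>complex_ring\<^esub> b) \<odot>\<^bsub>C\<^esub> x = a \<odot>\<^bsub>C\<^esub> (b \<odot>\<^bsub>C\<^esub> x)"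
      using x by (simp add: corner_simps smult_smult)
    show "\<one>\<^bsub>complex_ring\<^esub> \<odot>\<^bsub>C\<^esub> x = x"
      using x by (simp add: corner_simps smult_one')
    assume y: "y \<in> carrier C"
    show "a \<odot>\<^bsub>C\<^esub> (x \<oplus>\<^bsub>C\<^esub> y) = a \<odot>\<^bsub>C\<^esub> x \<oplus>\<^bsub>C\<^esub> a \<odot>\<^bsub>C\<^esub> y"
      using x y smult_r_distr[of a x y] by (simp add: corner_simps)
  qed
  show ?thesis
  proof
    show "\<one>\<^bsub>C\<^esub> \<noteq> \<zero>\<^bsub>C\<^esub>" using p by (simp add: corner_simps)
  next
    fix s :: "nat \<Rightarrow> 'x"
    assume s: "\<And>n. s n \<in> carrier C"
      and cau: "\<And>e. 0 < e \<Longrightarrow> \<exists>N. \<forall>m\<ge>N. \<forall>n\<ge>N. nrm C (s m \<ominus>\<^bsub>C\<^esub> s n) < e"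
    have sA: "s n \<in> carrier A" "p \<otimes> s n = s n" "s n \<otimes> p = s n" for n using s by (auto simp: corner_simps)
    obtain l where l: "l \<in> carrier A" "(\<lambda>n. nrm A (s n \<ominus> l)) \<longlonglongrightarrow> 0"
      using nrm_complete[of s] cau s sA by (auto simp: corner_diff corner_simps)
    \<comment> \<open>A point at least as close to every \<open>s n\<close> as the limit
      \<open>l\<close> equals \<open>l\<close>. It is applied to \<open>p l\<close> and
      \<open>l p\<close>, which qualify because multiplication by \<open>p\<close> fixes
      \<open>s n\<close> and does not increase norms; so \<open>l\<close> lies in the
      corner.\<close>
    have zero: "y = l"
      if y: "y \<in> carrier A" and b: "\<And>n. nrm A (s n \<ominus> y) \<le> nrm A (s n \<ominus> l)" for y
    proof -
      have "nrm A (y \<ominus> l) \<le> nrm A (s n \<ominus> l) + nrm A (s n \<ominus> l)" for n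
        using nrm_minus_triangle[of y "s n" l] nrm_minus_commute[of y "s n"] y l sA b[of n] by simp
      moreover have "(\<lambda>n. nrm A (s n \<ominus> l) + nrm A (s n \<ominus> l)) \<longlonglongrightarrow> 0 + 0"
        by (intro tendsto_add l(2))
      ultimately have "nrm A (y \<ominus> l) \<le> 0 + 0" by (intro LIMSEQ_le_const) blast+
      then have "y \<ominus> l = \<zero>" using nrm_nonneg[of "y \<ominus> l"] nrm_eq_zero[of "y \<ominus> l"] y l by simp
      moreover have "y = (y \<ominus> l) \<oplus> l" using y l(1) by algebra
      ultimately show ?thesis using l by simp
    qed
    have np: "nrm A p = 1" by (rule nrm_proj[OF p])
    have "s n \<ominus> p \<otimes> l = p \<otimes> (s n \<ominus> l)" "s n \<ominus> l \<otimes> p = (s n \<ominus> l) \<otimes> p" for n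
      using l sA[of n] by (simp_all add: a_minus_def r_distr l_distr r_minus l_minus)
    then have "nrm A (s n \<ominus> p \<otimes> l) \<le> nrm A (s n \<ominus> l)" "nrm A (s n \<ominus> l \<otimes> p) \<le> nrm A (s n \<ominus> l)" for n
      using nrm_mult[of p "s n \<ominus> l"] nrm_mult[of "s n \<ominus> l" p] l sA[of n] np by simp_all
    then have "p \<otimes> l = l" "l \<otimes> p = l" using zero l by simp_all
    then show "\<exists>l\<in>carrier C. (\<lambda>n. nrm C (s n \<ominus>\<^bsub>C\<^esub> l)) \<longlonglongrightarrow> 0"
      using l s by (intro bexI[of _ l]) (auto simp: corner_diff corner_simps)
  qed (rule corner_cstar_axioms; assumption)+
qed

end

lemma nrm_finsum_le:
  assumes "\<And>i. i \<in> S \<Longrightarrow> g i \<in> carrier A" "\<And>i. i \<in> S \<Longrightarrow> nrm A (g i) \<le> B"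
  shows "nrm A (\<Oplus>i\<in>S. g i) \<le> real (card S) * B"
  using assms
proof (induction S rule: infinite_finite_induct)
  case (insert i S)
  then have "nrm A (g i \<oplus> (\<Oplus>i\<in>S. g i)) \<le> nrm A (g i) + nrm A (\<Oplus>i\<in>S. g i)"
    by (intro nrm_triangle) auto
  also have "\<dots> \<le> B + real (card S) * B" using insert by (intro add_mono) auto
  finally show ?case using insert by (simp add: M.finsum_insert Pi_def algebra_simps)
qed (simp_all add: nrm_zero M.finsum_infinite)

text \<open>Together with \<open>nrm_finsum_le\<close> this bounds the norm of
  \<open>n u - 2 s\<close>, where \<open>s\<close> is the sum of \<open>g\<close>; that bound is the
  substitute for positivity of \<open>s\<close>.\<close>

lemma finsum_reflections:
  assumes "finite S" "\<And>i. i \<in> S \<Longrightarrow> g i \<in> carrier A" "u \<in> carrier A"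
  shows "(\<Oplus>i\<in>S. u \<ominus> 2 \<odot> g i) = of_nat (card S) \<odot> u \<ominus> 2 \<odot> (\<Oplus>i\<in>S. g i)"
  using assms
proof (induction S rule: finite_induct)
  case empty
  then show ?case using smult_l_null[of u] smult_r_null[of 2] by (simp add: a_minus_def)
next
  case (insert i S)
  have c: "(\<Oplus>i\<in>S. g i) \<in> carrier A" "g i \<in> carrier A" using insert by auto
  have "(\<Oplus>i\<in>insert i S. u \<ominus> 2 \<odot> g i) = (u \<ominus> 2 \<odot> g i) \<oplus> (of_nat (card S) \<odot> u \<ominus> 2 \<odot> (\<Oplus>i\<in>S. g i))"
    using insert by (subst M.finsum_insert) (auto simp: Pi_def)
  also have "\<dots> = (u \<oplus> of_nat (card S) \<odot> u) \<ominus> (2 \<odot> g i \<oplus> 2 \<odot> (\<Oplus>i\<in>S. g i))"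
  proof -
    have *: "(u \<ominus> x) \<oplus> (v \<ominus> y) = (u \<oplus> v) \<ominus> (x \<oplus> y)"
      if "v \<in> carrier A" "x \<in> carrier A" "y \<in> carrier A" for v x y using that insert.prems(2) by algebra
    show ?thesis by (rule *) (use c insert.prems in auto)
  qed
  also have "u \<oplus> of_nat (card S) \<odot> u = of_nat (card (insert i S)) \<odot> u"
    using insert smult_add_left[of u 1 "of_nat (card S)"] by (simp add: smult_one')
  also have "2 \<odot> g i \<oplus> 2 \<odot> (\<Oplus>i\<in>S. g i) = 2 \<odot> (\<Oplus>i\<in>insert i S. g i)"
    using insert c smult_r_distr[of 2 "g i" "\<Oplus>i\<in>S. g i"] by (simp add: M.finsum_insert Pi_def)
  finally show ?case .
qed

end

section \<open>Magic unitaries\<close>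

context unital_cstar_algebra begin

lemma finsum_neutral: "(\<And>i. i \<in> S \<Longrightarrow> f i = \<zero>) \<Longrightarrow> (\<Oplus>i\<in>S. f i) = \<zero>"
  by (rule M.add.finprod_one_eqI)

lemma finsum_single:
  assumes "finite S" "i \<in> S" "f i \<in> carrier A" "\<And>j. j \<in> S \<Longrightarrow> j \<noteq> i \<Longrightarrow> f j = \<zero>"
  shows "(\<Oplus>j\<in>S. f j) = f i"
proof -
  have "(\<Oplus>j\<in>insert i (S - {i}). f j) = f i \<oplus> (\<Oplus>j\<in>S - {i}. f j)"
  proof (rule M.finsum_insert)
    show "f \<in> S - {i} \<rightarrow> carrier A"
      by (rule Pi_I) (use assms(4) M.zero_closed in auto)
  qed (use assms in auto)
  then show ?thesis using assms finsum_neutral[of "S - {i}" f] by (simp add: insert_absorb)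
qed

lemma finsum_swap:
  assumes "finite S" "finite T" "\<And>i j. i \<in> S \<Longrightarrow> j \<in> T \<Longrightarrow> f i j \<in> carrier A"
  shows "(\<Oplus>i\<in>S. \<Oplus>j\<in>T. f i j) = (\<Oplus>j\<in>T. \<Oplus>i\<in>S. f i j)"
  using assms
proof (induction S rule: finite_induct)
  case empty
  then show ?case by (simp add: M.finsum_zero)
next
  case (insert i S)
  have "(\<Oplus>j\<in>T. \<Oplus>i\<in>insert i S. f i j) = (\<Oplus>j\<in>T. f i j \<oplus> (\<Oplus>i\<in>S. f i j))"
    using insert by (intro M.finsum_cong') (auto simp: M.finsum_insert Pi_def)
  also have "\<dots> = (\<Oplus>j\<in>T. f i j) \<oplus> (\<Oplus>j\<in>T. \<Oplus>i\<in>S. f i j)"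
    using insert.prems by (intro M.finsum_addf) auto
  finally show ?case using insert by (simp add: M.finsum_insert Pi_def)
qed

lemma finsum_smult_right:
  assumes "finite S" "\<And>i. i \<in> S \<Longrightarrow> f i \<in> carrier A"
  shows "c \<odot> (\<Oplus>i\<in>S. f i) = (\<Oplus>i\<in>S. c \<odot> f i)"
  using assms
proof (induction S rule: finite_induct)
  case empty
  then show ?case using smult_r_null[of c] by simp
next
  case (insert i S)
  then show ?case
    using smult_r_distr[of c "f i" "\<Oplus>i\<in>S. f i"] by (simp add: M.finsum_insert Pi_def)
qed

lemma finsum_smult_left:
  assumes "finite S" "w \<in> carrier A"
  shows "(\<Oplus>i\<in>S. of_nat (f i) \<odot> w) = of_nat (\<Sum>i\<in>S. f i) \<odot> w"
  using assms
proof (induction S rule: finite_induct)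
  case empty
  then show ?case using smult_l_null[of w] by simp
next
  case (insert i S)
  then show ?case
    using smult_add_left[of w "of_nat (f i)" "of_nat (\<Sum>i\<in>S. f i)"] by (simp add: M.finsum_insert Pi_def)
qed

lemma smult_of_nat_cancel:
  assumes "of_nat m \<odot> w = of_nat n \<odot> w" "w \<in> carrier A" "w \<noteq> \<zero>"
  shows "m = n"
proof -
  have "(of_nat m - of_nat n) \<odot> w \<oplus> of_nat n \<odot> w = of_nat m \<odot> w"
    using smult_add_left[of w "of_nat m - of_nat n" "of_nat n"] assms by simp
  also have "\<dots> = \<zero> \<oplus> of_nat n \<odot> w" using assms by simp
  finally have "(of_nat m - of_nat n) \<odot> w = \<zero>"
    using M.add.right_cancel[of "(of_nat m - of_nat n) \<odot> w" "of_nat n \<odot> w" \<zero>] assms by simp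
  then have "cmod (of_nat m - of_nat n) * nrm A w = 0"
    using nrm_smult[of w "of_nat m - of_nat n"] assms nrm_zero by simp
  then show ?thesis using assms nrm_eq_zero by simp
qed

text \<open>The compressions \<open>p P\<^sub>l p\<close> with \<open>p = P\<^sub>i\<close> and \<open>l \<noteq> i\<close> are positive and add up to zero.\<close>

lemma proj_orthogonal:
  assumes fin: "finite S" and P: "\<And>k. k \<in> S \<Longrightarrow> proj (P k)"
    and sum: "(\<Oplus>k\<in>S. P k) = \<one>" and ik: "i \<in> S" "k \<in> S" "i \<noteq> k"
  shows "P k \<otimes> P i = \<zero>"
proof (cases "P i = \<zero>")
  case True
  then show ?thesis using P[OF ik(2)] by (simp add: projD)
next
  case False
  let ?p = "P i"
  let ?C = "corner A ?p"
  have p: "proj ?p" "?p \<noteq> \<zero>" using P ik False by auto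
  interpret C: unital_cstar_algebra ?C by (rule cstar_corner[OF p])
  note cs = corner_simps[OF p]
  have PA: "l \<in> S \<Longrightarrow> P l \<in> carrier A" for l using P projD by blast
  have pA: "?p \<in> carrier A" "?p \<otimes> ?p = ?p" using p projD by auto
  define e where "e l = ?p \<otimes> P l \<otimes> ?p" for l
  have eA: "e l \<in> carrier A" if "l \<in> S" for l using PA that ik by (simp add: e_def)
  have pp: "?p \<otimes> (?p \<otimes> x) = ?p \<otimes> x" if "x \<in> carrier A" for x
    using that pA m_assoc[of ?p ?p x] by simp
  have eC: "e l \<in> carrier ?C" if "l \<in> S" for l
    using PA[OF that] pA(1) by (simp add: cs(1) e_def m_assoc pp pA(2))
  have "(\<Oplus>l\<in>S. e l) = ?p \<otimes> (\<Oplus>l\<in>S. P l) \<otimes> ?p"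
    unfolding e_def using PA fin ik
    by (subst finsum_rdistr) (auto simp: Pi_def finsum_ldistr)
  also have "\<dots> = ?p" by (simp add: sum pA)
  finally have total: "(\<Oplus>l\<in>S. e l) = ?p" .
  have "insert i (insert k (S - {i, k})) = S" using ik by blast
  then have "?p = (\<Oplus>l\<in>insert i (insert k (S - {i, k})). e l)" using total by simp
  also have "\<dots> = e i \<oplus> (e k \<oplus> (\<Oplus>l\<in>S - {i, k}. e l))"
    using fin ik eA by (simp add: M.finsum_insert Pi_def)
  also have "e i = ?p" by (simp add: e_def pA)
  finally have sum0: "?p = ?p \<oplus> (e k \<oplus> (\<Oplus>l\<in>S - {i, k}. e l))" .
  have rest: "(\<Oplus>l\<in>S - {i, k}. e l) \<in> carrier A" using eA by (intro M.finsum_closed) auto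
  have "e k \<oplus> (\<Oplus>l\<in>S - {i, k}. e l) = \<zero>"
    by (rule iffD1[OF M.add.l_cancel_one' sum0]) (use eA[OF ik(2)] rest pA in auto)
  then have neg: "e k = \<ominus> (\<Oplus>l\<in>S - {i, k}. e l)"
    using M.minus_equality[of "e k" "\<Oplus>l\<in>S - {i, k}. e l"] eA[OF ik(2)] rest by simp
  \<comment> \<open>\<open>p - 2 e_l\<close> is the compression of the reflection
    \<open>1 - 2 P_l\<close> by \<open>p\<close>; the bound stands in for positivity of
    \<open>e_l\<close>.\<close>
  have le: "nrm A (?p \<ominus> 2 \<odot> e l) \<le> 1" if "l \<in> S" for l
  proof -
    have "?p \<ominus> 2 \<odot> e l = ?p \<otimes> (\<one> \<ominus> 2 \<odot> P l) \<otimes> ?p"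
      using PA[OF that] pA
      by (simp add: e_def a_minus_def l_distr r_distr l_minus r_minus smult_mult_left smult_mult_right)
    moreover have "nrm A (\<one> \<ominus> 2 \<odot> P l) \<le> 1"
    proof -
      have "nrm A (\<one> \<ominus> 2 \<odot> P l) = 1"
        by (rule nrm_reflection[OF proj_one one_neq_zero P[OF that]]) (use PA[OF that] in auto)
      then show ?thesis by simp
    qed
    ultimately show ?thesis
      using PA[OF that] pA nrm_proj[OF p]
      by (simp only:) (intro nrm_mult_le_one, auto)
  qed
  have "e k = \<zero>"
  proof (cases "S - {i, k} = {}")
    case True
    \<comment> \<open>Here \<open>e k\<close> is minus an empty sum; the norm argument in the other
      case needs at least one further index.\<close>
    show ?thesis using neg unfolding True by simp
  next
    case False
    let ?T = "S - {i, k}"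
    have T: "finite ?T" "1 \<le> real (card ?T)" using fin False by (auto simp: card_gt_0_iff Suc_le_eq)
    have "(\<Oplus>l\<in>?T. ?p \<ominus> 2 \<odot> e l) = of_nat (card ?T) \<odot> ?p \<ominus> 2 \<odot> (\<Oplus>l\<in>?T. e l)"
      using T eA pA by (intro finsum_reflections) auto
    also have "\<dots> = of_nat (card ?T) \<odot> ?p \<oplus> 2 \<odot> e k"
      unfolding neg using eA by (simp add: a_minus_def smult_minus Pi_def)
    finally have eq: "(\<Oplus>l\<in>?T. ?p \<ominus> 2 \<odot> e l) = complex_of_real (real (card ?T)) \<odot> ?p \<oplus> 2 \<odot> e k"
      by simp
    have "nrm A (\<Oplus>l\<in>?T. ?p \<ominus> 2 \<odot> e l) \<le> real (card ?T) * 1"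
      using le eA pA by (intro nrm_finsum_le) auto
    then have "nrm A (complex_of_real (real (card ?T)) \<odot> ?p \<oplus> 2 \<odot> e k) \<le> real (card ?T)"
      by (simp only: eq mult_1_right)
    moreover have "?p \<ominus>\<^bsub>?C\<^esub> 2 \<odot> e k = ?p \<ominus> 2 \<odot> e k"
      using C.smult_closed'[OF eC[OF ik(2)], of 2] C.one_closed corner_diff[OF p] by (simp add: cs)
    ultimately show ?thesis
      using C.positive_and_negative_imp_zero[OF eC[OF ik(2)] _ T(2)] le[OF ik(2)] by (simp only: cs)
  qed
  \<comment> \<open>\<open>e k\<close> is \<open>star x\<close> times \<open>x\<close> for
    \<open>x = P_k p\<close>, so by the C*-identity its vanishing gives
    \<open>x = 0\<close>.\<close>
  then have "nrm A (star A (P k \<otimes> ?p) \<otimes> (P k \<otimes> ?p)) = 0"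
  proof -
    have "star A (P k \<otimes> ?p) \<otimes> (P k \<otimes> ?p) = ?p \<otimes> (P k \<otimes> P k) \<otimes> ?p"
      using PA ik pA P p by (simp add: star_mult projD(3) m_assoc)
    also have "\<dots> = e k" using P ik by (simp add: e_def projD(2))
    finally show ?thesis using \<open>e k = \<zero>\<close> nrm_zero by simp
  qed
  then show ?thesis using cstar_identity[of "P k \<otimes> ?p"] nrm_eq_zero[of "P k \<otimes> ?p"] PA ik by simp
qed

end

locale magic = unital_cstar_algebra A for A :: "'x cstar" (structure) +
  fixes I :: "'i set" and J :: "'j set" and U :: "'i \<Rightarrow> 'j \<Rightarrow> 'x"
  assumes magic: "magic_unitary A I J U"
begin

lemma fin: "finite I" "finite J"
  using magic unfolding magic_unitary_def by blast+

lemma U_closed [simp]: "i \<in> I \<Longrightarrow> j \<in> J \<Longrightarrow> U i j \<in> carrier A"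
  and U_idem: "i \<in> I \<Longrightarrow> j \<in> J \<Longrightarrow> U i j \<otimes> U i j = U i j"
  and U_star: "i \<in> I \<Longrightarrow> j \<in> J \<Longrightarrow> star A (U i j) = U i j"
  and U_proj: "i \<in> I \<Longrightarrow> j \<in> J \<Longrightarrow> proj (U i j)"
  using magic unfolding magic_unitary_def proj_def by blast+

lemma column_sum: "j \<in> J \<Longrightarrow> (\<Oplus>i\<in>I. U i j) = \<one>"
  and row_sum: "i \<in> I \<Longrightarrow> (\<Oplus>j\<in>J. U i j) = \<one>"
  using magic unfolding magic_unitary_def by blast+

lemma column_orthogonal: "i \<in> I \<Longrightarrow> i' \<in> I \<Longrightarrow> j \<in> J \<Longrightarrow> i \<noteq> i' \<Longrightarrow> U i j \<otimes> U i' j = \<zero>"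
  by (rule proj_orthogonal[of I "\<lambda>i. U i j" i' i]) (use fin U_proj column_sum in auto)

lemma row_orthogonal: "i \<in> I \<Longrightarrow> j \<in> J \<Longrightarrow> j' \<in> J \<Longrightarrow> j \<noteq> j' \<Longrightarrow> U i j \<otimes> U i j' = \<zero>"
  by (rule proj_orthogonal[of J "\<lambda>j. U i j" j' j]) (use fin U_proj row_sum in auto)

lemma magic_transpose: "magic A J I (\<lambda>j i. U i j)"
  by unfold_locales (use magic in \<open>unfold magic_unitary_def, blast\<close>)

lemma sum_column_between:
  assumes "j \<in> J" "x \<in> carrier A" "y \<in> carrier A"
  shows "(\<Oplus>i\<in>I. x \<otimes> U i j \<otimes> y) = x \<otimes> y"
proof -
  have "(\<Oplus>i\<in>I. x \<otimes> U i j \<otimes> y) = x \<otimes> (\<Oplus>i\<in>I. U i j) \<otimes> y"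
    using assms fin by (subst finsum_rdistr) (auto simp: Pi_def finsum_ldistr)
  then show ?thesis using assms by (simp add: column_sum)
qed

lemma sum_row_between:
  assumes "i \<in> I" "x \<in> carrier A" "y \<in> carrier A"
  shows "(\<Oplus>j\<in>J. x \<otimes> U i j \<otimes> y) = x \<otimes> y"
proof -
  interpret T: magic A J I "\<lambda>j i. U i j" by (rule magic_transpose)
  show ?thesis using T.sum_column_between[OF assms] .
qed

text \<open>Double counting with operator weights: the elements \<open>u U_cz v\<close> add up to
  \<open>u v\<close> along every row and every column, and \<open>f z = g c\<close> wherever the
  weight is nonzero. The weighted double sum, evaluated in both orders, yields two equal multiples
  of the nonzero element \<open>u v\<close>.\<close>

lemma sum_determined:
  fixes f :: "'j \<Rightarrow> nat" and g :: "'i \<Rightarrow> nat"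
  assumes uv: "u \<in> carrier A" "v \<in> carrier A" "u \<otimes> v \<noteq> \<zero>"
    and fg: "\<And>c z. c \<in> I \<Longrightarrow> z \<in> J \<Longrightarrow> u \<otimes> U c z \<noteq> \<zero> \<Longrightarrow> U c z \<otimes> v \<noteq> \<zero> \<Longrightarrow> f z = g c"
  shows "(\<Sum>z\<in>J. f z) = (\<Sum>c\<in>I. g c)"
proof -
  define t where "t c z = u \<otimes> U c z \<otimes> v" for c z
  have t: "t c z \<in> carrier A" if "c \<in> I" "z \<in> J" for c z using that uv by (simp add: t_def)
  have tz: "of_nat (f z) \<odot> t c z = of_nat (g c) \<odot> t c z" if "c \<in> I" "z \<in> J" for c z
  proof (cases "t c z = \<zero>")
    case True
    then show ?thesis using smult_r_null[of "of_nat (f z)"] smult_r_null[of "of_nat (g c)"] by simp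
  next
    case False
    then have "u \<otimes> U c z \<noteq> \<zero>" "U c z \<otimes> v \<noteq> \<zero>"
      using uv that m_assoc[of u "U c z" v] by (auto simp: t_def)
    then show ?thesis using fg that by simp
  qed
  have tJ: "(\<Oplus>c\<in>I. k \<odot> t c z) = k \<odot> (u \<otimes> v)" if "z \<in> J" for k z
    using finsum_smult_right[OF fin(1), of "\<lambda>c. t c z" k] t[OF _ that] sum_column_between[OF that uv(1,2)]
    unfolding t_def by metis
  have tI: "(\<Oplus>z\<in>J. k \<odot> t c z) = k \<odot> (u \<otimes> v)" if "c \<in> I" for k c
    using finsum_smult_right[OF fin(2), of "\<lambda>z. t c z" k] t[OF that] sum_row_between[OF that uv(1,2)]
    unfolding t_def by metis
  have uvA: "u \<otimes> v \<in> carrier A" using uv by simp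
  have "of_nat (\<Sum>z\<in>J. f z) \<odot> (u \<otimes> v) = (\<Oplus>z\<in>J. of_nat (f z) \<odot> (u \<otimes> v))"
    by (rule finsum_smult_left[OF fin(2) uvA, symmetric])
  also have "\<dots> = (\<Oplus>z\<in>J. \<Oplus>c\<in>I. of_nat (f z) \<odot> t c z)"
    by (rule M.finsum_cong'[OF refl _ tJ[symmetric]]) (auto simp: tJ uvA)
  also have "\<dots> = (\<Oplus>z\<in>J. \<Oplus>c\<in>I. of_nat (g c) \<odot> t c z)"
    using tz t by (intro M.finsum_cong') (auto simp: Pi_def)
  also have "\<dots> = (\<Oplus>c\<in>I. \<Oplus>z\<in>J. of_nat (g c) \<odot> t c z)"
    using fin t by (intro finsum_swap) auto
  also have "\<dots> = (\<Oplus>c\<in>I. of_nat (g c) \<odot> (u \<otimes> v))"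
    by (rule M.finsum_cong'[OF refl _ tI]) (auto simp: uvA)
  also have "\<dots> = of_nat (\<Sum>c\<in>I. g c) \<odot> (u \<otimes> v)"
    by (rule finsum_smult_left[OF fin(1) uvA])
  finally show ?thesis by (rule smult_of_nat_cancel[OF _ uvA uv(3)])
qed

end

section \<open>Invariance of adjacency, walk counts and biconnectedness\<close>

locale quantum_iso = magic A "verts H" "verts G" U
  for A :: "'x cstar" (structure) and G :: "('v, 'e) pre_digraph" and H :: "('w, 'f) pre_digraph" and U +
  assumes graph_G: "Digraph.graph G" and graph_H: "Digraph.graph H"
    and intertwine: "\<And>a x. a \<in> verts H \<Longrightarrow> x \<in> verts G \<Longrightarrow>
      matrix_prod A (verts G) U (adj_matrix A G) a x = matrix_prod A (verts H) (adj_matrix A H) U a x"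
begin

text \<open>The \<open>(a, y)\<close> entry of the intertwining relation is multiplied by
  \<open>U a x\<close> from the left and \<open>U b y\<close> from the right. Orthogonality in row
  \<open>a\<close> leaves only \<open>z = x\<close>, orthogonality in column \<open>y\<close> only
  \<open>c = b\<close>, so both adjacency coefficients multiply the same nonzero product.\<close>

lemma edge_iff:
  assumes "a \<in> verts H" "b \<in> verts H" "x \<in> verts G" "y \<in> verts G" "U a x \<otimes> U b y \<noteq> \<zero>"
  shows "x \<rightarrow>\<^bsub>G\<^esub> y \<longleftrightarrow> a \<rightarrow>\<^bsub>H\<^esub> b"
proof -
  have adjG: "adj_matrix A G z w \<in> carrier A" for z w by (simp add: adj_matrix_def)
  have adjH: "adj_matrix A H z w \<in> carrier A" for z w by (simp add: adj_matrix_def)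
  have "U a x \<otimes> matrix_prod A (verts G) U (adj_matrix A G) a y \<otimes> U b y =
      (\<Oplus>z\<in>verts G. U a x \<otimes> (U a z \<otimes> adj_matrix A G z y) \<otimes> U b y)"
    unfolding matrix_prod_def using assms fin adjG
    by (subst finsum_rdistr) (auto simp: Pi_def finsum_ldistr)
  also have "\<dots> = U a x \<otimes> (U a x \<otimes> adj_matrix A G x y) \<otimes> U b y"
  proof (rule finsum_single)
    fix z assume "z \<in> verts G" "z \<noteq> x"
    then show "U a x \<otimes> (U a z \<otimes> adj_matrix A G z y) \<otimes> U b y = \<zero>"
      using assms adjG row_orthogonal[of a x z] by (simp add: m_assoc[symmetric])
  qed (use assms fin adjG in auto)
  also have "\<dots> = (if x \<rightarrow>\<^bsub>G\<^esub> y then U a x \<otimes> U b y else \<zero>)"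
    using assms by (simp add: adj_matrix_def U_idem)
  finally have 1: "U a x \<otimes> matrix_prod A (verts G) U (adj_matrix A G) a y \<otimes> U b y = \<dots>" .
  have "U a x \<otimes> matrix_prod A (verts H) (adj_matrix A H) U a y \<otimes> U b y =
      (\<Oplus>c\<in>verts H. U a x \<otimes> (adj_matrix A H a c \<otimes> U c y) \<otimes> U b y)"
    unfolding matrix_prod_def using assms fin adjH
    by (subst finsum_rdistr) (auto simp: Pi_def finsum_ldistr)
  also have "\<dots> = U a x \<otimes> (adj_matrix A H a b \<otimes> U b y) \<otimes> U b y"
  proof (rule finsum_single)
    fix c assume "c \<in> verts H" "c \<noteq> b"
    then show "U a x \<otimes> (adj_matrix A H a c \<otimes> U c y) \<otimes> U b y = \<zero>"
      using assms adjH column_orthogonal[of c b y] by (simp add: m_assoc)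
  qed (use assms fin adjH in auto)
  also have "\<dots> = (if a \<rightarrow>\<^bsub>H\<^esub> b then U a x \<otimes> U b y else \<zero>)"
    using assms by (simp add: adj_matrix_def U_idem m_assoc)
  finally show ?thesis using 1 intertwine[of a y] assms by (auto split: if_splits)
qed

lemma eq_iff:
  assumes "a \<in> verts H" "b \<in> verts H" "x \<in> verts G" "y \<in> verts G" "U a x \<otimes> U b y \<noteq> \<zero>"
  shows "x = y \<longleftrightarrow> a = b"
  using assms row_orthogonal[of a x y] column_orthogonal[of a b x] by blast

text \<open>The first step is compared by \<open>edge_iff\<close> with the left factor, the rest of
  the walk by induction with the right factor; the two nonvanishing conditions in
  \<open>sum_determined\<close> match this split.\<close>

lemma walks_eq:
  assumes "a \<in> verts H" "b \<in> verts H" "x \<in> verts G" "y \<in> verts G" "U a x \<otimes> U b y \<noteq> \<zero>"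
  shows "walks (verts G) (arcs_ends G) n x y = walks (verts H) (arcs_ends H) n a b"
  using assms
proof (induction n arbitrary: a x)
  case 0
  then show ?case using eq_iff by simp
next
  case (Suc n)
  have "(\<Sum>z\<in>verts G. of_bool (x \<in> verts G \<and> (x, z) \<in> arcs_ends G) * walks (verts G) (arcs_ends G) n z y) =
      (\<Sum>c\<in>verts H. of_bool (a \<in> verts H \<and> (a, c) \<in> arcs_ends H) * walks (verts H) (arcs_ends H) n c b)"
    using Suc edge_iff by (intro sum_determined[of "U a x" "U b y"]) auto
  then show ?case by simp
qed

lemma biconnected_iff:
  assumes ab: "a \<in> verts H" "b \<in> verts H" "x \<in> verts G" "y \<in> verts G" "U a x \<otimes> U b y \<noteq> \<zero>"
  shows "biconnected (verts G) (arcs_ends G) x y \<longleftrightarrow> biconnected (verts H) (arcs_ends H) a b"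
proof -
  \<comment> \<open>Indicators of the vertices that separate \<open>x\<close> from \<open>y\<close>.
    Only sums of such indicators can be compared, but biconnectedness merely asks whether the sum is
    zero.\<close>
  let ?f = "\<lambda>z. of_bool (z \<notin> {x, y} \<and> (x, y) \<notin> rtrancl_on (verts G - {z}) (arcs_ends G)) :: nat"
  let ?g = "\<lambda>c. of_bool (c \<notin> {a, b} \<and> (a, b) \<notin> rtrancl_on (verts H - {c}) (arcs_ends H)) :: nat"
  have "(\<Sum>z\<in>verts G. ?f z) = (\<Sum>c\<in>verts H. ?g c)"
  proof (rule sum_determined[of "U a x" "U b y"])
    fix c z assume cz: "c \<in> verts H" "z \<in> verts G" "U a x \<otimes> U c z \<noteq> \<zero>" "U c z \<otimes> U b y \<noteq> \<zero>"
    \<comment> \<open>This yields equal numbers of closed walks at \<open>z\<close> and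
      \<open>c\<close>, which the first-passage argument requires.\<close>
    have "U c z \<otimes> U c z \<noteq> \<zero>" using cz ab by (auto simp: U_idem)
    then have "walks (verts G - {z}) (arcs_ends G) n x y = walks (verts H - {c}) (arcs_ends H) n a b" for n
      using cz ab fin by (intro walks_remove_determined walks_eq) auto
    then have "(x, y) \<in> rtrancl_on (verts G - {z}) (arcs_ends G) \<longleftrightarrow>
        (a, b) \<in> rtrancl_on (verts H - {c}) (arcs_ends H)"
      using walks_pos_iff[of "verts G - {z}" "arcs_ends G" x y] walks_pos_iff[of "verts H - {c}" "arcs_ends H" a b] fin
      by simp
    moreover have "z \<in> {x, y} \<longleftrightarrow> c \<in> {a, b}"
      using eq_iff[of a c x z] eq_iff[of c b z y] cz ab by auto
    ultimately show "?f z = ?g c" by simp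
  qed (use ab in auto)
  then have "(\<forall>z\<in>verts G. ?f z = 0) \<longleftrightarrow> (\<forall>c\<in>verts H. ?g c = 0)"
    by (simp only: sum_eq_0_iff[OF fin(1), symmetric] sum_eq_0_iff[OF fin(2), symmetric])
  then have "(\<forall>z\<in>verts G - {x, y}. (x, y) \<in> rtrancl_on (verts G - {z}) (arcs_ends G)) \<longleftrightarrow>
      (\<forall>c\<in>verts H - {a, b}. (a, b) \<in> rtrancl_on (verts H - {c}) (arcs_ends H))"
    by (simp only: of_bool_eq_0_iff) blast
  moreover have "(x, y) \<in> rtrancl_on (verts G) (arcs_ends G) \<longleftrightarrow> (a, b) \<in> rtrancl_on (verts H) (arcs_ends H)"
    using walks_eq[OF ab] walks_pos_iff[of "verts G" "arcs_ends G" x y] walks_pos_iff[of "verts H" "arcs_ends H" a b] fin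
    by simp
  ultimately show ?thesis using eq_iff[OF ab] by (simp add: biconnected_def)
qed

end

section \<open>Projections attached to pairs of blocks\<close>

context unital_cstar_algebra begin

lemma star_finsum:
  assumes "finite S" "\<And>i. i \<in> S \<Longrightarrow> f i \<in> carrier A"
  shows "star A (\<Oplus>i\<in>S. f i) = (\<Oplus>i\<in>S. star A (f i))"
  using assms
proof (induction S rule: finite_induct)
  case empty
  then show ?case by (simp add: star_zero)
next
  case (insert i S)
  then show ?case by (simp add: M.finsum_insert star_add star_closed Pi_def)
qed

text \<open>Projections have norm 0 or 1, so taking norms shows that both vanish or
  \<open>n = m\<close>; in the latter case the scalar is divided out.\<close>

lemma proj_smult_eq:
  assumes q: "proj q" and r: "proj r" and eq: "of_nat n \<odot> q = of_nat m \<odot> r" and nm: "n > 0" "m > 0"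
  shows "q = r" "q \<noteq> \<zero> \<Longrightarrow> n = m"
proof -
  have qr: "q \<in> carrier A" "r \<in> carrier A" using q r projD by auto
  have nrm: "real n * nrm A q = real m * nrm A r"
    using arg_cong[OF eq, of "nrm A"] qr by (simp add: nrm_smult)
  have nz: "nrm A p = (if p = \<zero> then 0 else 1)" if "proj p" for p
    using nrm_proj[OF that] nrm_zero by auto
  show nm': "n = m" if "q \<noteq> \<zero>" using nrm nz[OF q] nz[OF r] nm that by (auto split: if_splits)
  show "q = r"
  proof (cases "q = \<zero>")
    case True
    then show ?thesis using nrm nz[OF q] nz[OF r] nm by (auto split: if_splits)
  next
    case False
    have "q = (1 / of_nat n) \<odot> (of_nat n \<odot> q)" using qr nm by (simp add: smult_smult smult_one')
    also have "\<dots> = (1 / of_nat n) \<odot> (of_nat n \<odot> r)" using eq nm'[OF False] by simp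
    also have "\<dots> = r" using qr nm by (simp add: smult_smult smult_one')
    finally show ?thesis .
  qed
qed

end

text \<open>Collects the facts about biconnectedness on which the calculus of block projections
  rests. In this abstract form both graphs play the same role, and every result also applies to the
  transposed matrix.\<close>

locale square_closed =
  fixes rel :: "'a \<Rightarrow> 'a \<Rightarrow> bool"
  assumes rel_sym: "rel x y \<Longrightarrow> rel y x"
    and rel_irrefl: "\<not> rel x x"
    and rel_square: "rel a c \<Longrightarrow> rel c b \<Longrightarrow> rel a d \<Longrightarrow> rel d b \<Longrightarrow> a \<noteq> b \<Longrightarrow> c \<noteq> d \<Longrightarrow> rel a b"
begin

text \<open>The second clause is maximality: whatever is related to two distinct members is a
  member. Singletons satisfy both clauses vacuously, so two distinct members are requested
  separately where a genuine block matters.\<close>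

definition clique :: "'a set \<Rightarrow> bool" where
  "clique d \<longleftrightarrow> (\<forall>c\<in>d. \<forall>c'\<in>d. c \<noteq> c' \<longrightarrow> rel c c') \<and>
     (\<forall>c\<in>d. \<forall>c'\<in>d. \<forall>e. c \<noteq> c' \<longrightarrow> rel e c \<longrightarrow> rel e c' \<longrightarrow> e \<in> d)"

lemma clique_rel: "clique d \<Longrightarrow> c \<in> d \<Longrightarrow> c' \<in> d \<Longrightarrow> c \<noteq> c' \<Longrightarrow> rel c c'"
  unfolding clique_def by blast

lemma clique_closed: "clique d \<Longrightarrow> c \<in> d \<Longrightarrow> c' \<in> d \<Longrightarrow> c \<noteq> c' \<Longrightarrow> rel e c \<Longrightarrow> rel e c' \<Longrightarrow> e \<in> d"
  unfolding clique_def by blast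

text \<open>If \<open>e'\<close> differs from \<open>e\<close>, then \<open>c\<close>,
  \<open>e\<close>, \<open>f\<close>, \<open>e'\<close> is a four-cycle, so \<open>e\<close> and
  \<open>e'\<close> are related; thus \<open>e'\<close> is related to the two members
  \<open>c\<close> and \<open>e\<close> of \<open>d\<close>. The vertex \<open>f\<close> may lie
  outside \<open>d\<close>.\<close>

lemma common_neighbour_in_clique:
  assumes "clique d" "c \<in> d" "f \<noteq> c" "e \<in> d" "rel c e" "rel e f" "rel c e'" "rel e' f"
  shows "e' \<in> d"
proof (rule ccontr)
  assume "e' \<notin> d"
  then have "e \<noteq> e'" using assms(4) by blast
  then have "rel e e'" using rel_square[of e c e' f] assms rel_sym by blast
  moreover have "c \<noteq> e" using assms(5) rel_irrefl by blast
  ultimately have "e' \<in> d" using clique_closed[OF assms(1,2,4)] assms(7) rel_sym by blast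
  with \<open>e' \<notin> d\<close> show False ..
qed

end

locale magic_square = magic A I J U + P: square_closed P + Q: square_closed Q
  for A :: "'x cstar" (structure) and I :: "'i set" and J :: "'j set" and U
    and P :: "'j \<Rightarrow> 'j \<Rightarrow> bool" and Q :: "'i \<Rightarrow> 'i \<Rightarrow> bool" +
  assumes P_iff_Q: "a \<in> I \<Longrightarrow> b \<in> I \<Longrightarrow> x \<in> J \<Longrightarrow> y \<in> J \<Longrightarrow> U a x \<otimes> U b y \<noteq> \<zero> \<Longrightarrow> P x y \<longleftrightarrow> Q a b"
begin

lemma magic_square_transpose: "magic_square A J I (\<lambda>j i. U i j) Q P"
  by (intro magic_square.intro magic_transpose P.square_closed_axioms Q.square_closed_axioms
      magic_square_axioms.intro) (use P_iff_Q in blast)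

text \<open>The \<open>p_d(w)\<close> of the overview, to be read as the event that \<open>w\<close>
  is mapped into \<open>d\<close>.\<close>

definition hit :: "'i set \<Rightarrow> 'j \<Rightarrow> 'x" where
  "hit d w = (\<Oplus>e\<in>d. U e w)"

lemma finite_sub: "d \<subseteq> I \<Longrightarrow> finite d"
  using fin(1) finite_subset by blast

lemma hit_closed: "d \<subseteq> I \<Longrightarrow> w \<in> J \<Longrightarrow> hit d w \<in> carrier A"
  unfolding hit_def by (intro M.finsum_closed) auto

lemma mult_hit:
  assumes "d \<subseteq> I" "w \<in> J" "x \<in> carrier A"
  shows "x \<otimes> hit d w = (\<Oplus>e\<in>d. x \<otimes> U e w)"
  unfolding hit_def by (rule finsum_rdistr) (use assms finite_sub in auto)

lemma hit_mult:
  assumes "d \<subseteq> I" "w \<in> J" "x \<in> carrier A"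
  shows "hit d w \<otimes> x = (\<Oplus>e\<in>d. U e w \<otimes> x)"
  unfolding hit_def by (rule finsum_ldistr) (use assms finite_sub in auto)

lemma U_hit:
  assumes "d \<subseteq> I" "w \<in> J" "c \<in> I"
  shows "U c w \<otimes> hit d w = (if c \<in> d then U c w else \<zero>)"
proof (cases "c \<in> d")
  case True
  have "(\<Oplus>e\<in>d. U c w \<otimes> U e w) = U c w \<otimes> U c w"
    by (rule finsum_single) (use True assms finite_sub column_orthogonal in auto)
  then show ?thesis using True assms by (simp add: mult_hit U_idem)
next
  case False
  then show ?thesis using assms column_orthogonal by (auto simp: mult_hit intro!: finsum_neutral)
qed

lemma hit_star: "d \<subseteq> I \<Longrightarrow> w \<in> J \<Longrightarrow> star A (hit d w) = hit d w"
  unfolding hit_def by (subst star_finsum) (auto intro!: M.finsum_cong' finite_sub simp: U_star)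

lemma hit_U:
  assumes "d \<subseteq> I" "w \<in> J" "c \<in> I"
  shows "hit d w \<otimes> U c w = (if c \<in> d then U c w else \<zero>)"
proof -
  have "star A (U c w \<otimes> hit d w) = hit d w \<otimes> U c w"
    using assms by (simp add: star_mult hit_closed hit_star U_star)
  then show ?thesis using U_hit[OF assms] assms by (simp add: U_star star_zero split: if_splits)
qed

lemma hit_idem: assumes "d \<subseteq> I" "w \<in> J" shows "hit d w \<otimes> hit d w = hit d w"
proof -
  have "hit d w \<otimes> hit d w = (\<Oplus>e\<in>d. U e w \<otimes> hit d w)"
    by (rule hit_mult[OF assms hit_closed[OF assms]])
  also have "\<dots> = (\<Oplus>e\<in>d. U e w)"
    by (rule M.finsum_cong') (use assms U_hit[OF assms] in \<open>auto simp: subset_iff\<close>)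
  finally show ?thesis by (simp only: hit_def)
qed

lemma hit_proj: "d \<subseteq> I \<Longrightarrow> w \<in> J \<Longrightarrow> proj (hit d w)"
  unfolding proj_def using hit_closed hit_idem hit_star by blast

text \<open>The common neighbours of two distinct vertices, one of them in the block \<open>d\<close>, lie either all
  in \<open>d\<close> or all outside of \<open>d\<close>, so that a sum over \<open>d\<close> is either empty or a sum over all of \<open>I\<close>.\<close>

lemma U_hit_U:
  assumes d: "Q.clique d" "d \<subseteq> I" "c \<in> d" and f: "f \<in> I" "f \<noteq> c"
    and J: "z \<in> J" "w \<in> J" "v \<in> J" and P: "P z w" "P w v"
  shows "U c z \<otimes> hit d w \<otimes> U f v = (if \<exists>e\<in>d. Q c e \<and> Q e f then U c z \<otimes> U f v else \<zero>)"
proof -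
  let ?t = "\<lambda>e. U c z \<otimes> U e w \<otimes> U f v"
  have c: "c \<in> I" using d by auto
  have tA: "?t e \<in> carrier A" if "e \<in> I" for e using that J f c by simp
  \<comment> \<open>Both adjacent pairs of factors have a nonzero product, so \<open>P z w\<close>
    and \<open>P w v\<close> transfer to \<open>Q\<close>.\<close>
  have t0: "Q c e \<and> Q e f" if "e \<in> I" "?t e \<noteq> \<zero>" for e
  proof -
    have "U c z \<otimes> U e w \<noteq> \<zero>" using that J f by auto
    moreover have "U e w \<otimes> U f v \<noteq> \<zero>" using that J f c by (auto simp: m_assoc)
    ultimately show ?thesis using P P_iff_Q c f J that by blast
  qed
  have "U c z \<otimes> hit d w \<otimes> U f v = (\<Oplus>e\<in>d. U c z \<otimes> U e w) \<otimes> U f v"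
    using d c J by (subst mult_hit) auto
  also have "\<dots> = (\<Oplus>e\<in>d. ?t e)"
    by (rule finsum_ldistr) (use d c J f finite_sub in auto)
  finally have s: "U c z \<otimes> hit d w \<otimes> U f v = (\<Oplus>e\<in>d. ?t e)" .
  show ?thesis
  proof (cases "\<exists>e\<in>d. Q c e \<and> Q e f")
    case True
    then obtain e where e: "e \<in> d" "Q c e" "Q e f" by blast
    have "?t e' = \<zero>" if "e' \<in> I - d" for e'
      using that t0[of e'] Q.common_neighbour_in_clique[OF d(1,3) f(2) e, of e'] by blast
    then have "(\<Oplus>e\<in>d. ?t e) = (\<Oplus>e\<in>I. ?t e)"
      by (intro M.add.finprod_mono_neutral_cong_left) (use d fin tA in auto)
    also have "\<dots> = U c z \<otimes> U f v" using sum_column_between[of w "U c z" "U f v"] c f J by simp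
    finally show ?thesis using s True by simp
  next
    case False
    then have "(\<Oplus>e\<in>d. ?t e) = \<zero>" using t0 d by (intro finsum_neutral) blast
    then show ?thesis using s by (simp only: False if_False)
  qed
qed

text \<open>Column \<open>z\<close> is inserted on the right. For \<open>f\<close> other than
  \<open>c\<close>, \<open>U_hit_U\<close> with \<open>v = z\<close> gives zero or
  \<open>U c z\<close> times \<open>U f z\<close>, which is zero as well. Hence the product equals
  \<open>U c z\<close>, \<open>hit d w\<close>, \<open>U c z\<close> multiplied in this order, which
  is self-adjoint.\<close>

lemma U_hit_commute:
  assumes d: "Q.clique d" "d \<subseteq> I" "c \<in> d" and J: "z \<in> J" "w \<in> J" and P: "P z w"
  shows "U c z \<otimes> hit d w = hit d w \<otimes> U c z"
proof -
  let ?p = "hit d w"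
  have c: "c \<in> I" using d by auto
  have A: "U c z \<in> carrier A" "?p \<in> carrier A" using hit_closed d J c by auto
  have "U c z \<otimes> ?p = (\<Oplus>f\<in>I. U c z \<otimes> ?p \<otimes> U f z \<otimes> \<one>)"
    using sum_column_between[of z "U c z \<otimes> ?p" \<one>] A J by simp
  also have "\<dots> = U c z \<otimes> ?p \<otimes> U c z \<otimes> \<one>"
  proof (rule finsum_single)
    fix f assume f: "f \<in> I" "f \<noteq> c"
    then have "U c z \<otimes> ?p \<otimes> U f z = \<zero>"
      using U_hit_U[OF d f J(1,2,1) P P.rel_sym[OF P]] column_orthogonal[of c f z] c J by simp
    then show "U c z \<otimes> ?p \<otimes> U f z \<otimes> \<one> = \<zero>" by simp
  qed (use fin c A in auto)
  finally have eq: "U c z \<otimes> ?p = U c z \<otimes> ?p \<otimes> U c z" using A by simp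
  have "?p \<otimes> U c z = star A (U c z \<otimes> ?p)"
    using A c J d by (simp add: star_mult hit_star U_star)
  also have "\<dots> = star A (U c z \<otimes> ?p \<otimes> U c z)" by (rule arg_cong[OF eq])
  also have "\<dots> = U c z \<otimes> ?p \<otimes> U c z"
    using A c J d by (simp add: star_mult hit_star U_star m_assoc)
  finally show ?thesis using eq by simp
qed

lemma hit_commute:
  assumes d: "Q.clique d" "d \<subseteq> I" and J: "z \<in> J" "w \<in> J" and P: "P z w"
  shows "hit d z \<otimes> hit d w = hit d w \<otimes> hit d z"
proof -
  have "hit d z \<otimes> hit d w = (\<Oplus>c\<in>d. U c z \<otimes> hit d w)"
    using d J hit_closed by (intro hit_mult) auto
  also have "\<dots> = (\<Oplus>c\<in>d. hit d w \<otimes> U c z)"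
    by (rule M.finsum_cong') (use U_hit_commute[OF d _ J P] hit_closed[OF d(2)] d J in \<open>auto simp: subset_iff\<close>)
  also have "\<dots> = hit d w \<otimes> hit d z"
    using d J hit_closed by (intro mult_hit[symmetric]) auto
  finally show ?thesis .
qed

text \<open>Column \<open>v\<close> is inserted on the right; only rows in \<open>d\<close> may
  contribute. For \<open>f\<close> outside \<open>d\<close> with a common neighbour of
  \<open>c\<close> and \<open>f\<close> in \<open>d\<close>, a relation \<open>Q c f\<close> would
  put \<open>f\<close> into \<open>d\<close>; so it fails, whereas \<open>P z v\<close> holds, and
  \<open>U c z\<close> annihilates \<open>U f v\<close>.\<close>

lemma U_hit_hit:
  assumes d: "Q.clique d" "d \<subseteq> I" "c \<in> d" and J: "z \<in> J" "w \<in> J" "v \<in> J"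
    and P: "P z w" "P w v" "P z v"
  shows "U c z \<otimes> hit d w = U c z \<otimes> hit d w \<otimes> hit d v"
proof -
  let ?p = "hit d w"
  have c: "c \<in> I" using d by auto
  have A: "U c z \<otimes> ?p \<in> carrier A" using hit_closed d J c by auto
  have z: "U c z \<otimes> ?p \<otimes> U f v = \<zero>" if f: "f \<in> I - d" for f
  proof (cases "\<exists>e\<in>d. Q c e \<and> Q e f")
    case True
    then obtain e where e: "e \<in> d" "Q c e" "Q e f" by blast
    have "\<not> Q c f"
      using Q.clique_closed[OF d(1,3) e(1), of f] e f Q.rel_sym Q.rel_irrefl by blast
    then have "U c z \<otimes> U f v = \<zero>" using P_iff_Q[of c f z v] c f J P by blast
    moreover have "f \<noteq> c" using f d by blast
    ultimately show ?thesis using U_hit_U[OF d _ _ J P(1,2), of f] f by simp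
  next
    case False
    have "f \<in> I" "f \<noteq> c" using f d by auto
    then show ?thesis unfolding U_hit_U[OF d \<open>f \<in> I\<close> \<open>f \<noteq> c\<close> J P(1,2)] by (simp only: False if_False)
  qed
  have "U c z \<otimes> ?p = (\<Oplus>f\<in>I. U c z \<otimes> ?p \<otimes> U f v \<otimes> \<one>)"
    using sum_column_between[of v "U c z \<otimes> ?p" \<one>] A J by simp
  also have "\<dots> = (\<Oplus>f\<in>d. U c z \<otimes> ?p \<otimes> U f v)"
  proof (rule M.add.finprod_mono_neutral_cong_right)
    fix f assume "f \<in> I - d"
    then show "U c z \<otimes> ?p \<otimes> U f v \<otimes> \<one> = \<zero>" using z by simp
  next
    fix f assume "f \<in> d"
    then show "U c z \<otimes> ?p \<otimes> U f v \<otimes> \<one> = U c z \<otimes> ?p \<otimes> U f v" using A d J by (simp add: subsetD)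
  qed (use fin d A J in auto)
  also have "\<dots> = U c z \<otimes> ?p \<otimes> hit d v" using mult_hit[OF d(2) J(3) A] by simp
  finally show ?thesis .
qed

text \<open>By \<open>U_hit_hit\<close> both sides equal \<open>U c z\<close> times both hits, which
  commute.\<close>

lemma U_hit_eq:
  assumes d: "Q.clique d" "d \<subseteq> I" "c \<in> d" and J: "z \<in> J" "w \<in> J" "v \<in> J"
    and P: "P z w" "P w v" "P z v"
  shows "U c z \<otimes> hit d w = U c z \<otimes> hit d v"
proof -
  have A: "U c z \<in> carrier A" "hit d w \<in> carrier A" "hit d v \<in> carrier A"
    using hit_closed d J by auto
  have "U c z \<otimes> hit d w = U c z \<otimes> (hit d w \<otimes> hit d v)"
    using U_hit_hit[OF assms] A by (simp add: m_assoc)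
  also have "\<dots> = U c z \<otimes> (hit d v \<otimes> hit d w)" by (simp only: hit_commute[OF d(1,2) J(2,3) P(2)])
  also have "\<dots> = U c z \<otimes> hit d v"
    using U_hit_hit[OF d J(1,3,2) P(3) P.rel_sym[OF P(2)] P(1)] A by (simp add: m_assoc)
  finally show ?thesis .
qed

lemma hit_hit_eq:
  assumes d: "Q.clique d" "d \<subseteq> I" and b: "P.clique b" "b \<subseteq> J"
    and z: "z \<in> b" "w \<in> b" "v \<in> b" "z \<noteq> w" "z \<noteq> v"
  shows "hit d z \<otimes> hit d w = hit d z \<otimes> hit d v"
proof (cases "w = v")
  case False
  have J: "z \<in> J" "w \<in> J" "v \<in> J" using b z by auto
  have P: "P z w" "P w v" "P z v" using P.clique_rel[OF b(1)] z False by auto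
  have "hit d z \<otimes> hit d w = (\<Oplus>c\<in>d. U c z \<otimes> hit d w)"
    using d J hit_closed by (intro hit_mult) auto
  also have "\<dots> = (\<Oplus>c\<in>d. U c z \<otimes> hit d v)"
    by (rule M.finsum_cong') (use U_hit_eq[OF d _ J P] hit_closed[OF d(2)] d J in \<open>auto simp: subset_iff\<close>)
  also have "\<dots> = hit d z \<otimes> hit d v"
    using d J hit_closed by (intro hit_mult[symmetric]) auto
  finally show ?thesis .
qed simp

text \<open>\<open>hit d z \<otimes> hit d w\<close> is the projection onto the event that \<open>b\<close> is mapped to \<open>d\<close>.\<close>

lemma hit_hit_const:
  assumes d: "Q.clique d" "d \<subseteq> I" and b: "P.clique b" "b \<subseteq> J"
    and z: "z \<in> b" "w \<in> b" "z \<noteq> w" and z': "z' \<in> b" "w' \<in> b" "z' \<noteq> w'"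
  shows "hit d z \<otimes> hit d w = hit d z' \<otimes> hit d w'"
proof -
  note eq = hit_hit_eq[OF assms(1-4)]
  have comm: "hit d u \<otimes> hit d v = hit d v \<otimes> hit d u" if "u \<in> b" "v \<in> b" "u \<noteq> v" for u v
    using hit_commute[OF d] P.clique_rel[OF b(1) that] that b by blast
  show ?thesis
  proof (cases "z' = z")
    case True
    then show ?thesis using eq[of z w w'] z z' by simp
  next
    case False
    then have "hit d z \<otimes> hit d w = hit d z \<otimes> hit d z'" using eq[of z w z'] z z' by simp
    also have "\<dots> = hit d z' \<otimes> hit d z" using comm z z' False by blast
    also have "\<dots> = hit d z' \<otimes> hit d w'" using eq[of z' z w'] z z' False by simp
    finally show ?thesis .
  qed
qed

lemma hit_hit_proj:
  assumes "Q.clique d" "d \<subseteq> I" "P.clique b" "b \<subseteq> J" "z \<in> b" "w \<in> b" "z \<noteq> w"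
  shows "proj (hit d z \<otimes> hit d w)"
proof (rule proj_mult_commute)
  show "hit d z \<otimes> hit d w = hit d w \<otimes> hit d z"
    using hit_commute[OF assms(1,2)] P.clique_rel[OF assms(3,5,6,7)] assms by blast
qed (use assms hit_proj in auto)

text \<open>Next to \<open>U c z\<close> with \<open>c\<close> in \<open>d\<close> the factor
  \<open>hit d z\<close> acts as a unit from either side; what remains is \<open>hit d w\<close>,
  which commutes with \<open>U c z\<close>.\<close>

lemma U_commute_hit_hit:
  assumes d: "Q.clique d" "d \<subseteq> I" "c \<in> d" and b: "P.clique b" "b \<subseteq> J"
    and z: "z \<in> b" "w \<in> b" "z \<noteq> w"
  shows "U c z \<otimes> (hit d z \<otimes> hit d w) = U c z \<otimes> hit d w"
    and "U c z \<otimes> (hit d z \<otimes> hit d w) = (hit d z \<otimes> hit d w) \<otimes> U c z"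
proof -
  have J: "c \<in> I" "z \<in> J" "w \<in> J" using d b z by auto
  have P: "P z w" using P.clique_rel[OF b(1) z] .
  have A: "U c z \<in> carrier A" "hit d w \<in> carrier A" "hit d z \<in> carrier A" using hit_closed d J by auto
  show 1: "U c z \<otimes> (hit d z \<otimes> hit d w) = U c z \<otimes> hit d w"
    using A U_hit[OF d(2) J(2,1)] d(3) m_assoc[of "U c z" "hit d z" "hit d w"] by simp
  have "(hit d z \<otimes> hit d w) \<otimes> U c z = hit d z \<otimes> (U c z \<otimes> hit d w)"
    using A U_hit_commute[OF d J(2,3) P] by (simp add: m_assoc)
  also have "\<dots> = U c z \<otimes> hit d w"
    using A hit_U[OF d(2) J(2,1)] d(3) m_assoc[of "hit d z" "U c z" "hit d w"] by simp
  finally show "U c z \<otimes> (hit d z \<otimes> hit d w) = (hit d z \<otimes> hit d w) \<otimes> U c z" using 1 by simp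
qed

text \<open>\<open>T\<close> is symmetric in \<open>b\<close> and \<open>d\<close>, so comparing this formula with its transpose relates the
  column projections to the row projections.\<close>

lemma total_square:
  assumes d: "Q.clique d" "d \<subseteq> I" and b: "P.clique b" "b \<subseteq> J" and xy: "x \<in> b" "y \<in> b" "x \<noteq> y"
  defines "T \<equiv> (\<Oplus>z\<in>b. hit d z)"
  shows "T \<otimes> T = T \<oplus> of_nat (card b * (card b - 1)) \<odot> (hit d x \<otimes> hit d y)"
proof -
  let ?q = "hit d x \<otimes> hit d y"
  have fb: "finite b" using b fin finite_subset by blast
  have h: "hit d z \<in> carrier A" if "z \<in> b" for z using that hit_closed d b by auto
  have q: "?q \<in> carrier A" using h xy by simp
  have T: "T \<in> carrier A" unfolding T_def using h by (intro M.finsum_closed) auto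
  have row: "hit d z \<otimes> T = hit d z \<oplus> of_nat (card b - 1) \<odot> ?q" if z: "z \<in> b" for z
  proof -
    have "hit d z \<otimes> T = (\<Oplus>w\<in>b. hit d z \<otimes> hit d w)"
      unfolding T_def by (rule finsum_rdistr) (use fb h z in auto)
    also have "\<dots> = (\<Oplus>w\<in>insert z (b - {z}). hit d z \<otimes> hit d w)" using z by (simp add: insert_absorb)
    also have "\<dots> = hit d z \<otimes> hit d z \<oplus> (\<Oplus>w\<in>b - {z}. hit d z \<otimes> hit d w)"
      by (rule M.finsum_insert) (use fb h z in auto)
    also have "(\<Oplus>w\<in>b - {z}. hit d z \<otimes> hit d w) = (\<Oplus>w\<in>b - {z}. of_nat 1 \<odot> ?q)"
      using hit_hit_const[OF d b _ _ _ xy] z q by (intro M.finsum_cong') (auto simp: smult_one')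
    also have "\<dots> = of_nat (card b - 1) \<odot> ?q"
      using finsum_smult_left[of "b - {z}" ?q "\<lambda>_. 1"] fb q z by simp
    finally show ?thesis using hit_idem z d b by auto
  qed
  have "T \<otimes> T = (\<Oplus>z\<in>b. hit d z \<otimes> T)"
    using finsum_ldistr[OF fb T, of "hit d"] h by (auto simp: T_def)
  also have "\<dots> = (\<Oplus>z\<in>b. hit d z \<oplus> of_nat (card b - 1) \<odot> ?q)"
    by (rule M.finsum_cong') (use row h q in auto)
  also have "\<dots> = T \<oplus> (\<Oplus>z\<in>b. of_nat (card b - 1) \<odot> ?q)"
    unfolding T_def by (rule M.finsum_addf) (use h q in auto)
  also have "(\<Oplus>z\<in>b. of_nat (card b - 1) \<odot> ?q) = of_nat (card b * (card b - 1)) \<odot> ?q"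
    using finsum_smult_left[of b ?q "\<lambda>_. card b - 1"] fb q by simp
  finally show ?thesis .
qed

end

section \<open>Matchings in the support of a magic unitary\<close>

text \<open>A tight proper subset is matched on its own and its targets are withdrawn from the rest.
  If there is none, every nonempty proper subset has a spare target, so any \<open>i\<close> can be
  matched with any admissible \<open>y\<close> and both removed.\<close>

lemma hall_marriage:
  fixes N :: "'a \<Rightarrow> 'b set"
  assumes "finite K" "\<And>i. i \<in> K \<Longrightarrow> finite (N i)" "\<And>S. S \<subseteq> K \<Longrightarrow> card S \<le> card (\<Union>i\<in>S. N i)"
  shows "\<exists>\<pi>. inj_on \<pi> K \<and> (\<forall>i\<in>K. \<pi> i \<in> N i)"
  using assms
proof (induction "card K" arbitrary: K N rule: less_induct)
  case less
  note fin = less.prems(1,2) and hall = less.prems(3)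
  have finN: "finite (\<Union>i\<in>S. N i)" if "S \<subseteq> K" for S
    using that fin by (intro finite_UN_I) (auto dest: finite_subset)
  show ?case
  proof (cases "\<exists>S. S \<subset> K \<and> S \<noteq> {} \<and> card (\<Union>i\<in>S. N i) = card S")
    case True
    then obtain S where S: "S \<subset> K" "S \<noteq> {}" "card (\<Union>i\<in>S. N i) = card S" by blast
    let ?M = "\<Union>i\<in>S. N i"
    have fS: "finite S" using S(1) fin(1) finite_subset by blast
    have "card S < card K" using S(1) fin(1) by (simp add: psubset_card_mono)
    then obtain \<pi> where p: "inj_on \<pi> S" "\<forall>i\<in>S. \<pi> i \<in> N i"
      using less.hyps[of S N] S(1) fin hall fS by (metis psubsetE subset_iff subset_trans)
    have "card (K - S) < card K"
      using S(1,2) fin(1) by (intro psubset_card_mono) auto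
    moreover have "card T \<le> card (\<Union>i\<in>T. N i - ?M)" if T: "T \<subseteq> K - S" for T
    proof -
      have TS: "T \<union> S \<subseteq> K" using T S by auto
      have "card (T \<union> S) = card T + card S"
        using T fin(1) fS by (intro card_Un_disjoint) (auto dest: finite_subset)
      moreover have "card (\<Union>i\<in>T \<union> S. N i) = card (\<Union>i\<in>T. N i - ?M) + card ?M"
      proof -
        have "(\<Union>i\<in>T \<union> S. N i) = (\<Union>i\<in>T. N i - ?M) \<union> ?M" by blast
        moreover have "finite (\<Union>i\<in>T. N i - ?M)" using finN[of T] T by (auto intro: finite_subset)
        moreover have "(\<Union>i\<in>T. N i - ?M) \<inter> ?M = {}" by blast
        ultimately show ?thesis
          using finN[of S] S(1) card_Un_disjoint[of "\<Union>i\<in>T. N i - ?M" ?M] by simp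
      qed
      ultimately show ?thesis using hall[OF TS] S(3) by linarith
    qed
    moreover have "finite (K - S)" "\<And>i. i \<in> K - S \<Longrightarrow> finite (N i - ?M)" using fin by auto
    ultimately obtain \<rho> where r: "inj_on \<rho> (K - S)" "\<forall>i\<in>K - S. \<rho> i \<in> N i - ?M"
      using less.hyps[of "K - S" "\<lambda>i. N i - ?M"] by blast
    let ?f = "\<lambda>i. if i \<in> S then \<pi> i else \<rho> i"
    have "inj_on ?f K"
    proof (rule inj_onI)
      fix i j assume ij: "i \<in> K" "j \<in> K" "?f i = ?f j"
      consider "i \<in> S" "j \<in> S" | "i \<notin> S" "j \<notin> S" | "i \<in> S" "j \<notin> S" | "i \<notin> S" "j \<in> S" by blast
      then show "i = j"
      proof cases
        case 1
        then show ?thesis using ij inj_onD[OF p(1), of i j] by simp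
      next
        case 2
        then show ?thesis using ij inj_onD[OF r(1), of i j] by simp
      next
        case 3
        have "\<pi> i \<in> ?M" using 3 p(2) by blast
        moreover have "\<rho> j \<notin> ?M" using ij(2) 3 r(2) by blast
        ultimately show ?thesis using ij(3) 3 by simp
      next
        case 4
        have "\<pi> j \<in> ?M" using 4 p(2) by blast
        moreover have "\<rho> i \<notin> ?M" using ij(1) 4 r(2) by blast
        ultimately show ?thesis using ij(3) 4 by simp
      qed
    qed
    then show ?thesis using p(2) r(2) by (intro exI[of _ ?f]) auto
  next
    case False
    then have strict: "card T \<noteq> card (\<Union>i\<in>T. N i)" if "T \<subset> K" "T \<noteq> {}" for T
      using that by metis
    show ?thesis
    proof (cases "K = {}")
      case False
      then obtain i where i: "i \<in> K" by blast
      have "N i \<noteq> {}" using hall[of "{i}"] i by auto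
      then obtain y where y: "y \<in> N i" by blast
      have "card (K - {i}) < card K" using i fin(1) by (intro psubset_card_mono) auto
      moreover have "card T \<le> card (\<Union>j\<in>T. N j - {y})" if T: "T \<subseteq> K - {i}" for T
      proof (cases "T = {}")
        case False
        have "T \<subset> K" using T i by auto
        then have "card T < card (\<Union>j\<in>T. N j)"
          using strict[OF _ False] hall[of T] by (simp add: psubset_imp_subset order_less_le)
        moreover have "card (\<Union>j\<in>T. N j) - 1 \<le> card ((\<Union>j\<in>T. N j) - {y})"
          by (simp add: card_Diff_singleton_if)
        moreover have eq: "(\<Union>j\<in>T. N j - {y}) = (\<Union>j\<in>T. N j) - {y}" by blast
        ultimately show ?thesis unfolding eq by linarith
      qed simp
      moreover have "finite (K - {i})" "\<And>j. j \<in> K - {i} \<Longrightarrow> finite (N j - {y})" using fin by auto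
      ultimately obtain \<rho> where r: "inj_on \<rho> (K - {i})" "\<forall>j\<in>K - {i}. \<rho> j \<in> N j - {y}"
        using less.hyps[of "K - {i}" "\<lambda>j. N j - {y}"] by blast
      have "inj_on (\<rho>(i := y)) K"
      proof (rule inj_onI)
        fix j k assume jk: "j \<in> K" "k \<in> K" "(\<rho>(i := y)) j = (\<rho>(i := y)) k"
        have "\<rho> h \<noteq> y" if "h \<in> K" "h \<noteq> i" for h using r(2) that by blast
        then show "j = k"
          using jk inj_onD[OF r(1), of j k] by (cases "j = i"; cases "k = i") auto
      qed
      then show ?thesis using r(2) y by (intro exI[of _ "\<rho>(i := y)"]) auto
    qed simp
  qed
qed

context unital_cstar_algebra begin

text \<open>With \<open>m\<close>, \<open>n\<close> the cardinalities of \<open>T\<close>,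
  \<open>S\<close>, the sum of all reflections \<open>u - 2 w i j\<close> has norm at most
  \<open>m n\<close>. It equals \<open>(m n - 2 c) u\<close>, of norm \<open>|m n - 2 c|\<close>, so
  \<open>c\<close> is not negative.\<close>

lemma sum_proj_nonneg:
  assumes u: "proj u" "u \<noteq> \<zero>" and fin: "finite S" "finite T"
    and w: "\<And>i j. i \<in> S \<Longrightarrow> j \<in> T \<Longrightarrow> proj (w i j) \<and> u \<otimes> w i j = w i j \<and> w i j \<otimes> u = w i j"
    and sum: "(\<Oplus>j\<in>T. \<Oplus>i\<in>S. w i j) = complex_of_real c \<odot> u"
  shows "0 \<le> c"
proof -
  have uA: "u \<in> carrier A" using u projD by blast
  have wA: "w i j \<in> carrier A" if "i \<in> S" "j \<in> T" for i j using w that projD by blast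
  let ?n = "real (card S)" and ?m = "real (card T)"
  define g where "g j = (\<Oplus>i\<in>S. u \<ominus> 2 \<odot> w i j)" for j
  have g: "g j = complex_of_real ?n \<odot> u \<ominus> 2 \<odot> (\<Oplus>i\<in>S. w i j)" if "j \<in> T" for j
    using finsum_reflections[OF fin(1), of "\<lambda>i. w i j" u] wA[OF _ that] uA by (simp add: g_def)
  have gA: "g j \<in> carrier A" if "j \<in> T" for j
    unfolding g_def using wA[OF _ that] uA by (intro M.finsum_closed) auto
  have "nrm A (g j) \<le> ?n * 1" if "j \<in> T" for j
    unfolding g_def using wA[OF _ that] uA nrm_reflection[OF u] w[OF _ that]
    by (intro nrm_finsum_le) (auto intro: order_eq_refl)
  then have le: "nrm A (\<Oplus>j\<in>T. g j) \<le> ?m * ?n" using gA by (intro nrm_finsum_le) auto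
  have "(\<Oplus>j\<in>T. g j) = (\<Oplus>j\<in>T. complex_of_real ?n \<odot> u \<ominus> 2 \<odot> (\<Oplus>i\<in>S. w i j))"
    by (rule M.finsum_cong') (use g gA in auto)
  also have "\<dots> = of_nat (card T) \<odot> (complex_of_real ?n \<odot> u) \<ominus> 2 \<odot> (\<Oplus>j\<in>T. \<Oplus>i\<in>S. w i j)"
    using fin wA uA by (intro finsum_reflections) (auto intro!: M.finsum_closed)
  also have "\<dots> = complex_of_real (?m * ?n) \<odot> u \<ominus> complex_of_real (2 * c) \<odot> u"
    unfolding sum using uA by (simp add: smult_smult)
  also have "\<dots> = complex_of_real (?m * ?n - 2 * c) \<odot> u"
  proof -
    have "complex_of_real (?m * ?n) \<odot> u =
        complex_of_real (?m * ?n - 2 * c) \<odot> u \<oplus> complex_of_real (2 * c) \<odot> u"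
      using smult_add_left[OF uA, of "complex_of_real (?m * ?n - 2 * c)" "complex_of_real (2 * c)"] by simp
    moreover have "x \<oplus> y \<ominus> y = x" if "x \<in> carrier A" "y \<in> carrier A" for x y using that by algebra
    ultimately show ?thesis using uA by (simp only: smult_closed')
  qed
  finally have "nrm A (\<Oplus>j\<in>T. g j) = \<bar>?m * ?n - 2 * c\<bar>"
    using nrm_smult[OF uA, of "complex_of_real (?m * ?n - 2 * c)"] nrm_proj[OF u]
    by (simp only: norm_of_real mult_1_right)
  with le show ?thesis by linarith
qed

text \<open>Hall's condition by counting in multiples of \<open>u\<close>: rows \<open>S\<close>
  with support \<open>T\<close> put \<open>card S\<close> times \<open>u\<close> into the columns
  \<open>T\<close>, whose total is \<open>card T\<close> times \<open>u\<close>. The remaining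
  entries of these columns are projections adding up to the difference, so
  \<open>sum_proj_nonneg\<close> applies.\<close>

lemma magic_matching_inj:
  assumes u: "proj u" "u \<noteq> \<zero>" and fin: "finite K" "finite L"
    and w: "\<And>i j. i \<in> K \<Longrightarrow> j \<in> L \<Longrightarrow> proj (w i j) \<and> u \<otimes> w i j = w i j \<and> w i j \<otimes> u = w i j"
    and rows: "\<And>i. i \<in> K \<Longrightarrow> (\<Oplus>j\<in>L. w i j) = u"
    and cols: "\<And>j. j \<in> L \<Longrightarrow> (\<Oplus>i\<in>K. w i j) = u"
  shows "\<exists>\<pi>. inj_on \<pi> K \<and> (\<forall>i\<in>K. \<pi> i \<in> L \<and> w i (\<pi> i) \<noteq> \<zero>)"
proof -
  have uA: "u \<in> carrier A" using u projD by blast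
  have wA: "w i j \<in> carrier A" if "i \<in> K" "j \<in> L" for i j using w that projD by blast
  define N where "N i = {j \<in> L. w i j \<noteq> \<zero>}" for i
  have "card S \<le> card (\<Union>i\<in>S. N i)" if S: "S \<subseteq> K" for S
  proof -
    define T where "T = (\<Union>i\<in>S. N i)"
    have T: "T \<subseteq> L" by (auto simp: T_def N_def)
    have fS: "finite S" "finite T" "finite (K - S)" using S T fin finite_subset by blast+
    have part: "(\<Oplus>j\<in>T. \<Oplus>i\<in>S. w i j) = of_nat (card S) \<odot> u"
    proof -
      have "(\<Oplus>j\<in>T. \<Oplus>i\<in>S. w i j) = (\<Oplus>i\<in>S. \<Oplus>j\<in>T. w i j)"
        by (rule finsum_swap) (use fS S T wA in \<open>auto simp: subset_iff\<close>)
      also have "\<dots> = (\<Oplus>i\<in>S. of_nat 1 \<odot> u)"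
      proof (rule M.finsum_cong')
        fix i assume i: "i \<in> S"
        have "(\<Oplus>j\<in>T. w i j) = (\<Oplus>j\<in>L. w i j)"
          by (rule M.add.finprod_mono_neutral_cong_left) (use fin T S i wA in \<open>auto simp: T_def N_def subset_iff\<close>)
        then show "(\<Oplus>j\<in>T. w i j) = of_nat 1 \<odot> u" using rows i S uA by (simp add: smult_one' subset_iff)
      qed (use uA in auto)
      also have "\<dots> = of_nat (card S) \<odot> u" using finsum_smult_left[OF fS(1) uA, of "\<lambda>_. 1"] by simp
      finally show ?thesis .
    qed
    have rA: "(\<Oplus>j\<in>T. \<Oplus>i\<in>K - S. w i j) \<in> carrier A" "(\<Oplus>j\<in>T. \<Oplus>i\<in>S. w i j) \<in> carrier A"
      using T S wA by (auto intro!: M.finsum_closed simp: subset_iff)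
    have "of_nat (card T) \<odot> u = (\<Oplus>j\<in>T. of_nat 1 \<odot> u)"
      using finsum_smult_left[OF fS(2) uA, of "\<lambda>_. 1"] by simp
    also have "\<dots> = (\<Oplus>j\<in>T. (\<Oplus>i\<in>S. w i j) \<oplus> (\<Oplus>i\<in>K - S. w i j))"
    proof (rule M.finsum_cong')
      fix j assume j: "j \<in> T"
      have "(\<Oplus>i\<in>S \<union> (K - S). w i j) = (\<Oplus>i\<in>S. w i j) \<oplus> (\<Oplus>i\<in>K - S. w i j)"
        by (rule M.finsum_Un_disjoint) (use fS S T j wA in \<open>auto simp: subset_iff\<close>)
      moreover have "S \<union> (K - S) = K" using S by blast
      ultimately show "of_nat 1 \<odot> u = (\<Oplus>i\<in>S. w i j) \<oplus> (\<Oplus>i\<in>K - S. w i j)"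
        using cols j T uA by (simp add: smult_one' subset_iff)
    qed (use T S wA in \<open>auto intro!: M.finsum_closed M.a_closed simp: subset_iff\<close>)
    also have "\<dots> = (\<Oplus>j\<in>T. \<Oplus>i\<in>S. w i j) \<oplus> (\<Oplus>j\<in>T. \<Oplus>i\<in>K - S. w i j)"
      by (rule M.finsum_addf) (use T S wA in \<open>auto intro!: M.finsum_closed simp: subset_iff\<close>)
    finally have eq: "of_nat (card T) \<odot> u = of_nat (card S) \<odot> u \<oplus> (\<Oplus>j\<in>T. \<Oplus>i\<in>K - S. w i j)"
      using part by simp
    have "(\<Oplus>j\<in>T. \<Oplus>i\<in>K - S. w i j) = complex_of_real (real (card T) - real (card S)) \<odot> u"
    proof -
      have "x = y" if "z \<oplus> x = z \<oplus> y" "x \<in> carrier A" "y \<in> carrier A" "z \<in> carrier A" for x y z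
        using that M.add.right_cancel[of z x y] M.a_comm[of z x] M.a_comm[of z y] by simp
      moreover have "of_nat (card S) \<odot> u \<oplus> complex_of_real (real (card T) - real (card S)) \<odot> u = of_nat (card T) \<odot> u"
        using smult_add_left[OF uA, of "of_nat (card S)" "complex_of_real (real (card T) - real (card S))"] by simp
      ultimately show ?thesis using eq rA uA by (metis smult_closed')
    qed
    then have "0 \<le> real (card T) - real (card S)"
      by (rule sum_proj_nonneg[OF u fS(3,2), rotated]) (use w T in auto)
    then show ?thesis by (simp add: T_def)
  qed
  then obtain \<pi> where "inj_on \<pi> K" "\<forall>i\<in>K. \<pi> i \<in> N i"
    using hall_marriage[OF fin(1), of N] fin(2) by (auto simp: N_def)
  then show ?thesis by (auto simp: N_def)
qed

end

section \<open>Quantum isomorphisms between blocks\<close>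

context magic_square begin

text \<open>Cancelling the common sum from two evaluations of its square leaves positive multiples
  of two projections, identified by \<open>proj_smult_eq\<close>. Thus sending \<open>b\<close> into
  \<open>d\<close> and pulling \<open>d\<close> back into \<open>b\<close> are the same
  event.\<close>

lemma hit_hit_transpose:
  assumes d: "Q.clique d" "d \<subseteq> I" "a \<in> d" "c \<in> d" "a \<noteq> c"
    and b: "P.clique b" "b \<subseteq> J" "x \<in> b" "y \<in> b" "x \<noteq> y"
  shows "hit d x \<otimes> hit d y = magic_square.hit A (\<lambda>j i. U i j) b a \<otimes> magic_square.hit A (\<lambda>j i. U i j) b c"
    and "hit d x \<otimes> hit d y \<noteq> \<zero> \<Longrightarrow> card b = card d"
proof -
  interpret T: magic_square A J I "\<lambda>j i. U i j" Q P by (rule magic_square_transpose)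
  let ?q = "hit d x \<otimes> hit d y" and ?r = "T.hit b a \<otimes> T.hit b c"
  have q: "proj ?q" by (rule hit_hit_proj) (use d b in auto)
  have r: "proj ?r" by (rule T.hit_hit_proj) (use d b in auto)
  have fin': "finite b" "finite d" using d b fin finite_subset by blast+
  define S where "S = (\<Oplus>z\<in>b. hit d z)"
  have S': "S = (\<Oplus>e\<in>d. T.hit b e)"
    unfolding S_def hit_def T.hit_def by (rule finsum_swap) (use fin' d b in \<open>auto simp: subset_iff\<close>)
  have SA: "S \<in> carrier A" unfolding S_def using hit_closed d b by (intro M.finsum_closed) auto
  let ?n = "card b * (card b - 1)" and ?m = "card d * (card d - 1)"
  have "of_nat ?n \<odot> ?q \<oplus> S = S \<otimes> S"
    using total_square[OF d(1,2) b] SA q M.a_comm by (simp add: S_def[symmetric] projD)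
  also have "\<dots> = of_nat ?m \<odot> ?r \<oplus> S"
    using T.total_square[OF b(1,2) d] SA r M.a_comm by (simp add: S'[symmetric] projD)
  finally have eq: "of_nat ?n \<odot> ?q = of_nat ?m \<odot> ?r"
    by (rule iffD1[OF M.add.right_cancel, rotated 3]) (use SA q r projD in auto)
  have card: "card b \<ge> 2" "card d \<ge> 2"
    using card_mono[OF fin'(1), of "{x, y}"] card_mono[OF fin'(2), of "{a, c}"] b d by auto
  then have pos: "?n > 0" "?m > 0" by auto
  show "?q = ?r" using proj_smult_eq(1)[OF q r eq pos] .
  assume "?q \<noteq> \<zero>"
  then have nm: "?n = ?m" using proj_smult_eq(2)[OF q r eq pos] by blast
  \<comment> \<open>The multiplicity counts ordered pairs of distinct vertices, which determines the
    number of vertices once there are at least two.\<close>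
  have lt: "k * (k - 1) < l * (l - 1)" if "k < l" "2 \<le> k" for k l :: nat
    using that by (intro mult_strict_mono) auto
  show "card b = card d"
    using lt[of "card b" "card d"] lt[of "card d" "card b"] nm card by (metis less_irrefl linorder_neqE_nat)
qed

text \<open>\<open>q\<close> can be written with \<open>hit d z\<close> as first factor for any
  \<open>z\<close> in \<open>b\<close>, and by \<open>hit_hit_transpose\<close> with
  \<open>T.hit b e\<close> as first factor for any \<open>e\<close> in \<open>d\<close>. So column
  sums and row sums both act as the unit on \<open>q\<close>.\<close>

lemma block_magic_unitary:
  assumes d: "Q.clique d" "d \<subseteq> I" "a \<in> d" "c \<in> d" "a \<noteq> c"
    and b: "P.clique b" "b \<subseteq> J" "x \<in> b" "y \<in> b" "x \<noteq> y"
    and nz: "hit d x \<otimes> hit d y \<noteq> \<zero>"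
  defines "q \<equiv> hit d x \<otimes> hit d y"
  shows "magic_unitary (corner A q) d b (\<lambda>e z. U e z \<otimes> q)"
    and "e \<in> d \<Longrightarrow> z \<in> b \<Longrightarrow> q \<otimes> U e z = U e z \<otimes> q"
proof -
  interpret T: magic_square A J I "\<lambda>j i. U i j" Q P by (rule magic_square_transpose)
  have q: "proj q" "q \<noteq> \<zero>" using hit_hit_proj[OF d(1,2) b] nz by (auto simp: q_def)
  have qA: "q \<in> carrier A" "q \<otimes> q = q" using q projD by auto
  have fin': "finite b" "finite d" using d b fin finite_subset by blast+
  have UA: "U e z \<in> carrier A" if "e \<in> d" "z \<in> b" for e z
    by (rule U_closed) (use that d b in auto)
  have other: "\<exists>w\<in>b. z \<noteq> w" for z using b(3-5) by metis
  have otherd: "\<exists>f\<in>d. e \<noteq> f" for e using d(3-5) by metis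
  have qeq: "q = hit d z \<otimes> hit d w" if "z \<in> b" "w \<in> b" "z \<noteq> w" for z w
    unfolding q_def by (rule hit_hit_const[OF d(1,2) b that])
  have req: "q = T.hit b e \<otimes> T.hit b f" if "e \<in> d" "f \<in> d" "e \<noteq> f" for e f
    unfolding q_def by (rule hit_hit_transpose(1)[OF d(1,2) that b])
  show comm: "q \<otimes> U e z = U e z \<otimes> q" if "e \<in> d" "z \<in> b" for e z
  proof -
    obtain w where "w \<in> b" "z \<noteq> w" using other by blast
    then show ?thesis
      using U_commute_hit_hit(2)[OF d(1,2) that(1) b(1,2) that(2)] qeq[OF that(2)] by metis
  qed
  note cs = corner_simps[OF q]
  have C: "U e z \<otimes> q \<in> carrier (corner A q)" if "e \<in> d" "z \<in> b" for e z
  proof -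
    have "q \<otimes> (U e z \<otimes> q) = (q \<otimes> U e z) \<otimes> q" using UA[OF that] qA by (simp add: m_assoc)
    also have "\<dots> = U e z \<otimes> (q \<otimes> q)" unfolding comm[OF that] using UA[OF that] qA(1) by (simp add: m_assoc)
    finally show ?thesis using UA[OF that] qA by (simp add: cs(1) m_assoc)
  qed
  have P: "proj (U e z \<otimes> q)" if "e \<in> d" "z \<in> b" for e z
    by (rule proj_mult_commute[OF U_proj q(1) comm[symmetric]]) (use that d b in auto)
  have col: "(\<Oplus>\<^bsub>corner A q\<^esub>e\<in>d. U e z \<otimes> q) = q" if z: "z \<in> b" for z
  proof -
    obtain w where w: "w \<in> b" "z \<noteq> w" using other by blast
    have "(\<Oplus>\<^bsub>corner A q\<^esub>e\<in>d. U e z \<otimes> q) = (\<Oplus>e\<in>d. U e z \<otimes> q)"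
      by (rule corner_finsum[OF q]) (use C z in auto)
    also have "\<dots> = hit d z \<otimes> q" using hit_mult[of d z q] d b z qA by auto
    also have "\<dots> = q" unfolding qeq[OF z w]
      using hit_closed[OF d(2)] hit_idem[OF d(2)] b(2) z w by (simp add: m_assoc[symmetric] subset_iff)
    finally show ?thesis .
  qed
  have row: "(\<Oplus>\<^bsub>corner A q\<^esub>z\<in>b. U e z \<otimes> q) = q" if e: "e \<in> d" for e
  proof -
    obtain f where f: "f \<in> d" "e \<noteq> f" using otherd by blast
    have "(\<Oplus>\<^bsub>corner A q\<^esub>z\<in>b. U e z \<otimes> q) = (\<Oplus>z\<in>b. U e z \<otimes> q)"
      by (rule corner_finsum[OF q]) (use C e in auto)
    also have "\<dots> = T.hit b e \<otimes> q" using T.hit_mult[of b e q] d b e qA by auto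
    also have "\<dots> = q" unfolding req[OF e f]
      using T.hit_closed[OF b(2)] T.hit_idem[OF b(2)] d(2) e f by (simp add: m_assoc[symmetric] subset_iff)
    finally show ?thesis .
  qed
  show "magic_unitary (corner A q) d b (\<lambda>e z. U e z \<otimes> q)"
    unfolding magic_unitary_def cs(2,3,7) using fin' C col row projD[OF P] by blast
qed

text \<open>The sets \<open>D k\<close> without \<open>a\<close> partition the
  \<open>Q\<close>-neighbours of \<open>a\<close>. In the expansion of \<open>U a x\<close> along
  column \<open>y\<close> all other terms vanish: \<open>c = a\<close> by row orthogonality,
  non-neighbours because \<open>P x y\<close> holds.\<close>

lemma sum_blocks_at:
  assumes K: "finite K" and a: "a \<in> I" and xy: "x \<in> J" "y \<in> J" "P x y"
    and D: "\<And>k. k \<in> K \<Longrightarrow> Q.clique (D k) \<and> D k \<subseteq> I \<and> a \<in> D k"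
    and ex1: "\<And>c. c \<in> I \<Longrightarrow> Q a c \<Longrightarrow> \<exists>k\<in>K. c \<in> D k"
    and uniq: "\<And>c k k'. k \<in> K \<Longrightarrow> k' \<in> K \<Longrightarrow> c \<in> D k \<Longrightarrow> c \<in> D k' \<Longrightarrow> c \<noteq> a \<Longrightarrow> k = k'"
  shows "(\<Oplus>k\<in>K. U a x \<otimes> hit (D k) y) = U a x"
proof -
  let ?g = "\<lambda>c. U a x \<otimes> U c y"
  have gA: "?g c \<in> carrier A" if "c \<in> I" for c using a xy that by simp
  have ne: "x \<noteq> y" using xy(3) P.rel_irrefl by blast
  have ga: "?g a = \<zero>" using row_orthogonal[OF a xy(1,2) ne] .
  have DI: "D k \<subseteq> I" "finite (D k)" if "k \<in> K" for k using D[OF that] finite_sub by blast+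
  have "(\<Oplus>k\<in>K. U a x \<otimes> hit (D k) y) = (\<Oplus>k\<in>K. \<Oplus>c\<in>D k - {a}. ?g c)"
  proof (rule M.finsum_cong')
    fix k assume k: "k \<in> K"
    have "U a x \<otimes> hit (D k) y = (\<Oplus>c\<in>D k. ?g c)" using mult_hit[OF DI(1)[OF k] xy(2)] a xy by simp
    also have "\<dots> = (\<Oplus>c\<in>D k - {a}. ?g c)"
      by (rule M.add.finprod_mono_neutral_cong_right) (use DI[OF k] ga gA in auto)
    finally show "U a x \<otimes> hit (D k) y = (\<Oplus>c\<in>D k - {a}. ?g c)" .
  qed (use DI gA in \<open>auto intro!: M.finsum_closed simp: subset_iff\<close>)
  also have "\<dots> = (\<Oplus>c\<in>(\<Union>k\<in>K. D k - {a}). ?g c)"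
    by (rule M.add.finprod_UN_disjoint[symmetric])
       (use K DI gA uniq in \<open>auto simp: pairwise_def disjnt_def subset_iff\<close>)
  also have "\<dots> = (\<Oplus>c\<in>I. ?g c \<otimes> \<one>)"
  proof (rule M.add.finprod_mono_neutral_cong_left)
    fix c assume c: "c \<in> I - (\<Union>k\<in>K. D k - {a})"
    have "?g c = \<zero>"
    proof (rule ccontr)
      assume nz: "?g c \<noteq> \<zero>"
      then have "Q a c" using P_iff_Q[of a c x y] a c xy by blast
      moreover have "c \<noteq> a" using nz ga by blast
      ultimately show False using ex1[of c] c by blast
    qed
    then show "?g c \<otimes> \<one> = \<zero>" by simp
  qed (use fin DI gA in \<open>auto simp: subset_iff\<close>)
  also have "\<dots> = U a x \<otimes> \<one>" using sum_column_between[OF xy(2), of "U a x" \<one>] a xy by simp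
  finally show ?thesis using a xy by simp
qed

end

text \<open>Expanding by column \<open>j\<close> on the left and row \<open>i\<close> on the right
  turns both sides into sums of \<open>U i z\<close> times \<open>U c j\<close>, restricted by
  \<open>E z j\<close> and by \<open>F i c\<close>; these restrictions agree on nonzero
  terms.\<close>

lemma (in magic) intertwineI:
  assumes "\<And>i i' j j'. i \<in> I \<Longrightarrow> i' \<in> I \<Longrightarrow> j \<in> J \<Longrightarrow> j' \<in> J \<Longrightarrow> U i j \<otimes> U i' j' \<noteq> \<zero> \<Longrightarrow> E j j' \<longleftrightarrow> F i i'"
    and "i \<in> I" "j \<in> J"
  shows "(\<Oplus>k\<in>J. U i k \<otimes> (if E k j then \<one> else \<zero>)) = (\<Oplus>k\<in>I. (if F i k then \<one> else \<zero>) \<otimes> U k j)"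
proof -
  let ?t = "\<lambda>z c. if E z j then U i z \<otimes> U c j else \<zero>"
  have t: "?t z c = (if F i c then U i z \<otimes> U c j else \<zero>)" if "z \<in> J" "c \<in> I" for z c
    using assms(1)[OF assms(2) that(2,1) assms(3)] by (cases "U i z \<otimes> U c j = \<zero>") simp_all
  have tA: "?t z c \<in> carrier A" if "z \<in> J" "c \<in> I" for z c using that assms(2,3) by simp
  have "(\<Oplus>z\<in>J. U i z \<otimes> (if E z j then \<one> else \<zero>)) = (\<Oplus>z\<in>J. \<Oplus>c\<in>I. ?t z c)"
  proof (rule M.finsum_cong')
    fix z assume z: "z \<in> J"
    have "(\<Oplus>c\<in>I. U i z \<otimes> U c j) = (\<Oplus>c\<in>I. U i z \<otimes> U c j \<otimes> \<one>)"
      by (rule M.finsum_cong') (use z assms(2,3) in auto)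
    also have "\<dots> = U i z" using sum_column_between[OF assms(3), of "U i z" \<one>] z assms(2) by simp
    finally show "U i z \<otimes> (if E z j then \<one> else \<zero>) = (\<Oplus>c\<in>I. ?t z c)"
      using z assms(2) by (simp add: M.finsum_zero)
  qed (use tA in \<open>auto intro!: M.finsum_closed\<close>)
  also have "\<dots> = (\<Oplus>c\<in>I. \<Oplus>z\<in>J. ?t z c)"
    by (rule finsum_swap) (use fin tA in auto)
  also have "\<dots> = (\<Oplus>c\<in>I. (if F i c then \<one> else \<zero>) \<otimes> U c j)"
  proof (rule M.finsum_cong')
    fix c assume c: "c \<in> I"
    have cj: "U c j \<in> carrier A" using c assms(3) by (rule U_closed)
    show "(\<Oplus>z\<in>J. ?t z c) = (if F i c then \<one> else \<zero>) \<otimes> U c j"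
    proof (cases "F i c")
      case True
      have "(\<Oplus>z\<in>J. ?t z c) = (\<Oplus>z\<in>J. \<one> \<otimes> U i z \<otimes> U c j)"
      proof (rule M.finsum_cong')
        fix z assume z: "z \<in> J"
        then have "U i z \<in> carrier A" using assms(2) by simp
        then show "?t z c = \<one> \<otimes> U i z \<otimes> U c j" unfolding t[OF z c] by (simp only: True if_True l_one)
      qed (use assms(2) cj in auto)
      then show ?thesis using sum_row_between[OF assms(2) one_closed cj] True by simp
    next
      case False
      then have "?t z c = \<zero>" if "z \<in> J" for z unfolding t[OF that c] by (simp only: if_False)
      then have "(\<Oplus>z\<in>J. ?t z c) = \<zero>" by (rule finsum_neutral)
      then show ?thesis using False cj by simp
    qed
  qed (use assms(3) in auto)
  finally show ?thesis .
qed

lemma square_closed_biconnected: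
  assumes "sym E" shows "square_closed (biconnected V E)"
proof (rule square_closed.intro)
  fix x y a b c d
  show "biconnected V E x y \<Longrightarrow> biconnected V E y x" by (rule biconnected_sym[OF assms])
  show "\<not> biconnected V E x x" by (rule biconnected_irrefl)
  show "biconnected V E a c \<Longrightarrow> biconnected V E c b \<Longrightarrow> biconnected V E a d \<Longrightarrow> biconnected V E d b \<Longrightarrow>
      a \<noteq> b \<Longrightarrow> c \<noteq> d \<Longrightarrow> biconnected V E a b" by (rule biconnected_square[OF assms])
qed

sublocale quantum_iso \<subseteq> magic_square A "verts H" "verts G" U
  "biconnected (verts G) (arcs_ends G)" "biconnected (verts H) (arcs_ends H)"
  by (intro magic_square.intro magic_axioms square_closed_biconnected graph_symE graph_G graph_H
      magic_square_axioms.intro biconnected_iff)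

context quantum_iso begin

lemma quantum_isomorphic_blocks:
  assumes d: "Q.clique d" "d \<subseteq> verts H" "a \<in> d" "c \<in> d" "a \<noteq> c"
    and b: "P.clique b" "b \<subseteq> verts G" "x \<in> b" "y \<in> b" "x \<noteq> y"
    and nz: "hit d x \<otimes> hit d y \<noteq> \<zero>"
  shows "quantum_isomorphic (G \<restriction> b) (H \<restriction> d)"
proof -
  define q where "q = hit d x \<otimes> hit d y"
  have q: "proj q" "q \<noteq> \<zero>" using hit_hit_proj[OF d(1,2) b] nz by (auto simp: q_def)
  have qA: "q \<in> carrier A" using q projD by auto
  note mu = block_magic_unitary(1)[OF d b nz, folded q_def]
  note comm = block_magic_unitary(2)[OF d b nz, folded q_def]
  note cs = corner_simps[OF q]
  interpret C: unital_cstar_algebra "corner A q" by (rule cstar_corner[OF q])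
  interpret C: magic "corner A q" d b "\<lambda>e z. U e z \<otimes> q" by unfold_locales (rule mu)
  \<comment> \<open>As \<open>q\<close> commutes with the entries, a nonzero product in the corner
    stems from a nonzero product of entries of \<open>U\<close>, to which \<open>edge_iff\<close>
    applies.\<close>
  have edge: "z \<rightarrow>\<^bsub>G \<restriction> b\<^esub> z' \<longleftrightarrow> e \<rightarrow>\<^bsub>H \<restriction> d\<^esub> e'"
    if e: "e \<in> d" "e' \<in> d" "z \<in> b" "z' \<in> b"
      and "(U e z \<otimes> q) \<otimes>\<^bsub>corner A q\<^esub> (U e' z' \<otimes> q) \<noteq> \<zero>\<^bsub>corner A q\<^esub>" for e e' z z'
  proof -
    have UA: "U e z \<in> carrier A" "U e' z' \<in> carrier A"
      by (rule U_closed; use e d b in blast)+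
    have "(U e z \<otimes> q) \<otimes> (U e' z' \<otimes> q) = U e z \<otimes> (q \<otimes> U e' z') \<otimes> q" using UA qA by (simp add: m_assoc)
    also have "\<dots> = U e z \<otimes> U e' z' \<otimes> q \<otimes> q" using UA qA by (simp add: comm e m_assoc)
    finally have "U e z \<otimes> U e' z' \<noteq> \<zero>" using that(5) qA by (auto simp: cs(2,4))
    then have "z \<rightarrow>\<^bsub>G\<^esub> z' \<longleftrightarrow> e \<rightarrow>\<^bsub>H\<^esub> e'" using edge_iff[of e e' z z'] e d b by blast
    then show ?thesis using e by (simp add: arcs_ends_induce)
  qed
  have "quantum_isomorphism (corner A q) (G \<restriction> b) (H \<restriction> d) (\<lambda>e z. U e z \<otimes> q)"
    unfolding quantum_isomorphism_def induce_subgraph_verts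
  proof (intro conjI ballI mu)
    show "card b = card d" by (rule hit_hit_transpose(2)[OF d b nz])
    fix e z assume "e \<in> d" "z \<in> b"
    then show "matrix_prod (corner A q) b (\<lambda>e z. U e z \<otimes> q) (adj_matrix (corner A q) (G \<restriction> b)) e z =
        matrix_prod (corner A q) d (adj_matrix (corner A q) (H \<restriction> d)) (\<lambda>e z. U e z \<otimes> q) e z"
      unfolding matrix_prod_def adj_matrix_def by (intro C.intertwineI) (rule edge)
  qed
  then show ?thesis by (rule quantum_isomorphicI[OF cstar_corner[OF q]])
qed

end

theorem theorem5p5:
  fixes G :: "('v, 'e) pre_digraph" and H :: "('w, 'f) pre_digraph"
    and A :: "'x cstar" and U :: "'w \<Rightarrow> 'v \<Rightarrow> 'x"
    and b :: "nat \<Rightarrow> ('v, 'e) pre_digraph" and d :: "nat \<Rightarrow> ('w, 'f) pre_digraph"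
    and k l :: nat and x :: 'v and a :: 'w
  assumes "Digraph.graph G" and "Digraph.graph H"
    and "unital_cstar_algebra A"
    and "quantum_isomorphism A G H U"
    and "x \<in> verts G"
    and "bij_betw b {1..k} {B. block G B \<and> x \<in> verts B}"
    and "a \<in> verts H"
    and "bij_betw d {1..l} {D. block H D \<and> a \<in> verts D}"
    and "U a x \<noteq> \<zero>\<^bsub>A\<^esub>"
  shows "k = l \<and>
    (\<exists>\<pi>. \<pi> permutes {1..k} \<and>
      (\<forall>i\<in>{1..k}. quantum_isomorphic (G \<restriction> verts (b i)) (H \<restriction> verts (d (\<pi> i)))))"
proof -
  interpret quantum_iso A G H U
    by (intro quantum_iso.intro magic.intro magic_axioms.intro quantum_iso_axioms.intro assms(1-3))
       (use assms(4) in \<open>unfold quantum_isomorphism_def, blast+\<close>)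
  interpret T: magic_square A "verts G" "verts H" "\<lambda>j i. U i j"
    "biconnected (verts H) (arcs_ends H)" "biconnected (verts G) (arcs_ends G)"
    by (rule magic_square_transpose)
  interpret G: Digraph.graph G by fact
  interpret H: Digraph.graph H by fact
  let ?K = "{1..k}" and ?L = "{1..l}"
  let ?B = "\<lambda>i. verts (b i)" and ?D = "\<lambda>j. verts (d j)"
  let ?u = "U a x"
  have bG: "block G (b i)" "x \<in> ?B i" if "i \<in> ?K" for i
    using bij_betwE[OF assms(6)] that by blast+
  have dH: "block H (d j)" "a \<in> ?D j" if "j \<in> ?L" for j
    using bij_betwE[OF assms(8)] that by blast+
  have B: "P.clique (?B i)" "?B i \<subseteq> verts G" if "i \<in> ?K" for i
    unfolding P.clique_def
    using G.block_biconnected[OF bG(1)[OF that]] G.block_closed[OF bG(1)[OF that]]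
      G.block_subset[OF bG(1)[OF that]] by blast+
  have D: "Q.clique (?D j)" "?D j \<subseteq> verts H" if "j \<in> ?L" for j
    unfolding Q.clique_def
    using H.block_biconnected[OF dH(1)[OF that]] H.block_closed[OF dH(1)[OF that]]
      H.block_subset[OF dH(1)[OF that]] by blast+
  have uniqB: "i = i'" if "i \<in> ?K" "i' \<in> ?K" "c \<in> ?B i" "c \<in> ?B i'" "c \<noteq> x" for c i i'
    using G.block_unique[of "b i" "b i'" c x] bG that bij_betw_imp_inj_on[OF assms(6)]
    by (metis IntI empty_subsetI inj_on_eq_iff insert_subset)
  have uniqD: "j = j'" if "j \<in> ?L" "j' \<in> ?L" "c \<in> ?D j" "c \<in> ?D j'" "c \<noteq> a" for c j j'
    using H.block_unique[of "d j" "d j'" c a] dH that bij_betw_imp_inj_on[OF assms(8)]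
    by (metis IntI empty_subsetI inj_on_eq_iff insert_subset)
  have exB: "\<exists>i\<in>?K. c \<in> ?B i" if xc: "biconnected (verts G) (arcs_ends G) x c" for c
  proof -
    obtain C where C: "block G C" "x \<in> verts C" "c \<in> verts C" using G.ex_block[OF xc] .
    then have "C \<in> b ` ?K" using bij_betw_imp_surj_on[OF assms(6)] by blast
    then show ?thesis using C(3) by blast
  qed
  have exD: "\<exists>j\<in>?L. c \<in> ?D j" if ac: "biconnected (verts H) (arcs_ends H) a c" for c
  proof -
    obtain C where C: "block H C" "a \<in> verts C" "c \<in> verts C" using H.ex_block[OF ac] .
    then have "C \<in> d ` ?L" using bij_betw_imp_surj_on[OF assms(8)] by blast
    then show ?thesis using C(3) by blast
  qed
  have "\<exists>y. y \<in> ?B i \<and> y \<noteq> x" if "i \<in> ?K" for i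
    using G.block_other_vertex[OF bG[OF that]] by blast
  then obtain y where y: "\<And>i. i \<in> ?K \<Longrightarrow> y i \<in> ?B i" "\<And>i. i \<in> ?K \<Longrightarrow> y i \<noteq> x" by metis
  have "\<exists>c. c \<in> ?D j \<and> c \<noteq> a" if "j \<in> ?L" for j
    using H.block_other_vertex[OF dH[OF that]] by blast
  then obtain c where c: "\<And>j. j \<in> ?L \<Longrightarrow> c j \<in> ?D j" "\<And>j. j \<in> ?L \<Longrightarrow> c j \<noteq> a" by metis

  \<comment> \<open>With \<open>x\<close> itself as one of the two vertices, \<open>q i j\<close>
    commutes with \<open>?u\<close>, since \<open>a\<close> lies in \<open>?D j\<close>;
    \<open>y i\<close> and \<open>c j\<close> are arbitrary second vertices.\<close>
  define q where "q i j = hit (?D j) x \<otimes>\<^bsub>A\<^esub> hit (?D j) (y i)" for i j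
  define w where "w i j = ?u \<otimes>\<^bsub>A\<^esub> q i j" for i j
  have q: "proj (q i j)" "?u \<otimes>\<^bsub>A\<^esub> q i j = q i j \<otimes>\<^bsub>A\<^esub> ?u" "w i j = ?u \<otimes>\<^bsub>A\<^esub> hit (?D j) (y i)"
    if "i \<in> ?K" "j \<in> ?L" for i j
    unfolding w_def q_def
    using hit_hit_proj[OF D[OF that(2)] B[OF that(1)] bG(2)[OF that(1)] y(1)[OF that(1)]]
      U_commute_hit_hit[OF D[OF that(2)] dH(2)[OF that(2)] B[OF that(1)] bG(2)[OF that(1)] y(1)[OF that(1)]]
      y(2)[OF that(1)]
    by auto
  \<comment> \<open>The same projections seen from the transposed matrix, so that column sums follow
    from \<open>T.sum_blocks_at\<close> just as row sums do from
    \<open>sum_blocks_at\<close>.\<close>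
  have wT: "w i j = ?u \<otimes>\<^bsub>A\<^esub> T.hit (?B i) (c j)" if "i \<in> ?K" "j \<in> ?L" for i j
  proof -
    have "q i j = T.hit (?B i) a \<otimes>\<^bsub>A\<^esub> T.hit (?B i) (c j)"
      unfolding q_def
      by (rule hit_hit_transpose(1)[OF D[OF that(2)] dH(2)[OF that(2)] c(1)[OF that(2)] c(2)[OF that(2), symmetric]
            B[OF that(1)] bG(2)[OF that(1)] y(1)[OF that(1)] y(2)[OF that(1), symmetric]])
    then show ?thesis
      unfolding w_def
      using T.U_commute_hit_hit(1)[OF B[OF that(1)] bG(2)[OF that(1)] D[OF that(2)] dH(2)[OF that(2)] c(1)[OF that(2)]]
        c(2)[OF that(2)] by auto
  qed
  have u: "proj ?u" "?u \<noteq> \<zero>\<^bsub>A\<^esub>" using U_proj assms(5,7,9) by auto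
  have w: "proj (w i j) \<and> ?u \<otimes>\<^bsub>A\<^esub> w i j = w i j \<and> w i j \<otimes>\<^bsub>A\<^esub> ?u = w i j"
    if "i \<in> ?K" "j \<in> ?L" for i j
  proof (intro conjI)
    have uA: "?u \<in> carrier A" "?u \<otimes>\<^bsub>A\<^esub> ?u = ?u" and qA: "q i j \<in> carrier A"
      using u q(1)[OF that] projD by blast+
    show "proj (w i j)" unfolding w_def by (rule proj_mult_commute[OF u(1) q(1,2)[OF that]])
    show *: "?u \<otimes>\<^bsub>A\<^esub> w i j = w i j"
      unfolding w_def using m_assoc[OF uA(1) uA(1) qA] uA(2) by simp
    show "w i j \<otimes>\<^bsub>A\<^esub> ?u = w i j"
      using * m_assoc[OF uA(1) qA uA(1)] q(2)[OF that] by (simp add: w_def)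
  qed
  have rows: "(\<Oplus>\<^bsub>A\<^esub>j\<in>?L. w i j) = ?u" if i: "i \<in> ?K" for i
  proof -
    have yi: "y i \<in> verts G" "biconnected (verts G) (arcs_ends G) x (y i)"
      using B[OF i] bG(2)[OF i] y[OF i] P.clique_rel by (blast, metis)
    have "(\<Oplus>\<^bsub>A\<^esub>j\<in>?L. w i j) = (\<Oplus>\<^bsub>A\<^esub>j\<in>?L. ?u \<otimes>\<^bsub>A\<^esub> hit (?D j) (y i))"
    proof (rule M.finsum_cong'[OF refl])
      show "(\<lambda>j. ?u \<otimes>\<^bsub>A\<^esub> hit (?D j) (y i)) \<in> ?L \<rightarrow> carrier A"
        using u(1) projD hit_closed D(2) yi(1) by (intro Pi_I m_closed) auto
    qed (rule q(3)[OF i])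
    also have "\<dots> = ?u"
      by (rule sum_blocks_at[OF _ assms(7,5) yi]) (use D dH exD uniqD in blast)+
    finally show ?thesis .
  qed
  have cols: "(\<Oplus>\<^bsub>A\<^esub>i\<in>?K. w i j) = ?u" if j: "j \<in> ?L" for j
  proof -
    have cj: "c j \<in> verts H" "biconnected (verts H) (arcs_ends H) a (c j)"
      using D[OF j] dH(2)[OF j] c[OF j] Q.clique_rel by (blast, metis)
    have "(\<Oplus>\<^bsub>A\<^esub>i\<in>?K. w i j) = (\<Oplus>\<^bsub>A\<^esub>i\<in>?K. ?u \<otimes>\<^bsub>A\<^esub> T.hit (?B i) (c j))"
    proof (rule M.finsum_cong'[OF refl])
      show "(\<lambda>i. ?u \<otimes>\<^bsub>A\<^esub> T.hit (?B i) (c j)) \<in> ?K \<rightarrow> carrier A"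
        using u(1) projD T.hit_closed B(2) cj(1) by (intro Pi_I m_closed) auto
    qed (rule wT[OF _ j])
    also have "\<dots> = ?u"
      by (rule T.sum_blocks_at[OF _ assms(5,7) cj]) (use B bG exB uniqB in blast)+
    finally show ?thesis .
  qed
  obtain \<pi> where p: "inj_on \<pi> ?K" "\<And>i. i \<in> ?K \<Longrightarrow> \<pi> i \<in> ?L" "\<And>i. i \<in> ?K \<Longrightarrow> w i (\<pi> i) \<noteq> \<zero>\<^bsub>A\<^esub>"
    using magic_matching_inj[OF u _ _ w rows cols] by auto
  \<comment> \<open>This injection in the opposite direction gives \<open>l \<le> k\<close>.\<close>
  obtain \<rho> where r: "inj_on \<rho> ?L" "\<And>j. j \<in> ?L \<Longrightarrow> \<rho> j \<in> ?K"
    using magic_matching_inj[OF u _ _ w cols rows] by auto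
  have "card ?K \<le> card ?L" using p by (intro card_inj_on_le[of \<pi>]) auto
  moreover have "card ?L \<le> card ?K" using r by (intro card_inj_on_le[of \<rho>]) auto
  ultimately have kl: "k = l" by simp
  \<comment> \<open>\<open>permutes\<close> demands the identity outside \<open>?K\<close>, where
    nothing is known about \<open>\<pi>\<close>.\<close>
  define \<sigma> where "\<sigma> i = (if i \<in> ?K then \<pi> i else i)" for i
  have "\<pi> ` ?K = ?K"
    by (rule endo_inj_surj) (use p kl in auto)
  then have "bij_betw \<pi> ?K ?K" using p(1) by (simp add: bij_betw_def)
  then have "bij_betw \<sigma> ?K ?K" by (rule bij_betw_cong[THEN iffD1, rotated]) (simp add: \<sigma>_def)
  then have "\<sigma> permutes ?K" by (rule bij_imp_permutes) (simp only: \<sigma>_def if_False)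
  moreover have "quantum_isomorphic (G \<restriction> ?B i) (H \<restriction> ?D (\<sigma> i))" if i: "i \<in> ?K" for i
  proof -
    have j: "\<pi> i \<in> ?L" using p(2) i .
    have uA: "?u \<in> carrier A" using u(1) projD by blast
    have "q i (\<pi> i) \<noteq> \<zero>\<^bsub>A\<^esub>" using p(3)[OF i] uA by (auto simp: w_def)
    then have "quantum_isomorphic (G \<restriction> ?B i) (H \<restriction> ?D (\<pi> i))"
      by (intro quantum_isomorphic_blocks[OF D[OF j] dH(2)[OF j] c(1)[OF j] c(2)[OF j, symmetric]
            B[OF i] bG(2)[OF i] y(1)[OF i] y(2)[OF i, symmetric]]) (simp add: q_def)
    then show ?thesis using i by (simp add: \<sigma>_def)
  qed
  ultimately show ?thesis using kl by blast
qed

end
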